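(* Let $k$ be a field of characteristic $0$, let $H$ be a primitively generated bialgebra over $k$, and let $p\in H^{*}$. Then the following are equivalent: 1. $p$ has finite Lie rank; 2. $p$ is differentially produced by some augmented $k$-algebra $R$ (with augmentation $\epsilon: R\to k$) for which $\dim_k\,(\ker\epsilon)/(\ker\epsilon)^2$ is finite; 3. $p$ is differentially produced by a subalgebra of $H^{*}$ which is isomorphic to $k[[x_1,\ldots,x_N]]$, the algebra of formal power series in $N$ variables (for some integer $N\ge 0$).
   Context: An algebra over $k$ means an associative algebra with identity (not necessarily commutative); an augmentation of an algebra $A$ is an algebra homomorphism $A\to k$, and an augmented algebra is an algebra equipped with an augmentation. A bialgebra $H$ is a vector space with an algebra structure and a coalgebra structure (comultiplication $\Delta$, counit $\epsilon$) such that $\Delta$ and $\epsilon$ are algebra homomorphisms; write $\Delta(h)=\sum_{(h)}h_{(1)}\otimes h_{(2)}$. The space of primitive elements is $P(H)=\{h\in H\mid \Delta(h)=1\otimes h+h\otimes 1\}$, and $H$ is primitively generated if it is generated as an algebra by $P(H)$. $H^{*}$ is the space of all $k$-linear maps $H\to k$, with the algebra structure dual to the coalgebra structure of $H$ (the convolution product $(pq)(h)=\sum_{(h)}p(h_{(1)})q(h_{(2)})$, with identity the counit of $H$). For $h\in H$ and $p\in H^{*}$, define $h\rightharpoonup p\in H^{*}$ by $(h\rightharpoonup p)(g)=p(gh)$ for $g\in H$. The element $p\in H^{*}$ has finite Lie rank if the vector space $P(H)\rightharpoonup p=\{h\rightharpoonup p\mid h\in P(H)\}$ is finite dimensional. A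 right $H$-module algebra is an algebra $A$ that is a right $H$-module such that $(ab)\cdot h=\sum_{(h)}(a\cdot h_{(1)})(b\cdot h_{(2)})$ for all $a,b\in A$, $h\in H$. The element $p\in H^{*}$ is differentially produced by the algebra $R$ with the augmentation $\epsilon: R\to k$ if (i) there is a right $H$-module algebra structure on $R$, and (ii) there exists $f\in R$ satisfying $p(h)=\epsilon(f\cdot h)$ for all $h\in H$. It is differentially produced by $R$ if this holds with some augmentation of $R$. *)

theory Defs
  imports
    "HOL-Algebra.Module"
    "HOL-Algebra.Subrings"
    "HOL-Algebra.QuotRing"
    "HOL-Algebra.Ideal_Product"
    "HOL-Library.Poly_Mapping"
begin

text \<open>
  Conventions.  The ground field is a type \<open>'k\<close> of class \<open>field\<close>.  Vector spaces and (associative,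
  unital, not necessarily commutative) algebras are records of type \<open>('k, 'a) module\<close> with an
  explicit carrier, so that one can quantify over algebras and form subalgebras, tensor products
  and quotients.  Only the bialgebra, which is fixed once and for all, is the full type
  \<open>'h::ring_1\<close> with a scalar multiplication \<open>scale\<close>.  Records that only serve as vector
  spaces have an irrelevant multiplicative part.
\<close>

section \<open>Vector spaces and algebras\<close>

definition type_algebra :: "('k::field \<Rightarrow> 'a::ring_1 \<Rightarrow> 'a) \<Rightarrow> ('k, 'a) module" where
  "type_algebra scale =
     \<lparr>carrier = UNIV, mult = (*), one = 1, zero = 0, add = (+), smult = scale\<rparr>"

definition scalars :: "('k::field, 'k) module" where
  "scalars = type_algebra (*)"

locale k_algebra = ring A + module scalars A
  for A :: "('k::field, 'a) module" (structure) +
  assumes smult_mult_left: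
      "\<lbrakk>x \<in> carrier A; y \<in> carrier A\<rbrakk> \<Longrightarrow> (c \<odot> x) \<otimes> y = c \<odot> (x \<otimes> y)"
    and smult_mult_right:
      "\<lbrakk>x \<in> carrier A; y \<in> carrier A\<rbrakk> \<Longrightarrow> x \<otimes> (c \<odot> y) = c \<odot> (x \<otimes> y)"

definition alg_hom :: "('k::field, 'a) module \<Rightarrow> ('k, 'b) module \<Rightarrow> ('a \<Rightarrow> 'b) set" where
  "alg_hom A B =
     {\<phi> \<in> ring_hom A B. \<forall>c. \<forall>x\<in>carrier A. \<phi> (c \<odot>\<^bsub>A\<^esub> x) = c \<odot>\<^bsub>B\<^esub> \<phi> x}"

definition alg_iso :: "('k::field, 'a) module \<Rightarrow> ('k, 'b) module \<Rightarrow> ('a \<Rightarrow> 'b) set" where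
  "alg_iso A B = {\<phi> \<in> alg_hom A B. bij_betw \<phi> (carrier A) (carrier B)}"

definition is_subalgebra :: "'a set \<Rightarrow> ('k::field, 'a) module \<Rightarrow> bool" where
  "is_subalgebra S A \<longleftrightarrow> subring S A \<and> (\<forall>c. \<forall>x\<in>S. c \<odot>\<^bsub>A\<^esub> x \<in> S)"

definition generated_subalgebra :: "('k::field, 'a) module \<Rightarrow> 'a set \<Rightarrow> 'a set" where
  "generated_subalgebra A X = \<Inter>{S. is_subalgebra S A \<and> X \<subseteq> S}"

definition augmented_algebra :: "('k::field, 'a) module \<Rightarrow> ('a \<Rightarrow> 'k) \<Rightarrow> bool" where
  "augmented_algebra A \<eta> \<longleftrightarrow> k_algebra A \<and> \<eta> \<in> alg_hom A scalars"

definition finite_dimensional :: "('k::field, 'v) module \<Rightarrow> bool" where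
  "finite_dimensional V \<longleftrightarrow>
     (\<exists>B. finite B \<and> B \<subseteq> carrier V \<and>
          (\<forall>v\<in>carrier V. \<exists>c. v = (\<Oplus>\<^bsub>V\<^esub>b\<in>B. c b \<odot>\<^bsub>V\<^esub> b)))"

definition subspace_of :: "('k::field, 'v) module \<Rightarrow> 'v set \<Rightarrow> ('k, 'v) module" where
  "subspace_of V S = V\<lparr>carrier := S\<rparr>"

definition quotient_space :: "('k::field, 'v) module \<Rightarrow> 'v set \<Rightarrow> ('k, 'v set) module" where
  "quotient_space V W =
     \<lparr>carrier = a_rcosets\<^bsub>V\<^esub> W, mult = undefined, one = undefined, zero = W, add = set_add V,
      smult = (\<lambda>c X. \<Union>x\<in>X. W +>\<^bsub>V\<^esub> (c \<odot>\<^bsub>V\<^esub> x))\<rparr>"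

text \<open>The vector space $\ker\eta/(\ker\eta)^2$ of an augmentation \<open>\<eta>\<close>.\<close>

definition indecomposables :: "('k::field, 'a) module \<Rightarrow> ('a \<Rightarrow> 'k) \<Rightarrow> ('k, 'a set) module" where
  "indecomposables A \<eta> =
     (let I = a_kernel A scalars \<eta> in quotient_space (subspace_of A I) (ideal_prod A I I))"

section \<open>Tensor products\<close>

text \<open>
  \<open>V \<otimes> W\<close> is the quotient of the free vector space on \<open>carrier V \<times> carrier W\<close> by the subspace
  \<open>tensor_null V W\<close> generated by the bilinearity relations; since the generators carry an arbitrary
  coefficient \<open>c\<close>, closure under addition suffices.
\<close>

definition free_space :: "('k::field, 'v) module \<Rightarrow> ('k, 'w) module \<Rightarrow> ('v \<times> 'w \<Rightarrow>\<^sub>0 'k) set" where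
  "free_space V W = {x. Poly_Mapping.keys x \<subseteq> carrier V \<times> carrier W}"

inductive_set tensor_null ::
    "('k::field, 'v) module \<Rightarrow> ('k, 'w) module \<Rightarrow> ('v \<times> 'w \<Rightarrow>\<^sub>0 'k) set"
  for V :: "('k, 'v) module" and W :: "('k, 'w) module" where
  zero: "0 \<in> tensor_null V W"
| plus: "\<lbrakk>x \<in> tensor_null V W; y \<in> tensor_null V W\<rbrakk> \<Longrightarrow> x + y \<in> tensor_null V W"
| add_left: "\<lbrakk>v \<in> carrier V; v' \<in> carrier V; w \<in> carrier W\<rbrakk> \<Longrightarrow>
    Poly_Mapping.single (v \<oplus>\<^bsub>V\<^esub> v', w) c
      - Poly_Mapping.single (v, w) c - Poly_Mapping.single (v', w) c \<in> tensor_null V W"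
| add_right: "\<lbrakk>v \<in> carrier V; w \<in> carrier W; w' \<in> carrier W\<rbrakk> \<Longrightarrow>
    Poly_Mapping.single (v, w \<oplus>\<^bsub>W\<^esub> w') c
      - Poly_Mapping.single (v, w) c - Poly_Mapping.single (v, w') c \<in> tensor_null V W"
| smult_left: "\<lbrakk>v \<in> carrier V; w \<in> carrier W\<rbrakk> \<Longrightarrow>
    Poly_Mapping.single (r \<odot>\<^bsub>V\<^esub> v, w) c - Poly_Mapping.single (v, w) (r * c)
      \<in> tensor_null V W"
| smult_right: "\<lbrakk>v \<in> carrier V; w \<in> carrier W\<rbrakk> \<Longrightarrow>
    Poly_Mapping.single (v, r \<odot>\<^bsub>W\<^esub> w) c - Poly_Mapping.single (v, w) (r * c)
      \<in> tensor_null V W"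

definition tensor_rel ::
    "('k::field, 'v) module \<Rightarrow> ('k, 'w) module \<Rightarrow> (('v \<times> 'w \<Rightarrow>\<^sub>0 'k) \<times> ('v \<times> 'w \<Rightarrow>\<^sub>0 'k)) set" where
  "tensor_rel V W =
     {(x, y). x \<in> free_space V W \<and> y \<in> free_space V W \<and> x - y \<in> tensor_null V W}"

definition tensor_class ::
    "('k::field, 'v) module \<Rightarrow> ('k, 'w) module \<Rightarrow> ('v \<times> 'w \<Rightarrow>\<^sub>0 'k) \<Rightarrow> ('v \<times> 'w \<Rightarrow>\<^sub>0 'k) set" where
  "tensor_class V W x = tensor_rel V W `` {x}"

definition pure_tensor ::
    "('k::field, 'v) module \<Rightarrow> ('k, 'w) module \<Rightarrow> 'v \<Rightarrow> 'w \<Rightarrow> ('v \<times> 'w \<Rightarrow>\<^sub>0 'k) set" where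
  "pure_tensor V W v w = tensor_class V W (Poly_Mapping.single (v, w) 1)"

definition free_mult ::
    "('k::field, 'v) module \<Rightarrow> ('k, 'w) module \<Rightarrow>
       ('v \<times> 'w \<Rightarrow>\<^sub>0 'k) \<Rightarrow> ('v \<times> 'w \<Rightarrow>\<^sub>0 'k) \<Rightarrow> ('v \<times> 'w \<Rightarrow>\<^sub>0 'k)" where
  "free_mult V W x y =
     (\<Sum>(v, w)\<in>Poly_Mapping.keys x. \<Sum>(v', w')\<in>Poly_Mapping.keys y.
        Poly_Mapping.single (v \<otimes>\<^bsub>V\<^esub> v', w \<otimes>\<^bsub>W\<^esub> w')
          (Poly_Mapping.lookup x (v, w) * Poly_Mapping.lookup y (v', w')))"

definition tensor ::
    "('k::field, 'v) module \<Rightarrow> ('k, 'w) module \<Rightarrow> ('k, ('v \<times> 'w \<Rightarrow>\<^sub>0 'k) set) module" where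
  "tensor V W =
     \<lparr>carrier = free_space V W // tensor_rel V W,
      mult = (\<lambda>X Y. \<Union>x\<in>X. \<Union>y\<in>Y. tensor_class V W (free_mult V W x y)),
      one = pure_tensor V W \<one>\<^bsub>V\<^esub> \<one>\<^bsub>W\<^esub>,
      zero = tensor_class V W 0,
      add = (\<lambda>X Y. \<Union>x\<in>X. \<Union>y\<in>Y. tensor_class V W (x + y)),
      smult = (\<lambda>c X. \<Union>x\<in>X. tensor_class V W (Poly_Mapping.map ((*) c) x))\<rparr>"

text \<open>
  The linear map \<open>V \<otimes> W \<rightarrow> U\<close> induced by a bilinear map \<open>\<beta>\<close>; bilinearity makes the value
  independent of the chosen representative.
  \<open>tensor_lift U \<beta> (comult h)\<close> is Sweedler's $\sum_{(h)} \beta(h_{(1)}, h_{(2)})$.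
\<close>

definition tensor_lift ::
    "('k::field, 'u) module \<Rightarrow> ('v \<Rightarrow> 'w \<Rightarrow> 'u) \<Rightarrow> ('v \<times> 'w \<Rightarrow>\<^sub>0 'k) set \<Rightarrow> 'u" where
  "tensor_lift U \<beta> X =
     (let x = (SOME x. x \<in> X) in
        \<Oplus>\<^bsub>U\<^esub>vw\<in>Poly_Mapping.keys x.
          Poly_Mapping.lookup x vw \<odot>\<^bsub>U\<^esub> \<beta> (fst vw) (snd vw))"

section \<open>Bialgebras\<close>

text \<open>
  In \<open>coassoc\<close>, $H \otimes (H \otimes H)$ is identified with $(H \otimes H) \otimes H$ by means of
  $a \otimes (c \otimes d) \mapsto (a \otimes c) \otimes d$.
\<close>

locale bialgebra =
  fixes scale :: "'k::field \<Rightarrow> 'h::ring_1 \<Rightarrow> 'h"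
    and comult :: "'h \<Rightarrow> ('h \<times> 'h \<Rightarrow>\<^sub>0 'k) set"
    and counit :: "'h \<Rightarrow> 'k"
  assumes algebra: "k_algebra (type_algebra scale)"
    and comult_hom:
      "comult \<in> alg_hom (type_algebra scale) (tensor (type_algebra scale) (type_algebra scale))"
    and counit_hom: "counit \<in> alg_hom (type_algebra scale) scalars"
    and coassoc:
      "\<And>h. let H = type_algebra scale; HH = tensor H H; HHH = tensor HH H in
         tensor_lift HHH (\<lambda>a b. pure_tensor HH H (comult a) b) (comult h)
         = tensor_lift HHH
             (\<lambda>a b. tensor_lift HHH (\<lambda>c d. pure_tensor HH H (pure_tensor H H a c) d) (comult b))
             (comult h)"
    and counit_left: "\<And>h. tensor_lift (type_algebra scale) (\<lambda>a b. scale (counit a) b) (comult h) = h"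
    and counit_right: "\<And>h. tensor_lift (type_algebra scale) (\<lambda>a b. scale (counit b) a) (comult h) = h"

definition primitives ::
    "('k::field \<Rightarrow> 'h::ring_1 \<Rightarrow> 'h) \<Rightarrow> ('h \<Rightarrow> ('h \<times> 'h \<Rightarrow>\<^sub>0 'k) set) \<Rightarrow> 'h set" where
  "primitives scale comult =
     (let H = type_algebra scale in
        {h. comult h = pure_tensor H H 1 h \<oplus>\<^bsub>tensor H H\<^esub> pure_tensor H H h 1})"

definition primitively_generated ::
    "('k::field \<Rightarrow> 'h::ring_1 \<Rightarrow> 'h) \<Rightarrow> ('h \<Rightarrow> ('h \<times> 'h \<Rightarrow>\<^sub>0 'k) set) \<Rightarrow> bool" where
  "primitively_generated scale comult \<longleftrightarrow>
     generated_subalgebra (type_algebra scale) (primitives scale comult) = UNIV"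

text \<open>The algebra $H^*$ with the convolution product.\<close>

definition dual_algebra ::
    "('k::field \<Rightarrow> 'h::ring_1 \<Rightarrow> 'h) \<Rightarrow> ('h \<Rightarrow> ('h \<times> 'h \<Rightarrow>\<^sub>0 'k) set) \<Rightarrow> ('h \<Rightarrow> 'k) \<Rightarrow>
       ('k, 'h \<Rightarrow> 'k) module" where
  "dual_algebra scale comult counit =
     \<lparr>carrier = {p. Vector_Spaces.linear scale (*) p},
      mult = (\<lambda>p q h. tensor_lift scalars (\<lambda>a b. p a * q b) (comult h)),
      one = counit,
      zero = (\<lambda>_. 0),
      add = (\<lambda>p q h. p h + q h),
      smult = (\<lambda>c p h. c * p h)\<rparr>"

section \<open>Finite Lie rank and differential production\<close>

definition left_hit :: "'h::ring_1 \<Rightarrow> ('h \<Rightarrow> 'k) \<Rightarrow> 'h \<Rightarrow> 'k" (infixr \<open>\<rightharpoonup>\<close> 65) where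
  "(h \<rightharpoonup> p) = (\<lambda>g. p (g * h))"

definition finite_lie_rank ::
    "('k::field \<Rightarrow> 'h::ring_1 \<Rightarrow> 'h) \<Rightarrow> ('h \<Rightarrow> ('h \<times> 'h \<Rightarrow>\<^sub>0 'k) set) \<Rightarrow> ('h \<Rightarrow> 'k) \<Rightarrow>
       ('h \<Rightarrow> 'k) \<Rightarrow> bool" where
  "finite_lie_rank scale comult counit p \<longleftrightarrow>
     finite_dimensional (subspace_of (dual_algebra scale comult counit)
       ((\<lambda>h. h \<rightharpoonup> p) ` primitives scale comult))"

locale right_module_algebra = k_algebra A
  for scale :: "'k::field \<Rightarrow> 'h::ring_1 \<Rightarrow> 'h"
    and comult :: "'h \<Rightarrow> ('h \<times> 'h \<Rightarrow>\<^sub>0 'k) set"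
    and A :: "('k, 'a) module" (structure)
    and act :: "'a \<Rightarrow> 'h \<Rightarrow> 'a" (infixl \<open>\<triangleleft>\<close> 75) +
  assumes act_closed: "a \<in> carrier A \<Longrightarrow> a \<triangleleft> h \<in> carrier A"
    and act_add_left: "\<lbrakk>a \<in> carrier A; b \<in> carrier A\<rbrakk> \<Longrightarrow> (a \<oplus> b) \<triangleleft> h = a \<triangleleft> h \<oplus> b \<triangleleft> h"
    and act_smult_left: "a \<in> carrier A \<Longrightarrow> (c \<odot> a) \<triangleleft> h = c \<odot> (a \<triangleleft> h)"
    and act_add_right: "a \<in> carrier A \<Longrightarrow> a \<triangleleft> (g + h) = a \<triangleleft> g \<oplus> a \<triangleleft> h"
    and act_smult_right: "a \<in> carrier A \<Longrightarrow> a \<triangleleft> scale c h = c \<odot> (a \<triangleleft> h)"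
    and act_one: "a \<in> carrier A \<Longrightarrow> a \<triangleleft> 1 = a"
    and act_mult: "a \<in> carrier A \<Longrightarrow> a \<triangleleft> (g * h) = (a \<triangleleft> g) \<triangleleft> h"
    and mult_act: "\<lbrakk>a \<in> carrier A; b \<in> carrier A\<rbrakk> \<Longrightarrow>
      (a \<otimes> b) \<triangleleft> h = tensor_lift A (\<lambda>x y. (a \<triangleleft> x) \<otimes> (b \<triangleleft> y)) (comult h)"

definition differentially_produced ::
    "('k::field \<Rightarrow> 'h::ring_1 \<Rightarrow> 'h) \<Rightarrow> ('h \<Rightarrow> ('h \<times> 'h \<Rightarrow>\<^sub>0 'k) set) \<Rightarrow>
       ('k, 'r) module \<Rightarrow> ('r \<Rightarrow> 'k) \<Rightarrow> ('h \<Rightarrow> 'k) \<Rightarrow> bool" where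
  "differentially_produced scale comult R \<eta> p \<longleftrightarrow>
     augmented_algebra R \<eta> \<and>
     (\<exists>act. right_module_algebra scale comult R act \<and>
        (\<exists>f\<in>carrier R. \<forall>h. p h = \<eta> (act f h)))"

text \<open>
  $k[[x_1, \dots, x_N]]$: a series is its coefficient function on monomials \<open>m :: nat \<Rightarrow>\<^sub>0 nat\<close>, and
  only the variables with index \<open>< N\<close> may occur.  Each monomial has only finitely many
  factorisations \<open>a + b = m\<close>, so the sum in the product is finite.
\<close>

definition power_series :: "nat \<Rightarrow> ('k::field, (nat \<Rightarrow>\<^sub>0 nat) \<Rightarrow> 'k) module" where
  "power_series N =
     \<lparr>carrier = {f. \<forall>m. \<not> Poly_Mapping.keys m \<subseteq> {..<N} \<longrightarrow> f m = 0},
      mult = (\<lambda>f g m. \<Sum>(a, b)\<in>{(a, b). a + b = m}. f a * g b),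
      one = (\<lambda>m. if m = 0 then 1 else 0),
      zero = (\<lambda>_. 0),
      add = (\<lambda>f g m. f m + g m),
      smult = (\<lambda>c f m. c * f m)\<rparr>"

end

theory Submission
  imports Defs
begin

text \<open>
  The convolution product of functionals is controlled by the primitive elements alone.
  For a primitive element \<open>l\<close>, right translation by \<open>l\<close> is a
  derivation of \<open>H\<^sup>*\<close> (lemma \<open>conv_mult_primitive\<close>), and
  products of primitive elements span \<open>H\<close>. Hence identities between
  convolution products are proved by peeling off primitive factors one at a time.

  Differential production implies finite Lie rank: if \<open>p h = \<eta> (f
  \<triangleleft> h)\<close> and \<open>l\<close> is primitive, then \<open>a \<mapsto>
  \<eta> (a \<triangleleft> l)\<close> is an \<open>\<eta>\<close>-derivation, so it kills
  \<open>1\<close> and the square of the augmentation ideal. It is therefore determined by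
  its values on a finite set of representatives of generators of the indecomposables.
  Because \<open>p (g * l)\<close> is the value of this derivation at \<open>f
  \<triangleleft> g\<close>, the functional \<open>l \<rightharpoonup> p\<close> is
  determined by finitely many scalars that depend linearly on \<open>l\<close> (lemma
  \<open>production_finite_lie_rank\<close>).

  Finite Lie rank implies production by a power series algebra: let \<open>L\<close> be
  the set of primitive elements \<open>l\<close> with \<open>l \<rightharpoonup> p =
  0\<close>, and let \<open>S\<close> be the space of functionals that vanish on the left
  ideal \<open>H L\<close>. It is a subalgebra, stable under the translations \<open>q
  \<mapsto> q (h * _)\<close>, and it contains \<open>p\<close>; so \<open>p\<close> is
  produced by \<open>S\<close> with the augmentation \<open>q \<mapsto> q 1\<close>. The
  space of primitive elements modulo \<open>L\<close> has a finite basis \<open>e\<^sub>0,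
  \<dots>, e\<^sub>N\<^sub>-\<^sub>1\<close>, and there are \<open>d\<^sub>j\<close> in
  \<open>H\<close> such that \<open>p (d\<^sub>j * e\<^sub>i)\<close> is the Kronecker
  symbol. Assigning to \<open>q\<close> its Taylor coefficients \<open>q (e\<^sup>m) /
  m!\<close> on ordered monomials is an algebra homomorphism from \<open>S\<close> to
  power series. It is injective because the ordered monomials together with \<open>H
  L\<close> span \<open>H\<close> (the easy half of the Poincare-Birkhoff-Witt theorem,
  lemma \<open>filt_subset_pbw_span\<close>). It is surjective because the functionals
  \<open>x\<^sub>j = p (d\<^sub>j * _) - p d\<^sub>j \<cdot> counit\<close> lie in
  \<open>S\<close> and their Taylor series begin with the variables: the translates of
  \<open>p\<close> themselves separate the \<open>e\<^sub>i\<close> (lemma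
  \<open>taylor_iso\<close>).

  Finally, a power series algebra has only one augmentation, the constant coefficient,
  because every series with nonzero constant coefficient is invertible; and its
  augmentation ideal is generated by the finitely many variables. So the indecomposables
  are finite-dimensional (lemma \<open>power_series_indecomposables\<close>), which closes
  the circle.
\<close>

section \<open>Formal linear combinations and tensors\<close>

lemma type_algebra_simps [simp]:
  "carrier (type_algebra s) = UNIV" "x \<otimes>\<^bsub>type_algebra s\<^esub> y = x * y"
  "\<one>\<^bsub>type_algebra s\<^esub> = 1" "\<zero>\<^bsub>type_algebra s\<^esub> = 0"
  "x \<oplus>\<^bsub>type_algebra s\<^esub> y = x + y" "c \<odot>\<^bsub>type_algebra s\<^esub> x = s c x"
  by (simp_all add: type_algebra_def)

lemma scalars_simps [simp]:
  "carrier scalars = UNIV" "x \<otimes>\<^bsub>scalars\<^esub> y = x * y"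
  "\<one>\<^bsub>scalars\<^esub> = 1" "\<zero>\<^bsub>scalars\<^esub> = 0"
  "x \<oplus>\<^bsub>scalars\<^esub> y = x + y" "c \<odot>\<^bsub>scalars\<^esub> x = c * x"
  by (simp_all add: scalars_def)

lemma abelian_group_type_algebra: "abelian_group (type_algebra s)"
  by (rule abelian_groupI) (auto simp: add.assoc add.commute intro: exI[of _ "- x" for x])

lemma cring_scalars: "cring (scalars :: ('k::field, 'k) module)"
  by (rule cringI)
    (auto simp: scalars_def abelian_group_type_algebra algebra_simps intro!: comm_monoidI)

lemma finsum_type_algebra: "finite A \<Longrightarrow> finsum (type_algebra s) f A = sum f A"
proof (induct A rule: finite_induct)
  case empty
  then show ?case
    using abelian_group_type_algebra[of s]
    by (simp add: abelian_monoid.finsum_empty abelian_group_def)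
next
  case (insert a A)
  then show ?case
    using abelian_group_type_algebra[of s]
    by (simp add: abelian_monoid.finsum_insert abelian_group_def)
qed

lemma finsum_scalars: "finite A \<Longrightarrow> finsum scalars f A = sum f A"
  by (simp add: scalars_def finsum_type_algebra)

text \<open>
  The linear extension of a function on a basis to the free vector space on that basis;
  tensors are classes of elements of such a space.
\<close>

definition lin_ext :: "('b \<Rightarrow> 'k) \<Rightarrow> ('b \<Rightarrow>\<^sub>0 'k::field) \<Rightarrow> 'k" where
  "lin_ext \<beta> x = (\<Sum>b\<in>Poly_Mapping.keys x. Poly_Mapping.lookup x b * \<beta> b)"

lemma lin_ext_superset:
  assumes "finite A" "Poly_Mapping.keys x \<subseteq> A"
  shows "lin_ext \<beta> x = (\<Sum>b\<in>A. Poly_Mapping.lookup x b * \<beta> b)"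
  unfolding lin_ext_def using assms
  by (intro sum.mono_neutral_left) (auto simp: in_keys_iff)

lemma lin_ext_zero [simp]: "lin_ext \<beta> 0 = 0"
  by (simp add: lin_ext_def)

lemma lin_ext_single [simp]: "lin_ext \<beta> (Poly_Mapping.single b c) = c * \<beta> b"
  by (simp add: lin_ext_superset[of "{b}"])

lemma lin_ext_add: "lin_ext \<beta> (x + y) = lin_ext \<beta> x + lin_ext \<beta> y"
proof -
  let ?A = "Poly_Mapping.keys x \<union> Poly_Mapping.keys y"
  show ?thesis
    using keys_add[of x y]
    by (simp add: lin_ext_superset[of ?A] lookup_add sum.distrib algebra_simps)
qed

lemma lin_ext_diff: "lin_ext \<beta> (x - y) = lin_ext \<beta> x - lin_ext \<beta> y"
  using lin_ext_add[of \<beta> "x - y" y] by simp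

lemma lin_ext_map_mult: "lin_ext \<beta> (Poly_Mapping.map ((*) c) x) = c * lin_ext \<beta> x"
proof -
  have "Poly_Mapping.keys (Poly_Mapping.map ((*) c) x) \<subseteq> Poly_Mapping.keys x"
    by (auto simp: in_keys_iff Poly_Mapping.map.rep_eq when_def)
  then show ?thesis
    by (subst lin_ext_superset[of "Poly_Mapping.keys x"])
      (auto simp: Poly_Mapping.map.rep_eq when_def sum_distrib_left lin_ext_def mult.assoc intro!: sum.cong)
qed

lemma lin_ext_sum: "finite A \<Longrightarrow> lin_ext \<beta> (\<Sum>a\<in>A. x a) = (\<Sum>a\<in>A. lin_ext \<beta> (x a))"
  by (induct A rule: finite_induct) (auto simp: lin_ext_add)

lemma tensor_simps:
  "carrier (tensor V W) = free_space V W // tensor_rel V W"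
  "X \<otimes>\<^bsub>tensor V W\<^esub> Y = (\<Union>x\<in>X. \<Union>y\<in>Y. tensor_class V W (free_mult V W x y))"
  "\<one>\<^bsub>tensor V W\<^esub> = pure_tensor V W \<one>\<^bsub>V\<^esub> \<one>\<^bsub>W\<^esub>"
  "\<zero>\<^bsub>tensor V W\<^esub> = tensor_class V W 0"
  "X \<oplus>\<^bsub>tensor V W\<^esub> Y = (\<Union>x\<in>X. \<Union>y\<in>Y. tensor_class V W (x + y))"
  "c \<odot>\<^bsub>tensor V W\<^esub> X = (\<Union>x\<in>X. tensor_class V W (Poly_Mapping.map ((*) c) x))"
  by (simp_all add: tensor_def)

text \<open>
  Each family of generators of \<open>tensor_null\<close> is stable under replacing the
  coefficient \<open>c\<close> by \<open>- c\<close>.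
\<close>

lemma tensor_null_uminus: "x \<in> tensor_null V W \<Longrightarrow> - x \<in> tensor_null V W"
proof (induct rule: tensor_null.induct)
  case (plus x y)
  then show ?case using tensor_null.plus[of "- x" V W "- y"] by simp
next
  case (add_left v v' w c)
  then show ?case
    using tensor_null.add_left[of v V v' w W "- c"]
    by (simp add: single_uminus algebra_simps)
next
  case (add_right v w w' c)
  then show ?case
    using tensor_null.add_right[of v V w W w' "- c"]
    by (simp add: single_uminus algebra_simps)
next
  case (smult_left v w r c)
  then show ?case
    using tensor_null.smult_left[of v V w W r "- c"]
    by (simp add: single_uminus)
next
  case (smult_right v w r c)
  then show ?case
    using tensor_null.smult_right[of v V w W r "- c"]
    by (simp add: single_uminus)
qed (auto intro: tensor_null.zero)

lemma equiv_tensor_rel: "equiv (free_space V W) (tensor_rel V W)"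
proof (rule equivI)
  show "tensor_rel V W \<subseteq> free_space V W \<times> free_space V W"
    by (auto simp: tensor_rel_def)
  show "refl_on (free_space V W) (tensor_rel V W)"
    by (auto simp: refl_on_def tensor_rel_def intro: tensor_null.zero)
  show "sym (tensor_rel V W)"
    by (auto simp: sym_def tensor_rel_def dest: tensor_null_uminus)
  show "trans (tensor_rel V W)"
    by (rule transI) (auto simp: tensor_rel_def dest: tensor_null.plus)
qed

lemma free_space_type_algebra [simp]:
  "free_space (type_algebra s) (type_algebra t) = UNIV"
  by (simp add: free_space_def)

section \<open>Sweedler sums and primitive elements\<close>

lemma vector_space_mult: "vector_space ((*) :: 'k::field \<Rightarrow> 'k \<Rightarrow> 'k)"
  by unfold_locales (auto simp: algebra_simps)

context bialgebra
begin

abbreviation "alg \<equiv> type_algebra scale"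

abbreviation "dual \<equiv> dual_algebra scale comult counit"

abbreviation "prims \<equiv> primitives scale comult"

abbreviation "lin \<equiv> Vector_Spaces.linear scale (*)"

lemma scale_mult_left: "scale c x * y = scale c (x * y)"
  and scale_mult_right: "x * scale c y = scale c (x * y)"
  using k_algebra.smult_mult_left[OF algebra, of x y c]
    k_algebra.smult_mult_right[OF algebra, of x y c]
  by simp_all

sublocale vector_space scale
proof
  interpret M: module scalars alg
    using algebra by (simp add: k_algebra_def)
  show "scale a (x + y) = scale a x + scale a y" for a x y
    using M.smult_r_distr[of a x y] by simp
  show "scale (a + b) x = scale a x + scale b x" for a b x
    using M.smult_l_distr[of a b x] by simp
  show "scale a (scale b x) = scale (a * b) x" for a b x
    using M.smult_assoc1[of a b x] by simp
  show "scale 1 x = x" for x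
    using M.smult_one[of x] by simp
qed

lemma lin_iff: "lin f \<longleftrightarrow> (\<forall>x y. f (x + y) = f x + f y) \<and> (\<forall>c x. f (scale c x) = c * f x)"
  by (simp add: Vector_Spaces.linear_iff vector_space_mult vector_space_axioms)

lemma linI:
  "\<lbrakk>\<And>x y. f (x + y) = f x + f y; \<And>c x. f (scale c x) = c * f x\<rbrakk> \<Longrightarrow> lin f"
  by (simp add: lin_iff)

lemma lin_add: "lin f \<Longrightarrow> f (x + y) = f x + f y"
  and lin_scale: "lin f \<Longrightarrow> f (scale c x) = c * f x"
  by (simp_all add: lin_iff)

lemma lin_zero: "lin f \<Longrightarrow> f 0 = 0"
  using lin_scale[of f 0 0] by simp

lemma lin_diff: "lin f \<Longrightarrow> f (x - y) = f x - f y"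
  using lin_add[of f "x - y" y] by simp

lemma lin_sum: "finite A \<Longrightarrow> lin f \<Longrightarrow> f (\<Sum>a\<in>A. g a) = (\<Sum>a\<in>A. f (g a))"
  by (induct A rule: finite_induct) (auto simp: lin_add lin_zero)

lemma lin_mult_right: "lin f \<Longrightarrow> lin (\<lambda>g. f (g * h))"
  by (rule linI) (auto simp: lin_add lin_scale distrib_right scale_mult_left)

lemma lin_mult_left: "lin f \<Longrightarrow> lin (\<lambda>g. f (h * g))"
  by (rule linI) (auto simp: lin_add lin_scale distrib_left scale_mult_right)

lemma lin_counit: "lin counit"
  and counit_mult: "counit (g * h) = counit g * counit h"
  and counit_one: "counit 1 = 1"
  using counit_hom unfolding alg_hom_def ring_hom_def by (auto intro: linI)

definition bilin :: "('h \<Rightarrow> 'h \<Rightarrow> 'k) \<Rightarrow> bool" where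
  "bilin \<beta> \<longleftrightarrow> (\<forall>x. lin (\<beta> x)) \<and> (\<forall>y. lin (\<lambda>x. \<beta> x y))"

lemma bilinI: "\<lbrakk>\<And>x. lin (\<beta> x); \<And>y. lin (\<lambda>x. \<beta> x y)\<rbrakk> \<Longrightarrow> bilin \<beta>"
  by (simp add: bilin_def)

lemma bilin_left:
  "bilin \<beta> \<Longrightarrow> \<beta> (x + x') y = \<beta> x y + \<beta> x' y"
  "bilin \<beta> \<Longrightarrow> \<beta> (scale c x) y = c * \<beta> x y"
  by (auto simp: bilin_def lin_iff)

lemma bilin_right:
  "bilin \<beta> \<Longrightarrow> \<beta> x (y + y') = \<beta> x y + \<beta> x y'"
  "bilin \<beta> \<Longrightarrow> \<beta> x (scale c y) = c * \<beta> x y"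
  by (auto simp: bilin_def lin_iff)

lemma bilin_product: "lin p \<Longrightarrow> lin q \<Longrightarrow> bilin (\<lambda>x y. p x * q y)"
  by (auto simp: bilin_def lin_iff algebra_simps)

abbreviation form_ext :: "('h \<Rightarrow> 'h \<Rightarrow> 'k) \<Rightarrow> ('h \<times> 'h \<Rightarrow>\<^sub>0 'k) \<Rightarrow> 'k" where
  "form_ext \<beta> \<equiv> lin_ext (\<lambda>vw. \<beta> (fst vw) (snd vw))"

text \<open>
  A bilinear form kills the relations that define the tensor product. This is the reason
  why values of bilinear forms on Sweedler sums may be computed from any representative
  of the comultiplication.
\<close>

lemma form_ext_tensor_null:
  assumes "bilin \<beta>" "x \<in> tensor_null alg alg"
  shows "form_ext \<beta> x = 0"
  using assms(2)
  by (induct rule: tensor_null.induct)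
    (auto simp: lin_ext_add lin_ext_diff bilin_left[OF assms(1)] bilin_right[OF assms(1)]
       algebra_simps)

lemma form_ext_tensor_class:
  assumes "bilin \<beta>" "y \<in> tensor_class alg alg x"
  shows "form_ext \<beta> y = form_ext \<beta> x"
  using assms form_ext_tensor_null[of \<beta> "x - y"]
  by (auto simp: tensor_class_def tensor_rel_def lin_ext_diff)

lemma tensor_class_self: "x \<in> tensor_class alg alg x"
  by (simp add: tensor_class_def tensor_rel_def tensor_null.zero)

lemma comult_carrier: "comult h \<in> carrier (tensor alg alg)"
  using comult_hom by (auto simp: alg_hom_def ring_hom_def)

lemma comult_class:
  assumes "x \<in> comult h" shows "comult h = tensor_class alg alg x"
  using comult_carrier[of h] assms
  unfolding tensor_simps tensor_class_def
  using equiv_tensor_rel equiv_class_eq_iff quotient_eq_iff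
  by (smt (verit, best) Image_singleton_iff equiv_class_eq quotientE)

lemma comult_nonempty: "\<exists>x. x \<in> comult h"
  using comult_carrier[of h] unfolding tensor_simps
  by (metis equiv_class_self equiv_tensor_rel quotientE)

text \<open>
  The representative that \<open>tensor_lift\<close> chooses does not depend on the
  bilinear map or on its target. Fixing it turns every Sweedler sum into a sum over the
  same finite family.
\<close>

definition rep :: "'h \<Rightarrow> ('h \<times> 'h \<Rightarrow>\<^sub>0 'k)" where
  "rep h = (SOME x. x \<in> comult h)"

lemma rep: "rep h \<in> comult h"
  unfolding rep_def using comult_nonempty[of h] by (rule someI_ex)

definition sweedler :: "('h \<Rightarrow> 'h \<Rightarrow> 'k) \<Rightarrow> 'h \<Rightarrow> 'k" where
  "sweedler \<beta> h = form_ext \<beta> (rep h)"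

lemma tensor_lift_comult:
  "tensor_lift U \<beta> (comult h)
   = (\<Oplus>\<^bsub>U\<^esub>vw\<in>Poly_Mapping.keys (rep h). Poly_Mapping.lookup (rep h) vw \<odot>\<^bsub>U\<^esub> \<beta> (fst vw) (snd vw))"
  by (simp add: tensor_lift_def rep_def Let_def)

lemma tensor_lift_scalars: "tensor_lift scalars \<beta> (comult h) = sweedler \<beta> h"
  by (simp add: tensor_lift_comult finsum_scalars sweedler_def lin_ext_def)

lemma sweedler_eq:
  assumes "bilin \<beta>" "x \<in> comult h" shows "sweedler \<beta> h = form_ext \<beta> x"
  unfolding sweedler_def
  using form_ext_tensor_class[OF assms(1)] comult_class[OF assms(2)] rep[of h] by auto

lemma comult_add: "comult (g + h) = comult g \<oplus>\<^bsub>tensor alg alg\<^esub> comult h"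
  and comult_mult: "comult (g * h) = comult g \<otimes>\<^bsub>tensor alg alg\<^esub> comult h"
  and comult_one: "comult 1 = \<one>\<^bsub>tensor alg alg\<^esub>"
  and comult_scale: "comult (scale c h) = c \<odot>\<^bsub>tensor alg alg\<^esub> comult h"
  using comult_hom by (auto simp: alg_hom_def ring_hom_def)

lemma comult_add_mem: "x \<in> comult g \<Longrightarrow> y \<in> comult h \<Longrightarrow> x + y \<in> comult (g + h)"
  and comult_mult_mem:
    "x \<in> comult g \<Longrightarrow> y \<in> comult h \<Longrightarrow> free_mult alg alg x y \<in> comult (g * h)"
  and comult_scale_mem: "x \<in> comult h \<Longrightarrow> Poly_Mapping.map ((*) c) x \<in> comult (scale c h)"
  unfolding comult_add comult_mult comult_scale tensor_simps
  using tensor_class_self by blast+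

lemma comult_one_mem: "Poly_Mapping.single (1, 1) 1 \<in> comult 1"
  unfolding comult_one tensor_simps pure_tensor_def using tensor_class_self by simp

abbreviation prim_tensor :: "'h \<Rightarrow> ('h \<times> 'h \<Rightarrow>\<^sub>0 'k)" where
  "prim_tensor l \<equiv> Poly_Mapping.single (1, l) 1 + Poly_Mapping.single (l, 1) 1"

text \<open>
  Primitivity is an equality of classes; since classes are disjoint or equal, it can be
  tested on the single representative \<open>1 \<otimes> l + l \<otimes> 1\<close>.
\<close>

lemma primitives_iff: "l \<in> prims \<longleftrightarrow> prim_tensor l \<in> comult l"
proof -
  let ?T = "pure_tensor alg alg 1 l \<oplus>\<^bsub>tensor alg alg\<^esub> pure_tensor alg alg l 1"
  have mem: "prim_tensor l \<in> ?T"
    unfolding tensor_simps pure_tensor_def using tensor_class_self by blast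
  have "?T \<subseteq> tensor_class alg alg (prim_tensor l)"
  proof
    fix z assume "z \<in> ?T"
    then obtain x y where x: "Poly_Mapping.single (1, l) 1 - x \<in> tensor_null alg alg"
      and y: "Poly_Mapping.single (l, 1) 1 - y \<in> tensor_null alg alg"
      and z: "(x + y) - z \<in> tensor_null alg alg"
      by (auto simp: tensor_simps pure_tensor_def tensor_class_def tensor_rel_def)
    have "prim_tensor l - z \<in> tensor_null alg alg"
      using tensor_null.plus[OF tensor_null.plus[OF x y] z] by (simp add: algebra_simps)
    then show "z \<in> tensor_class alg alg (prim_tensor l)"
      by (simp add: tensor_class_def tensor_rel_def)
  qed
  moreover have "tensor_class alg alg (prim_tensor l) \<subseteq> ?T"
    unfolding tensor_simps pure_tensor_def using tensor_class_self by blast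
  ultimately have T: "?T = tensor_class alg alg (prim_tensor l)" by blast
  have "l \<in> prims \<longleftrightarrow> comult l = ?T"
    by (simp add: primitives_def Let_def)
  then show ?thesis
    using T mem comult_class by metis
qed

lemma form_ext_free_mult:
  "form_ext \<beta> (free_mult alg alg x y)
   = form_ext (\<lambda>v w. form_ext (\<lambda>v' w'. \<beta> (v * v') (w * w')) y) x"
  by (simp add: free_mult_def lin_ext_sum case_prod_unfold)
    (simp add: lin_ext_def sum_distrib_left mult.assoc)

lemma sweedler_add_form:
  "sweedler (\<lambda>a b. \<beta> a b + \<gamma> a b) h = sweedler \<beta> h + sweedler \<gamma> h"
  by (simp add: sweedler_def lin_ext_def sum.distrib algebra_simps)

lemma sweedler_scale_form: "sweedler (\<lambda>a b. c * \<beta> a b) h = c * sweedler \<beta> h"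
  by (simp add: sweedler_def lin_ext_def sum_distrib_left algebra_simps)

lemma lin_sweedler: assumes "bilin \<beta>" shows "lin (sweedler \<beta>)"
proof (rule linI)
  show "sweedler \<beta> (x + y) = sweedler \<beta> x + sweedler \<beta> y" for x y
    using sweedler_eq[OF assms comult_add_mem[OF rep rep], of x y]
    by (simp add: sweedler_def lin_ext_add)
  show "sweedler \<beta> (scale c x) = c * sweedler \<beta> x" for c x
    using sweedler_eq[OF assms comult_scale_mem[OF rep], of c x]
    by (simp add: sweedler_def lin_ext_map_mult)
qed

lemma sweedler_one: "bilin \<beta> \<Longrightarrow> sweedler \<beta> 1 = \<beta> 1 1"
  using sweedler_eq[OF _ comult_one_mem, of \<beta>] by simp

text \<open>
  The Leibniz rule behind the whole development: multiplying the tensor \<open>\<Delta>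
  g\<close> by \<open>1 \<otimes> l + l \<otimes> 1\<close> distributes \<open>l\<close>
  over the two factors.
\<close>

lemma sweedler_mult_primitive:
  assumes "bilin \<beta>" "l \<in> prims"
  shows "sweedler \<beta> (g * l) = sweedler (\<lambda>a b. \<beta> (a * l) b) g + sweedler (\<lambda>a b. \<beta> a (b * l)) g"
proof -
  have "sweedler \<beta> (g * l) = form_ext \<beta> (free_mult alg alg (rep g) (prim_tensor l))"
    using assms primitives_iff by (intro sweedler_eq comult_mult_mem rep) auto
  also have "\<dots> = sweedler (\<lambda>a b. \<beta> (a * l) b + \<beta> a (b * l)) g"
    by (simp add: form_ext_free_mult lin_ext_add sweedler_def add.commute)
  finally show ?thesis by (simp add: sweedler_add_form)
qed

lemma sweedler_primitive:
  assumes "bilin \<beta>" "l \<in> prims" shows "sweedler \<beta> l = \<beta> l 1 + \<beta> 1 l"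
  using sweedler_eq[OF assms(1), of "prim_tensor l" l] assms(2)
  by (simp add: primitives_iff lin_ext_add)

text \<open>
  Applying the counit to \<open>l = \<Sum> \<epsilon>(l\<^sub>1) l\<^sub>2\<close> gives
  \<open>\<epsilon>(l) = \<epsilon>(l) + \<epsilon>(l)\<close>.
\<close>

lemma counit_primitive:
  assumes "l \<in> prims" shows "counit l = 0"
proof -
  have "bilin (\<lambda>a b. counit (scale (counit a) b))"
    using lin_counit by (intro bilinI linI) (auto simp: lin_iff algebra_simps)
  then have "sweedler (\<lambda>a b. counit (scale (counit a) b)) l = counit l + counit l"
    using assms by (simp add: sweedler_primitive counit_one lin_scale[OF lin_counit])
  moreover have "counit l = sweedler (\<lambda>a b. counit (scale (counit a) b)) l"
    using arg_cong[OF counit_left[of l], of counit] lin_counit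
    by (simp add: tensor_lift_comult finsum_type_algebra lin_sum lin_scale sweedler_def lin_ext_def mult.assoc)
  ultimately show ?thesis by (metis add_cancel_right_right)
qed

lemma comult_memI:
  assumes "y \<in> comult h" "y - x \<in> tensor_null alg alg" shows "x \<in> comult h"
  using comult_class[OF assms(1)] assms(2) by (simp add: tensor_class_def tensor_rel_def)

lemma primitives_add:
  assumes "l \<in> prims" "l' \<in> prims" shows "l + l' \<in> prims"
proof -
  have "prim_tensor (l + l') - (prim_tensor l + prim_tensor l') \<in> tensor_null alg alg"
    using tensor_null.plus[OF tensor_null.add_right[of 1 alg l alg l' 1]
        tensor_null.add_left[of l alg l' 1 alg 1]]
    by (simp add: algebra_simps)
  then have "(prim_tensor l + prim_tensor l') - prim_tensor (l + l') \<in> tensor_null alg alg"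
    using tensor_null_uminus by fastforce
  then show ?thesis
    using assms comult_memI[OF comult_add_mem] unfolding primitives_iff by blast
qed

lemma primitives_scale:
  assumes "l \<in> prims" shows "scale c l \<in> prims"
proof -
  have map: "Poly_Mapping.map ((*) c) (prim_tensor l)
      = Poly_Mapping.single (1, l) c + Poly_Mapping.single (l, 1) c"
    by (rule poly_mapping_eqI)
      (simp add: Poly_Mapping.map.rep_eq lookup_add lookup_single when_def algebra_simps)
  have "prim_tensor (scale c l) - Poly_Mapping.map ((*) c) (prim_tensor l) \<in> tensor_null alg alg"
    using tensor_null.plus[OF tensor_null.smult_right[of 1 alg l alg c 1]
        tensor_null.smult_left[of l alg 1 alg c 1]]
    unfolding map by (simp add: algebra_simps)
  then have "Poly_Mapping.map ((*) c) (prim_tensor l) - prim_tensor (scale c l) \<in> tensor_null alg alg"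
    using tensor_null_uminus by fastforce
  then show ?thesis
    using assms comult_memI[OF comult_scale_mem] unfolding primitives_iff by blast
qed

lemma primitives_zero: "0 \<in> prims"
proof -
  have "prim_tensor 0 \<in> comult 0"
  proof -
    have "Poly_Mapping.map ((*) 0) (rep 0) = 0"
      by (rule poly_mapping_eqI) (simp add: Poly_Mapping.map.rep_eq when_def)
    then have "0 \<in> comult 0"
      using comult_scale_mem[OF rep, of 0 0] by simp
    moreover have "0 - prim_tensor 0 \<in> tensor_null alg alg"
      using tensor_null.plus[OF tensor_null.smult_right[of 1 alg 0 alg 0 1]
        tensor_null.smult_left[of 0 alg 1 alg 0 1]] tensor_null_uminus by fastforce
    ultimately show ?thesis using comult_memI by blast
  qed
  then show ?thesis by (simp add: primitives_iff)
qed

lemma free_mult_single: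
  "free_mult alg alg (Poly_Mapping.single (a, b) c) (Poly_Mapping.single (a', b') d)
   = Poly_Mapping.single (a * a', b * b') (c * d)"
  by (simp add: free_mult_def)

lemma free_mult_superset:
  assumes "finite A" "Poly_Mapping.keys x \<subseteq> A" "finite B" "Poly_Mapping.keys y \<subseteq> B"
  shows "free_mult alg alg x y = (\<Sum>vw\<in>A. \<Sum>vw'\<in>B.
     Poly_Mapping.single (fst vw * fst vw', snd vw * snd vw')
       (Poly_Mapping.lookup x vw * Poly_Mapping.lookup y vw'))"
proof -
  have "free_mult alg alg x y = (\<Sum>vw\<in>Poly_Mapping.keys x. \<Sum>vw'\<in>Poly_Mapping.keys y.
     Poly_Mapping.single (fst vw * fst vw', snd vw * snd vw')
       (Poly_Mapping.lookup x vw * Poly_Mapping.lookup y vw'))"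
    by (simp add: free_mult_def case_prod_unfold)
  also have "\<dots> = (\<Sum>vw\<in>Poly_Mapping.keys x. \<Sum>vw'\<in>B.
     Poly_Mapping.single (fst vw * fst vw', snd vw * snd vw')
       (Poly_Mapping.lookup x vw * Poly_Mapping.lookup y vw'))"
    using assms by (intro sum.cong refl sum.mono_neutral_left) (auto simp: in_keys_iff)
  also have "\<dots> = (\<Sum>vw\<in>A. \<Sum>vw'\<in>B.
     Poly_Mapping.single (fst vw * fst vw', snd vw * snd vw')
       (Poly_Mapping.lookup x vw * Poly_Mapping.lookup y vw'))"
    using assms by (intro sum.mono_neutral_left) (auto simp: in_keys_iff)
  finally show ?thesis .
qed

lemma free_mult_add_left:
  "free_mult alg alg (x + x') y = free_mult alg alg x y + free_mult alg alg x' y"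
proof -
  let ?A = "Poly_Mapping.keys x \<union> Poly_Mapping.keys x'"
  show ?thesis
    using keys_add[of x x']
    by (simp add: free_mult_superset[of ?A _ "Poly_Mapping.keys y"] lookup_add distrib_right
        single_add sum.distrib)
qed

lemma free_mult_add_right:
  "free_mult alg alg x (y + y') = free_mult alg alg x y + free_mult alg alg x y'"
proof -
  let ?A = "Poly_Mapping.keys y \<union> Poly_Mapping.keys y'"
  show ?thesis
    using keys_add[of y y']
    by (simp add: free_mult_superset[of "Poly_Mapping.keys x" _ ?A] lookup_add distrib_left
        single_add sum.distrib)
qed

text \<open>
  Modulo the tensor relations, \<open>\<Delta> (a b)\<close> is \<open>1 \<otimes> ab +
  a \<otimes> b + b \<otimes> a + ab \<otimes> 1\<close>; the two mixed terms are
  symmetric in \<open>a\<close> and \<open>b\<close> and cancel in the commutator.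
\<close>

lemma primitives_commutator:
  assumes l: "l \<in> prims" and l': "l' \<in> prims" shows "l * l' - l' * l \<in> prims"
proof -
  let ?s = "\<lambda>a b c. Poly_Mapping.single (a :: 'h, b :: 'h) (c :: 'k)"
  have prod: "?s 1 (a * b) 1 + ?s a b 1 + ?s b a 1 + ?s (a * b) 1 1 \<in> comult (a * b)"
    if "a \<in> prims" "b \<in> prims" for a b
  proof -
    have "free_mult alg alg (prim_tensor a) (prim_tensor b) \<in> comult (a * b)"
      using that comult_mult_mem unfolding primitives_iff by blast
    then show ?thesis
      by (simp add: free_mult_add_left free_mult_add_right free_mult_single algebra_simps)
  qed
  let ?X = "?s 1 (l * l') 1 + ?s l l' 1 + ?s l' l 1 + ?s (l * l') 1 1"
  let ?Y = "?s 1 (l' * l) 1 + ?s l' l 1 + ?s l l' 1 + ?s (l' * l) 1 1"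
  let ?c = "l * l' + scale (- 1) (l' * l)"
  have neg: "Poly_Mapping.map ((*) (- 1)) y = - y" for y :: "'h \<times> 'h \<Rightarrow>\<^sub>0 'k"
    by (rule poly_mapping_eqI) (simp add: Poly_Mapping.map.rep_eq when_def)
  have mem: "?X + - ?Y \<in> comult ?c"
    using comult_add_mem[OF prod[OF l l'] comult_scale_mem[OF prod[OF l' l], of "- 1"]]
    unfolding neg .
  have "?s 1 ?c 1 - ?s 1 (l * l') 1 - ?s 1 (scale (- 1) (l' * l)) 1 \<in> tensor_null alg alg"
    "?s ?c 1 1 - ?s (l * l') 1 1 - ?s (scale (- 1) (l' * l)) 1 1 \<in> tensor_null alg alg"
    "?s 1 (scale (- 1) (l' * l)) 1 - ?s 1 (l' * l) (- 1 * 1) \<in> tensor_null alg alg"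
    "?s (scale (- 1) (l' * l)) 1 1 - ?s (l' * l) 1 (- 1 * 1) \<in> tensor_null alg alg"
    using tensor_null.add_right[of 1 alg "l * l'" alg "scale (- 1) (l' * l)" 1]
      tensor_null.add_left[of "l * l'" alg "scale (- 1) (l' * l)" 1 alg 1]
      tensor_null.smult_right[of 1 alg "l' * l" alg "- 1" 1]
      tensor_null.smult_left[of "l' * l" alg 1 alg "- 1" 1]
    by simp_all
  note null = this
  have "prim_tensor ?c - (?X + - ?Y) \<in> tensor_null alg alg"
    using tensor_null.plus[OF tensor_null.plus[OF null(1,2)] tensor_null.plus[OF null(3,4)]]
    by (simp add: single_uminus algebra_simps)
  then have "(?X + - ?Y) - prim_tensor ?c \<in> tensor_null alg alg"
    using tensor_null_uminus by fastforce
  then have "?c \<in> prims"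
    using comult_memI[OF mem] unfolding primitives_iff by blast
  then show ?thesis by simp
qed

lemma subspace_primitives: "subspace prims"
  by (simp add: subspace_def primitives_add primitives_scale primitives_zero)

end

section \<open>The dual algebra\<close>

context bialgebra
begin

definition conv :: "('h \<Rightarrow> 'k) \<Rightarrow> ('h \<Rightarrow> 'k) \<Rightarrow> 'h \<Rightarrow> 'k" where
  "conv p q h = sweedler (\<lambda>a b. p a * q b) h"

lemma dual_simps [simp]:
  "carrier dual = {p. lin p}" "p \<otimes>\<^bsub>dual\<^esub> q = conv p q" "\<one>\<^bsub>dual\<^esub> = counit"
  "\<zero>\<^bsub>dual\<^esub> = (\<lambda>_. 0)" "p \<oplus>\<^bsub>dual\<^esub> q = (\<lambda>h. p h + q h)" "c \<odot>\<^bsub>dual\<^esub> p = (\<lambda>h. c * p h)"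
  by (auto simp: dual_algebra_def conv_def tensor_lift_scalars fun_eq_iff)

lemma lin_conv: "lin p \<Longrightarrow> lin q \<Longrightarrow> lin (conv p q)"
  using lin_sweedler[OF bilin_product] by (simp add: conv_def[abs_def])

lemma conv_one: "lin p \<Longrightarrow> lin q \<Longrightarrow> conv p q 1 = p 1 * q 1"
  using sweedler_one[OF bilin_product] by (simp add: conv_def)

text \<open>
  Right translation by a primitive element is a derivation of the convolution product.
\<close>

lemma conv_mult_primitive:
  assumes "lin p" "lin q" "l \<in> prims"
  shows "conv p q (g * l) = conv (\<lambda>x. p (x * l)) q g + conv p (\<lambda>x. q (x * l)) g"
  using sweedler_mult_primitive[OF bilin_product[OF assms(1,2)] assms(3)]
  by (simp add: conv_def)

lemma conv_primitive:
  "lin p \<Longrightarrow> lin q \<Longrightarrow> l \<in> prims \<Longrightarrow> conv p q l = p l * q 1 + p 1 * q l"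
  using sweedler_primitive[OF bilin_product] by (simp add: conv_def)

lemma conv_add_left: "conv (\<lambda>h. p h + p' h) q h = conv p q h + conv p' q h"
  and conv_add_right: "conv p (\<lambda>h. q h + q' h) h = conv p q h + conv p q' h"
  by (simp_all add: conv_def sweedler_add_form[symmetric] algebra_simps)

lemma conv_scale_left: "conv (\<lambda>h. c * p h) q h = c * conv p q h"
  and conv_scale_right: "conv p (\<lambda>h. c * q h) h = c * conv p q h"
  by (simp_all add: conv_def sweedler_scale_form[symmetric] algebra_simps)

lemma conv_zero_left: "conv (\<lambda>_. 0) q h = 0" and conv_zero_right: "conv p (\<lambda>_. 0) h = 0"
  using conv_scale_left[of 0 "\<lambda>_. 0" q h] conv_scale_right[of p 0 "\<lambda>_. 0" h] by simp_all

text \<open>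
  The standard filtration of an enveloping algebra, by the number of primitive factors.
\<close>

definition filt :: "nat \<Rightarrow> 'h set" where
  "filt m = span {prod_list ws | ws. set ws \<subseteq> prims \<and> length ws \<le> m}"

lemma word_in_filt: "set ws \<subseteq> prims \<Longrightarrow> length ws \<le> m \<Longrightarrow> prod_list ws \<in> filt m"
  unfolding filt_def by (rule span_base) auto

lemma filt_mono: "m \<le> n \<Longrightarrow> filt m \<subseteq> filt n"
  unfolding filt_def by (rule span_mono) (auto intro: order_trans)

lemma one_in_filt: "1 \<in> filt m"
  using word_in_filt[of "[]" m] by simp

lemma primitive_in_filt: "l \<in> prims \<Longrightarrow> l \<in> filt 1"
  using word_in_filt[of "[l]" 1] by simp

lemma filt_closed:
  "x \<in> filt m \<Longrightarrow> y \<in> filt m \<Longrightarrow> x + y \<in> filt m"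
  "x \<in> filt m \<Longrightarrow> y \<in> filt m \<Longrightarrow> x - y \<in> filt m"
  "x \<in> filt m \<Longrightarrow> scale c x \<in> filt m"
  unfolding filt_def by (auto intro: span_add span_diff span_scale)

lemma subspace_filt: "subspace (filt m)"
  unfolding filt_def by (rule subspace_span)

lemma filt_induct [consumes 1, case_names word zero add scale]:
  assumes "x \<in> filt m"
    and "\<And>ws. set ws \<subseteq> prims \<Longrightarrow> length ws \<le> m \<Longrightarrow> P (prod_list ws)"
    and "P 0" "\<And>x y. P x \<Longrightarrow> P y \<Longrightarrow> P (x + y)" "\<And>c x. P x \<Longrightarrow> P (scale c x)"
  shows "P x"
proof -
  have "subspace {x. P x}" using assms(3-5) by (simp add: subspace_def)
  moreover have "{prod_list ws | ws. set ws \<subseteq> prims \<and> length ws \<le> m} \<subseteq> {x. P x}"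
    using assms(2) by auto
  ultimately show ?thesis using assms(1) span_minimal unfolding filt_def by blast
qed

lemma filt_mult: assumes "x \<in> filt i" "y \<in> filt j" shows "x * y \<in> filt (i + j)"
  using assms(1)
proof (induct rule: filt_induct)
  case (word ws)
  show ?case using assms(2)
  proof (induct rule: filt_induct)
    case (word vs)
    then show ?case
      using word_in_filt[of "ws @ vs" "i + j"] \<open>set ws \<subseteq> prims\<close> \<open>length ws \<le> i\<close> by simp
  qed (auto simp: distrib_left scale_mult_right filt_closed subspace_0[OF subspace_filt])
qed (auto simp: distrib_right scale_mult_left filt_closed subspace_0[OF subspace_filt])

lemma ring_alg: "ring alg"
  using algebra by (simp add: k_algebra_def)

lemma a_inv_alg: "\<ominus>\<^bsub>alg\<^esub> x = - x"
proof -
  interpret ring alg by (rule ring_alg)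
  show ?thesis using minus_equality[of "- x" x] by simp
qed

text \<open>
  The union of the filtration is a subalgebra that contains the primitive elements.
\<close>

lemma ex_filt:
  assumes "primitively_generated scale comult" shows "\<exists>m. h \<in> filt m"
proof -
  interpret R: ring alg by (rule ring_alg)
  let ?S = "\<Union>m. filt m"
  have common: "\<exists>m. x \<in> filt m \<and> y \<in> filt m" if "x \<in> filt i" "y \<in> filt j" for x y i j
    using that filt_mono[of i "i + j"] filt_mono[of j "i + j"] by auto
  have "subring ?S alg"
  proof (rule R.subringI)
    show "h1 \<oplus>\<^bsub>alg\<^esub> h2 \<in> ?S" if "h1 \<in> ?S" "h2 \<in> ?S" for h1 h2
      using that common filt_closed(1) by simp blast
    show "\<ominus>\<^bsub>alg\<^esub> h \<in> ?S" if "h \<in> ?S" for h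
      using that filt_closed(3)[of h _ "- 1"] by (auto simp: a_inv_alg)
  qed (use one_in_filt filt_mult in \<open>simp_all, blast+\<close>)
  then have "is_subalgebra ?S alg"
    unfolding is_subalgebra_def using filt_closed(3) by simp blast
  moreover have "prims \<subseteq> ?S" using primitive_in_filt by blast
  ultimately have "generated_subalgebra alg prims \<subseteq> ?S"
    unfolding generated_subalgebra_def by blast
  then show ?thesis using assms by (auto simp: primitively_generated_def)
qed

end

locale primitively_generated_bialgebra = bialgebra scale comult counit
  for scale :: "'k::field \<Rightarrow> 'h::ring_1 \<Rightarrow> 'h"
    and comult :: "'h \<Rightarrow> ('h \<times> 'h \<Rightarrow>\<^sub>0 'k) set"
    and counit :: "'h \<Rightarrow> 'k" +
  assumes primitively_generated: "primitively_generated scale comult"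
begin

text \<open>
  Linear maps are compared on words in the primitive elements. Combined with the Leibniz
  rule, which shortens words from the right, this proves associativity and the unit laws
  of the convolution product for all functionals at once.
\<close>

lemma lin_eqI:
  assumes "lin f" "lin g"
    and eq: "\<And>ws. set ws \<subseteq> prims \<Longrightarrow> f (prod_list ws) = g (prod_list ws)"
  shows "f h = g h"
proof -
  obtain m where "h \<in> filt m" using ex_filt[OF primitively_generated] by blast
  then show ?thesis
    by (induct rule: filt_induct) (simp_all add: eq lin_add lin_scale lin_zero assms(1,2))
qed

lemma conv_assoc:
  assumes "lin p" "lin q" "lin r"
  shows "conv (conv p q) r h = conv p (conv q r) h"
proof (rule lin_eqI)
  fix ws assume "set ws \<subseteq> prims"
  then show "conv (conv p q) r (prod_list ws) = conv p (conv q r) (prod_list ws)"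
    using assms
  proof (induct ws arbitrary: p q r rule: rev_induct)
    case Nil
    then show ?case by (simp add: conv_one lin_conv)
  next
    case (snoc l ws)
    then show ?case
      by (simp add: conv_mult_primitive lin_conv lin_mult_right conv_add_left conv_add_right)
  qed
qed (auto intro: lin_conv assms)

lemma conv_counit:
  assumes "lin q"
  shows "conv counit q h = q h" "conv q counit h = q h"
proof -
  show "conv counit q h = q h"
  proof (rule lin_eqI)
    fix ws assume "set ws \<subseteq> prims"
    then show "conv counit q (prod_list ws) = q (prod_list ws)"
      using assms
    proof (induct ws arbitrary: q rule: rev_induct)
      case (snoc l ws)
      then show ?case
        by (simp add: conv_mult_primitive lin_counit lin_mult_right counit_mult counit_primitive
            conv_zero_left)
    qed (simp add: conv_one lin_counit counit_one)
  qed (auto intro: lin_conv lin_counit assms)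
  show "conv q counit h = q h"
  proof (rule lin_eqI)
    fix ws assume "set ws \<subseteq> prims"
    then show "conv q counit (prod_list ws) = q (prod_list ws)"
      using assms
    proof (induct ws arbitrary: q rule: rev_induct)
      case (snoc l ws)
      then show ?case
        by (simp add: conv_mult_primitive lin_counit lin_mult_right counit_mult counit_primitive
            conv_zero_right)
    qed (simp add: conv_one lin_counit counit_one)
  qed (auto intro: lin_conv lin_counit assms)
qed

text \<open>
  Left translation by \<open>h\<close> is expanded by the comultiplication of
  \<open>h\<close>. Both sides obey the same Leibniz rule in \<open>g\<close>, and for
  \<open>g = 1\<close> the claim is the definition of the convolution product.
\<close>

lemma conv_translate:
  assumes "lin a" "lin b"
  shows "conv a b (h * g) = (\<Sum>vw\<in>Poly_Mapping.keys (rep h). Poly_Mapping.lookup (rep h) vw *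
           conv (\<lambda>x. a (fst vw * x)) (\<lambda>x. b (snd vw * x)) g)"
proof (rule lin_eqI[of "\<lambda>g. conv a b (h * g)"])
  show "lin (\<lambda>g. \<Sum>vw\<in>Poly_Mapping.keys (rep h). Poly_Mapping.lookup (rep h) vw *
          conv (\<lambda>x. a (fst vw * x)) (\<lambda>x. b (snd vw * x)) g)"
    by (rule linI)
      (simp_all add: lin_add lin_scale lin_conv lin_mult_left assms sum.distrib sum_distrib_left
        algebra_simps)
next
  fix ws assume "set ws \<subseteq> prims"
  then show "conv a b (h * prod_list ws)
     = (\<Sum>vw\<in>Poly_Mapping.keys (rep h). Poly_Mapping.lookup (rep h) vw *
          conv (\<lambda>x. a (fst vw * x)) (\<lambda>x. b (snd vw * x)) (prod_list ws))"
    using assms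
  proof (induct ws arbitrary: a b rule: rev_induct)
    case Nil
    then show ?case
      by (simp add: conv_one lin_mult_left) (simp add: conv_def sweedler_def lin_ext_def)
  next
    case (snoc l ws)
    have "conv a b (h * prod_list (ws @ [l])) = conv a b ((h * prod_list ws) * l)"
      by (simp add: mult.assoc)
    also have "\<dots> = conv (\<lambda>x. a (x * l)) b (h * prod_list ws)
        + conv a (\<lambda>x. b (x * l)) (h * prod_list ws)"
      using snoc.prems by (intro conv_mult_primitive) auto
    also have "\<dots> = (\<Sum>vw\<in>Poly_Mapping.keys (rep h). Poly_Mapping.lookup (rep h) vw *
          conv (\<lambda>x. a (fst vw * x)) (\<lambda>x. b (snd vw * x)) (prod_list ws * l))"
      using snoc.prems
      by (simp add: snoc.hyps lin_mult_right lin_mult_left conv_mult_primitive sum.distrib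
          distrib_left mult.assoc)
    finally show ?case by simp
  qed
qed (auto intro: lin_mult_left lin_conv assms)

lemma ring_dual: "ring dual"
proof (rule ringI)
  show "abelian_group dual"
    by (rule abelian_groupI)
      (auto simp: lin_iff fun_eq_iff algebra_simps intro!: exI[of _ "\<lambda>h. - x h" for x])
  show "monoid dual"
    by (rule monoidI) (auto simp: lin_conv lin_counit conv_assoc conv_counit fun_eq_iff)
qed (auto simp: conv_add_left conv_add_right)

lemma a_inv_dual: assumes "lin p" shows "\<ominus>\<^bsub>dual\<^esub> p = (\<lambda>h. - p h)"
proof -
  interpret ring dual by (rule ring_dual)
  have "lin (\<lambda>h. - p h)" using assms by (simp add: lin_iff)
  then show ?thesis using minus_equality[of "\<lambda>h. - p h" p] assms by simp
qed

lemma subalgebra_dualI: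
  assumes "\<And>q. q \<in> S \<Longrightarrow> lin q" "counit \<in> S"
    and "\<And>q r. q \<in> S \<Longrightarrow> r \<in> S \<Longrightarrow> (\<lambda>h. q h + r h) \<in> S"
    and scale: "\<And>c q. q \<in> S \<Longrightarrow> (\<lambda>h. c * q h) \<in> S"
    and "\<And>q r. q \<in> S \<Longrightarrow> r \<in> S \<Longrightarrow> conv q r \<in> S"
  shows "is_subalgebra S dual"
proof -
  interpret ring dual by (rule ring_dual)
  have "\<ominus>\<^bsub>dual\<^esub> q \<in> S" if "q \<in> S" for q
    using scale[OF that, of "- 1"] assms(1)[OF that] by (simp add: a_inv_dual)
  then have "subring S dual"
    using assms by (intro subringI) auto
  then show ?thesis using scale by (simp add: is_subalgebra_def)
qed

lemma subalgebra_dual_lin: "is_subalgebra S dual \<Longrightarrow> q \<in> S \<Longrightarrow> lin q"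
  using subringE(1)[of S dual] by (auto simp: is_subalgebra_def)

lemma k_algebra_subalgebra_dual:
  assumes "is_subalgebra S dual" shows "k_algebra (dual\<lparr>carrier := S\<rparr>)"
proof -
  have sub: "subring S dual" and scale: "\<And>c q. q \<in> S \<Longrightarrow> (\<lambda>h. c * q h) \<in> S"
    using assms by (auto simp: is_subalgebra_def)
  have ring: "ring (dual\<lparr>carrier := S\<rparr>)"
    by (rule ring.subring_is_ring[OF ring_dual sub])
  have "module scalars (dual\<lparr>carrier := S\<rparr>)"
    using scale ring
    by (intro moduleI cring_scalars) (auto simp: ring_def algebra_simps)
  then show ?thesis
    using ring
    by (auto simp: k_algebra_def k_algebra_axioms_def conv_scale_left conv_scale_right fun_eq_iff)
qed

lemma augmented_subalgebra_dual:
  assumes "is_subalgebra S dual"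
  shows "augmented_algebra (dual\<lparr>carrier := S\<rparr>) (\<lambda>q. q 1)"
  using k_algebra_subalgebra_dual[OF assms] subalgebra_dual_lin[OF assms]
  by (auto simp: augmented_algebra_def alg_hom_def ring_hom_def conv_one counit_one)

end

text \<open>
  Sums in spaces of functions are pointwise; \<open>S\<close> may be any set of
  functions that is closed under addition.
\<close>

lemma (in bialgebra) finsum_functions:
  assumes "abelian_monoid (dual\<lparr>carrier := S\<rparr>)" "finite A" "\<And>a. a \<in> A \<Longrightarrow> f a \<in> S"
  shows "(\<Oplus>\<^bsub>dual\<lparr>carrier := S\<rparr>\<^esub>a\<in>A. f a) = (\<lambda>h. \<Sum>a\<in>A. f a h)"
  using assms(2,3)
proof (induct A rule: finite_induct)
  case empty
  then show ?case using abelian_monoid.finsum_empty[OF assms(1)] by simp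
next
  case (insert a A)
  then show ?case
    by (subst abelian_monoid.finsum_insert[OF assms(1)]) (auto simp: fun_eq_iff)
qed

context primitively_generated_bialgebra
begin

text \<open>
  The action is \<open>(q \<triangleleft> h) g = q (h * g)\<close>; its compatibility
  with products is \<open>conv_translate\<close>.
\<close>

lemma right_module_subalgebra_dual:
  assumes "is_subalgebra S dual" and translate: "\<And>q h. q \<in> S \<Longrightarrow> (\<lambda>g. q (h * g)) \<in> S"
  shows "right_module_algebra scale comult (dual\<lparr>carrier := S\<rparr>) (\<lambda>q h g. q (h * g))"
proof -
  interpret k_algebra "dual\<lparr>carrier := S\<rparr>"
    by (rule k_algebra_subalgebra_dual[OF assms(1)])
  have am: "abelian_monoid (dual\<lparr>carrier := S\<rparr>)" ..
  have lin: "lin q" if "q \<in> S" for q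
    using subalgebra_dual_lin[OF assms(1) that] .
  have mult_closed: "conv q r \<in> S" if "q \<in> S" "r \<in> S" for q r
    using subringE(6)[of S dual q r] that assms(1) by (simp add: is_subalgebra_def)
  have smult: "(\<lambda>h. c * q h) \<in> S" if "q \<in> S" for c q
    using that assms(1) by (simp add: is_subalgebra_def)
  show ?thesis
  proof unfold_locales
    fix a b h assume "a \<in> carrier (dual\<lparr>carrier := S\<rparr>)" "b \<in> carrier (dual\<lparr>carrier := S\<rparr>)"
    then have a: "a \<in> S" "lin a" and b: "b \<in> S" "lin b" using lin by auto
    show "(\<lambda>g. (a \<otimes>\<^bsub>dual\<lparr>carrier := S\<rparr>\<^esub> b) (h * g)) = tensor_lift (dual\<lparr>carrier := S\<rparr>)
        (\<lambda>x y. (\<lambda>g. a (x * g)) \<otimes>\<^bsub>dual\<lparr>carrier := S\<rparr>\<^esub> (\<lambda>g. b (y * g))) (comult h)"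
      unfolding tensor_lift_comult
      by (subst finsum_functions[OF am])
        (auto simp: conv_translate a b intro!: smult mult_closed translate)
  qed (auto simp: translate lin lin_add lin_scale distrib_right scale_mult_left mult.assoc)
qed

end

section \<open>Monomials and power series\<close>

definition mdeg :: "(nat \<Rightarrow>\<^sub>0 nat) \<Rightarrow> nat" where
  "mdeg m = (\<Sum>i\<in>Poly_Mapping.keys m. Poly_Mapping.lookup m i)"

lemma mdeg_superset:
  "finite A \<Longrightarrow> Poly_Mapping.keys m \<subseteq> A \<Longrightarrow> mdeg m = (\<Sum>i\<in>A. Poly_Mapping.lookup m i)"
  unfolding mdeg_def by (rule sum.mono_neutral_left) (auto simp: in_keys_iff)

lemma keys_add_nat: "Poly_Mapping.keys (a + b) = Poly_Mapping.keys a \<union> Poly_Mapping.keys b"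
  for a b :: "'i \<Rightarrow>\<^sub>0 nat"
  by (auto simp: in_keys_iff lookup_add)

lemma mdeg_add: "mdeg (a + b) = mdeg a + mdeg b"
proof -
  let ?A = "Poly_Mapping.keys a \<union> Poly_Mapping.keys b"
  show ?thesis
    by (simp add: mdeg_superset[of ?A] keys_add_nat lookup_add sum.distrib)
qed

lemma mdeg_zero [simp]: "mdeg 0 = 0"
  by (simp add: mdeg_def)

lemma mdeg_single [simp]: "mdeg (Poly_Mapping.single i n) = n"
  by (simp add: mdeg_superset[of "{i}"])

lemma mdeg_eq_0_iff: "mdeg m = 0 \<longleftrightarrow> m = 0"
proof
  assume "mdeg m = 0"
  then have "Poly_Mapping.lookup m i = 0" for i
    by (cases "i \<in> Poly_Mapping.keys m") (auto simp: mdeg_def in_keys_iff)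
  then show "m = 0" by (simp add: poly_mapping_eqI)
qed simp

lemma remove_variable:
  fixes m :: "'i \<Rightarrow>\<^sub>0 nat"
  assumes "i \<in> Poly_Mapping.keys m"
  obtains m' where "m = m' + Poly_Mapping.single i 1"
proof
  show "m = (m - Poly_Mapping.single i 1) + Poly_Mapping.single i 1"
    using assms
    by (intro poly_mapping_eqI) (auto simp: lookup_add lookup_minus lookup_single when_def in_keys_iff)
qed

lemma lookup_le_mdeg: "Poly_Mapping.lookup m i \<le> mdeg m"
  by (cases "i \<in> Poly_Mapping.keys m") (auto simp: mdeg_def in_keys_iff intro: member_le_sum)

lemma finite_bounded_monomials:
  "finite {m. Poly_Mapping.keys m \<subseteq> {..<N} \<and> mdeg m \<le> d}"
proof -
  let ?M = "{m. Poly_Mapping.keys m \<subseteq> {..<N} \<and> mdeg m \<le> d}"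
  have "Poly_Mapping.lookup ` ?M
      \<subseteq> {f. \<forall>i. (i \<in> {..<N} \<longrightarrow> f i \<in> {..d}) \<and> (i \<notin> {..<N} \<longrightarrow> f i = 0)}"
    using lookup_le_mdeg by (auto simp: in_keys_iff intro: order_trans)
  then have "finite (Poly_Mapping.lookup ` ?M)"
    by (rule finite_subset) (intro finite_set_of_finite_funs; simp)
  then show ?thesis
    by (rule finite_imageD) (simp add: inj_on_def poly_mapping_eqI)
qed

lemma finite_antidiagonal: "finite {(b, c). b + c = (a :: nat \<Rightarrow>\<^sub>0 nat)}"
proof -
  obtain N where N: "Poly_Mapping.keys a \<subseteq> {..<N}"
    using finite_nat_iff_bounded finite_keys by blast
  let ?M = "{m. Poly_Mapping.keys m \<subseteq> {..<N} \<and> mdeg m \<le> mdeg a}"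
  have "{(b, c). b + c = a} \<subseteq> ?M \<times> ?M"
    using N by (auto simp: keys_add_nat mdeg_add)
  then show ?thesis
    by (rule finite_subset) (simp add: finite_bounded_monomials)
qed

text \<open>
  Division by a variable: the pairs with sum \<open>a + \<epsilon>\<^sub>j\<close> whose
  first entry contains the variable \<open>j\<close> correspond to the pairs with sum
  \<open>a\<close>, and the weight \<open>b\<^sub>j\<close> removes the remaining pairs.
\<close>

lemma antidiagonal_shift:
  fixes f :: "(nat \<Rightarrow>\<^sub>0 nat) \<Rightarrow> 'k::semiring_1" and G :: "(nat \<Rightarrow>\<^sub>0 nat) \<Rightarrow> 'k"
  shows "(\<Sum>(b, c)\<in>{(b, c). b + c = a}. of_nat (Poly_Mapping.lookup b j + 1)
            * f (b + Poly_Mapping.single j 1) * G c)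
       = (\<Sum>(b, c)\<in>{(b, c). b + c = a + Poly_Mapping.single j 1}.
            of_nat (Poly_Mapping.lookup b j) * f b * G c)"
proof -
  let ?s = "Poly_Mapping.single j (1 :: nat)"
  let ?h = "\<lambda>(b, c). (b + ?s, c)"
  let ?A = "{(b, c). b + c = a}" and ?B = "{(b, c). b + c = a + ?s}"
  let ?F = "\<lambda>(b, c). of_nat (Poly_Mapping.lookup b j) * f b * G c"
  have inj: "inj_on ?h ?A" by (auto simp: inj_on_def)
  have image: "?h ` ?A = {x \<in> ?B. j \<in> Poly_Mapping.keys (fst x)}"
  proof (intro equalityI subsetI)
    fix x assume "x \<in> ?h ` ?A"
    then obtain b c where "x = (b + ?s, c)" "b + c = a" by (elim imageE) (simp split: prod.splits)
    then show "x \<in> {x \<in> ?B. j \<in> Poly_Mapping.keys (fst x)}"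
      by (auto simp: keys_add_nat ac_simps)
  next
    fix x assume "x \<in> {x \<in> ?B. j \<in> Poly_Mapping.keys (fst x)}"
    then obtain b' c where x: "x = (b', c)" "b' + c = a + ?s" "j \<in> Poly_Mapping.keys b'"
      by (cases x) simp
    obtain b where b: "b' = b + ?s" using remove_variable[OF x(3)] .
    have "(b + c) + ?s = a + ?s"
      using x(2) unfolding b by (simp only: add.assoc add.commute[of c])
    then have "b + c = a" by (rule add_right_imp_eq)
    then show "x \<in> ?h ` ?A" using x(1) b by (intro image_eqI[of _ _ "(b, c)"]) simp_all
  qed
  have "(\<Sum>x\<in>?B. ?F x) = (\<Sum>x\<in>{x \<in> ?B. j \<in> Poly_Mapping.keys (fst x)}. ?F x)"
  proof (rule sum.mono_neutral_right)
    have "?F x = 0" if "j \<notin> Poly_Mapping.keys (fst x)" for x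
      using that by (cases x) (simp add: in_keys_iff)
    then show "\<forall>x\<in>?B - {x \<in> ?B. j \<in> Poly_Mapping.keys (fst x)}. ?F x = 0" by blast
  qed (auto simp: finite_antidiagonal)
  also have "\<dots> = (\<Sum>x\<in>?A. ?F (?h x))"
    unfolding image[symmetric] by (rule sum.reindex_cong[OF inj]) auto
  also have "\<dots> = (\<Sum>(b, c)\<in>?A. of_nat (Poly_Mapping.lookup b j + 1) * f (b + ?s) * G c)"
    by (rule sum.cong) (auto simp: lookup_add)
  finally show ?thesis ..
qed

lemma antidiagonal_commute:
  "(\<Sum>(b, c)\<in>{(b, c). b + c = (a :: nat \<Rightarrow>\<^sub>0 nat)}. f c b) = (\<Sum>(b, c)\<in>{(b, c). b + c = a}. f b c)"
  by (rule sum.reindex_bij_witness[of _ prod.swap prod.swap]) (auto simp: add.commute[of _ "_ :: nat \<Rightarrow>\<^sub>0 nat"])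

lemma power_series_simps:
  "carrier (power_series N) = {f. \<forall>m. \<not> Poly_Mapping.keys m \<subseteq> {..<N} \<longrightarrow> f m = 0}"
  "f \<otimes>\<^bsub>power_series N\<^esub> g = (\<lambda>m. \<Sum>(a, b)\<in>{(a, b). a + b = m}. f a * g b)"
  "\<one>\<^bsub>power_series N\<^esub> = (\<lambda>m. if m = 0 then 1 else 0)"
  "\<zero>\<^bsub>power_series N\<^esub> = (\<lambda>_. 0)"
  "f \<oplus>\<^bsub>power_series N\<^esub> g = (\<lambda>m. f m + g m)"
  "c \<odot>\<^bsub>power_series N\<^esub> f = (\<lambda>m. c * f m)"
  by (simp_all add: power_series_def)

section \<open>Ordered monomials in the coordinates\<close>

context bialgebra
begin

text \<open>
  The commutator with \<open>l\<close> is a derivation that replaces one primitive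
  factor of a word by a commutator, which is again primitive; so it does not lengthen
  words.
\<close>

lemma commutator_in_filt:
  assumes "l \<in> prims" "u \<in> filt m" shows "l * u - u * l \<in> filt m"
  using assms(2)
proof (induct rule: filt_induct)
  case (word ws)
  then show ?case
  proof (induct ws arbitrary: m)
    case Nil
    then show ?case by (simp add: subspace_0[OF subspace_filt])
  next
    case (Cons x ws)
    then obtain n where m: "m = Suc n" by (cases m) auto
    have "(l * x - x * l) * prod_list ws \<in> filt (1 + n)"
      using Cons.prems assms(1) m
      by (intro filt_mult primitive_in_filt primitives_commutator word_in_filt) auto
    moreover have "x * (l * prod_list ws - prod_list ws * l) \<in> filt (1 + n)"
      using Cons m by (intro filt_mult primitive_in_filt) auto
    ultimately have "(l * x - x * l) * prod_list ws + x * (l * prod_list ws - prod_list ws * l)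
        \<in> filt (1 + n)"
      by (rule filt_closed)
    then show ?case by (simp add: m algebra_simps)
  qed
next
  case (add x y)
  have "l * (x + y) - (x + y) * l = (l * x - x * l) + (l * y - y * l)"
    by (simp add: algebra_simps)
  then show ?case using filt_closed(1)[OF add] by simp
next
  case (scale c x)
  have "l * scale c x - scale c x * l = scale c (l * x - x * l)"
    by (simp add: scale_mult_left scale_mult_right scale_right_diff_distrib)
  then show ?case using filt_closed(3)[OF scale] by simp
qed (simp add: subspace_0[OF subspace_filt])

lemma primitive_power_in_filt: "l \<in> prims \<Longrightarrow> l ^ n \<in> filt n"
  using word_in_filt[of "replicate n l" n] by (simp add: set_replicate_conv_if)

lemma ordered_product_in_filt:
  "(\<And>i. i \<in> set is \<Longrightarrow> e i \<in> prims) \<Longrightarrow> prod_list (map (\<lambda>i. e i ^ f i) is) \<in> filt (sum_list (map f is))"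
  by (induct "is") (auto intro: one_in_filt filt_mult primitive_power_in_filt)

definition lie_annihilator :: "('h \<Rightarrow> 'k) \<Rightarrow> 'h set" where
  "lie_annihilator p = {l \<in> prims. \<forall>g. p (g * l) = 0}"

text \<open>
  The dual space of the quotient of \<open>H\<close> by the left ideal that
  \<open>lie_annihilator p\<close> generates.
\<close>

definition invariants :: "('h \<Rightarrow> 'k) \<Rightarrow> ('h \<Rightarrow> 'k) set" where
  "invariants p = {q. lin q \<and> (\<forall>l\<in>lie_annihilator p. \<forall>g. q (g * l) = 0)}"

end

text \<open>
  The \<open>e i\<close> are a basis of the primitive elements modulo the annihilator of
  \<open>p\<close>, and the \<open>d i\<close> are elements of \<open>H\<close> for
  which the functionals \<open>p (d i * _)\<close> are the dual basis. The last
  assumption says that \<open>l - \<Sum>\<^sub>i p (d i * l) e i\<close> annihilates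
  \<open>p\<close>.
\<close>

locale lie_coordinates = primitively_generated_bialgebra scale comult counit
  for scale :: "'k::field_char_0 \<Rightarrow> 'h::ring_1 \<Rightarrow> 'h"
    and comult :: "'h \<Rightarrow> ('h \<times> 'h \<Rightarrow>\<^sub>0 'k) set"
    and counit :: "'h \<Rightarrow> 'k" +
  fixes p :: "'h \<Rightarrow> 'k" and N :: nat and e :: "nat \<Rightarrow> 'h" and d :: "nat \<Rightarrow> 'h"
  assumes lin_p: "lin p"
    and e_primitive: "i < N \<Longrightarrow> e i \<in> prims"
    and biorthogonal: "\<lbrakk>i < N; j < N\<rbrakk> \<Longrightarrow> p (d j * e i) = (if i = j then 1 else 0)"
    and reconstruct: "l \<in> prims \<Longrightarrow> p (x * l) = (\<Sum>i<N. p (d i * l) * p (x * e i))"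
begin

abbreviation "S \<equiv> invariants p"

abbreviation monom_in :: "(nat \<Rightarrow>\<^sub>0 nat) \<Rightarrow> bool" where
  "monom_in m \<equiv> Poly_Mapping.keys m \<subseteq> {..<N}"

definition mon :: "(nat \<Rightarrow>\<^sub>0 nat) \<Rightarrow> 'h" where
  "mon m = prod_list (map (\<lambda>i. e i ^ Poly_Mapping.lookup m i) [0..<N])"

lemma mon_zero: "mon 0 = 1"
  by (simp add: mon_def map_replicate_const)

lemma upt_split_at:
  assumes "j < n" shows "[0..<n] = [0..<j] @ j # [Suc j..<n]"
  using upt_add_eq_append[of 0 j "n - j"] upt_conv_Cons[OF assms] assms by simp

lemma mon_split:
  assumes "j < N"
  shows "mon m = prod_list (map (\<lambda>i. e i ^ Poly_Mapping.lookup m i) [0..<j])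
     * e j ^ Poly_Mapping.lookup m j
     * prod_list (map (\<lambda>i. e i ^ Poly_Mapping.lookup m i) [Suc j..<N])"
  by (simp add: mon_def upt_split_at[OF assms] mult.assoc)

lemma mon_in_filt: "monom_in m \<Longrightarrow> mon m \<in> filt (mdeg m)"
  using ordered_product_in_filt[of "[0..<N]" e "Poly_Mapping.lookup m"] e_primitive
  by (simp add: mon_def mdeg_superset[of "{..<N}"] interv_sum_list_conv_sum_set_nat
      atLeast0LessThan)

lemma mon_add_last:
  assumes "j < N" "Poly_Mapping.keys m \<subseteq> {..j}"
  shows "mon (m + Poly_Mapping.single j 1) = mon m * e j"
proof -
  have zero: "Poly_Mapping.lookup m i = 0" if "i > j" for i
    using assms(2) that by (force simp: in_keys_iff)
  have "map (\<lambda>i. e i ^ Poly_Mapping.lookup m i) [Suc j..<N] = map (\<lambda>i. 1) [Suc j..<N]"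
    using zero by simp
  moreover have "map (\<lambda>i. e i ^ Poly_Mapping.lookup (m + Poly_Mapping.single j 1) i) [Suc j..<N]
      = map (\<lambda>i. 1) [Suc j..<N]"
    using zero by (simp add: lookup_add lookup_single)
  moreover have "map (\<lambda>i. e i ^ Poly_Mapping.lookup (m + Poly_Mapping.single j 1) i) [0..<j]
      = map (\<lambda>i. e i ^ Poly_Mapping.lookup m i) [0..<j]"
    by (simp add: lookup_add lookup_single)
  ultimately show ?thesis
    unfolding mon_split[OF assms(1)]
    by (simp only: lookup_add lookup_single_eq power_add power_one_right)
      (simp add: map_replicate_const mult.assoc)
qed

text \<open>
  To insert \<open>e j\<close> at its place in the ordered monomial, it is moved past
  the factors with smaller index; the commutator that this costs is shorter by one
  factor.
\<close>

lemma mult_mon_in_filt: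
  assumes "j < N" "monom_in m"
  shows "e j * mon m - mon (m + Poly_Mapping.single j 1) \<in> filt (mdeg m)"
proof -
  let ?f = "\<lambda>i. e i ^ Poly_Mapping.lookup m i"
  let ?u = "prod_list (map ?f [0..<j])"
  let ?v = "e j ^ Poly_Mapping.lookup m j * prod_list (map ?f [Suc j..<N])"
  have m: "mon m = ?u * ?v"
    using mon_split[OF assms(1)] by (simp add: mult.assoc)
  have cong: "map (\<lambda>i. e i ^ Poly_Mapping.lookup (m + Poly_Mapping.single j 1) i) [0..<j] = map ?f [0..<j]"
    "map (\<lambda>i. e i ^ Poly_Mapping.lookup (m + Poly_Mapping.single j 1) i) [Suc j..<N] = map ?f [Suc j..<N]"
    by (simp_all add: lookup_add lookup_single)
  have m': "mon (m + Poly_Mapping.single j 1) = ?u * e j * ?v"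
    unfolding mon_split[OF assms(1)] cong
    by (simp add: lookup_add mult.assoc)
  let ?k = "sum_list (map (Poly_Mapping.lookup m) [0..<j])"
  let ?n = "Poly_Mapping.lookup m j + sum_list (map (Poly_Mapping.lookup m) [Suc j..<N])"
  have "?u \<in> filt ?k"
    using assms(1) e_primitive by (intro ordered_product_in_filt) auto
  moreover have v: "?v \<in> filt ?n"
    using assms(1) e_primitive
    by (intro filt_mult primitive_power_in_filt ordered_product_in_filt) auto
  ultimately have "(e j * ?u - ?u * e j) * ?v \<in> filt (?k + ?n)"
    using assms(1) e_primitive filt_mult[OF commutator_in_filt] by blast
  moreover have "mdeg m = ?k + ?n"
  proof -
    have "mdeg m = sum_list (map (Poly_Mapping.lookup m) [0..<N])"
      using assms(2) by (simp add: mdeg_superset[of "{..<N}"] interv_sum_list_conv_sum_set_nat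
        atLeast0LessThan)
    then show ?thesis by (simp add: upt_split_at[OF assms(1)])
  qed
  ultimately show ?thesis by (simp add: m m' algebra_simps del: One_nat_def)
qed

text \<open>
  Ordered monomials of bounded degree, together with the whole left ideal on which the
  invariant functionals vanish.
\<close>

definition pbw_span :: "nat \<Rightarrow> 'h set" where
  "pbw_span n = span ({mon m | m. monom_in m \<and> mdeg m \<le> n} \<union> {g * l | g l. l \<in> lie_annihilator p})"

lemma residue_in_annihilator:
  assumes "l \<in> prims"
  shows "l - (\<Sum>i<N. scale (p (d i * l)) (e i)) \<in> lie_annihilator p"
proof -
  have "(\<Sum>i<N. scale (p (d i * l)) (e i)) \<in> prims"
    using e_primitive by (intro subspace_sum subspace_primitives subspace_scale) auto
  moreover have "p (x * (l - (\<Sum>i<N. scale (p (d i * l)) (e i)))) = 0" for x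
    using reconstruct[OF assms, of x]
    by (simp add: right_diff_distrib lin_diff[OF lin_p] sum_distrib_left lin_sum[OF _ lin_p]
        scale_mult_right lin_scale[OF lin_p])
  ultimately show ?thesis
    using assms subspace_diff[OF subspace_primitives] by (auto simp: lie_annihilator_def)
qed

text \<open>
  The spanning half of the Poincare-Birkhoff-Witt theorem. By induction on the length of
  a word it suffices to multiply an ordered monomial from the left by a primitive
  element. The component of that element along \<open>e i\<close> is inserted at its
  place, the component in the annihilator is moved to the right end, and both operations
  change the product only by shorter words.
\<close>

lemma filt_subset_pbw_span: "filt n \<subseteq> pbw_span n"
proof (induct n)
  case 0
  have "1 \<in> pbw_span 0"
    unfolding pbw_span_def using mon_zero by (intro span_base) (auto intro!: exI[of _ 0])
  then show ?case
    unfolding filt_def by (intro span_minimal) (auto simp: pbw_span_def subspace_span)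
next
  case (Suc n)
  have mono: "pbw_span n \<subseteq> pbw_span (Suc n)"
    unfolding pbw_span_def by (rule span_mono) auto
  have W: "g * l \<in> pbw_span k" if "l \<in> lie_annihilator p" for g l k
    unfolding pbw_span_def using that by (intro span_base) auto
  have sub: "subspace (pbw_span k)" for k
    unfolding pbw_span_def by (rule subspace_span)
  have filt_le: "x \<in> pbw_span (Suc n)" if "x \<in> filt k" "k \<le> n" for x k
    using that filt_mono[of k n] Suc mono by blast
  have mult_mon: "l * mon m \<in> pbw_span (Suc n)"
    if l: "l \<in> prims" and m: "monom_in m" "mdeg m \<le> n" for l m
  proof -
    let ?s = "\<Sum>i<N. scale (p (d i * l)) (e i)"
    let ?r = "l - ?s"
    have r: "?r \<in> lie_annihilator p" "?r \<in> prims"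
      using residue_in_annihilator[OF l] by (auto simp: lie_annihilator_def)
    \<comment> \<open>the part of \<open>l\<close> in the annihilator may be moved to the right of the
        monomial\<close>
    have "?r * mon m - mon m * ?r \<in> pbw_span (Suc n)"
      by (rule filt_le[OF commutator_in_filt[OF r(2) mon_in_filt[OF m(1)]] m(2)])
    from subspace_add[OF sub this W[OF r(1), of "mon m"]] have 1: "?r * mon m \<in> pbw_span (Suc n)"
      by (simp only: diff_add_cancel)
    have "e i * mon m \<in> pbw_span (Suc n)" if "i < N" for i
    proof -
      have "mon (m + Poly_Mapping.single i 1) \<in> pbw_span (Suc n)"
        unfolding pbw_span_def using m that
        by (intro span_base UnI1 CollectI exI[of _ "m + Poly_Mapping.single i 1"])
          (simp add: keys_add_nat mdeg_add)
      from subspace_add[OF sub filt_le[OF mult_mon_in_filt[OF that m(1)] m(2)] this]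
      show ?thesis by (simp only: diff_add_cancel)
    qed
    then have "?s * mon m \<in> pbw_span (Suc n)"
      unfolding sum_distrib_right scale_mult_left
      by (intro subspace_sum[OF sub] subspace_scale[OF sub]) simp
    from subspace_add[OF sub 1 this] show ?thesis
      by (simp only: left_diff_distrib diff_add_cancel)
  qed
  have step: "l * x \<in> pbw_span (Suc n)" if l: "l \<in> prims" and x: "x \<in> pbw_span n" for l x
    using x unfolding pbw_span_def[of n]
  proof (induct rule: span_induct_alt)
    case base
    then show ?case by (simp add: subspace_0[OF sub])
  next
    case (step c x y)
    from step.hyps(1) have "l * x \<in> pbw_span (Suc n)"
    proof
      assume "x \<in> {mon m | m. monom_in m \<and> mdeg m \<le> n}"
      then show ?thesis using mult_mon[OF l] by blast
    next
      assume "x \<in> {g * l | g l. l \<in> lie_annihilator p}"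
      then obtain g l' where "l' \<in> lie_annihilator p" "x = g * l'" by blast
      then show ?thesis using W[of l' "l * g"] by (simp only: mult.assoc)
    qed
    then show ?case
      using step.hyps(2) unfolding distrib_left scale_mult_right
      by (intro subspace_add[OF sub] subspace_scale[OF sub])
  qed
  have "prod_list ws \<in> pbw_span (Suc n)" if "set ws \<subseteq> prims" "length ws \<le> Suc n" for ws
  proof (cases ws)
    case Nil
    then show ?thesis using filt_le[OF one_in_filt[of 0]] by simp
  next
    case (Cons l vs)
    then show ?thesis using that step Suc word_in_filt[of vs n] by auto
  qed
  then show ?case unfolding filt_def using sub by (intro span_minimal) auto
qed

lemma invariants_lin: "q \<in> S \<Longrightarrow> lin q"
  by (simp add: invariants_def)

lemma invariants_eq_on_filt:
  assumes "q \<in> S" "r \<in> S" and eq: "\<And>m. monom_in m \<Longrightarrow> mdeg m \<le> n \<Longrightarrow> q (mon m) = r (mon m)"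
    and "h \<in> filt n"
  shows "q h = r h"
proof -
  have lin: "lin q" "lin r" using assms invariants_lin by auto
  have "h \<in> pbw_span n" using assms(4) filt_subset_pbw_span by blast
  then show ?thesis
    unfolding pbw_span_def
  proof (induct rule: span_induct_alt)
    case base
    then show ?case by (simp add: lin lin_zero)
  next
    case (step c x y)
    then have "q x = r x"
      using assms(1,2) eq by (auto simp: invariants_def)
    then show ?case using step by (simp add: lin lin_add lin_scale)
  qed
qed

text \<open>
  Right translations by elements of the annihilator are derivations, and the invariants
  are their common kernel.
\<close>

lemma invariants_subalgebra: "is_subalgebra S dual"
proof (rule subalgebra_dualI)
  show "counit \<in> S"
    by (simp add: invariants_def lin_counit counit_mult lie_annihilator_def counit_primitive)
  show "conv q r \<in> S" if "q \<in> S" "r \<in> S" for q r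
  proof -
    have "conv q r (g * l) = 0" if l: "l \<in> lie_annihilator p" for g l
    proof -
      have "(\<lambda>x. q (x * l)) = (\<lambda>_. 0)" "(\<lambda>x. r (x * l)) = (\<lambda>_. 0)"
        using \<open>q \<in> S\<close> \<open>r \<in> S\<close> l by (auto simp: invariants_def)
      then show ?thesis
        using that \<open>q \<in> S\<close> \<open>r \<in> S\<close> l
        by (simp add: conv_mult_primitive invariants_lin lie_annihilator_def conv_zero_left
            conv_zero_right)
    qed
    then show ?thesis using that by (simp add: invariants_def lin_conv)
  qed
qed (auto simp: invariants_def lin_iff algebra_simps)

lemma invariants_translate: "q \<in> S \<Longrightarrow> (\<lambda>g. q (h * g)) \<in> S"
  by (auto simp: invariants_def lin_mult_left simp flip: mult.assoc)

subsection \<open>Taylor coefficients\<close>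

definition mfact :: "(nat \<Rightarrow>\<^sub>0 nat) \<Rightarrow> 'k" where
  "mfact m = (\<Prod>i<N. fact (Poly_Mapping.lookup m i))"

lemma mfact_nonzero: "mfact m \<noteq> 0"
  by (simp add: mfact_def)

lemma mfact_add_single:
  assumes "j < N"
  shows "mfact (m + Poly_Mapping.single j 1) = of_nat (Poly_Mapping.lookup m j + 1) * mfact m"
proof -
  let ?m = "m + Poly_Mapping.single j 1"
  have "mfact ?m = fact (Poly_Mapping.lookup ?m j) * (\<Prod>i\<in>{..<N} - {j}. fact (Poly_Mapping.lookup ?m i))"
    unfolding mfact_def using assms by (intro prod.remove) auto
  also have "(\<Prod>i\<in>{..<N} - {j}. fact (Poly_Mapping.lookup ?m i))
      = (\<Prod>i\<in>{..<N} - {j}. fact (Poly_Mapping.lookup m i) :: 'k)"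
    by (intro prod.cong) (auto simp: lookup_add lookup_single)
  also have "fact (Poly_Mapping.lookup ?m j) * \<dots>
      = of_nat (Poly_Mapping.lookup m j + 1)
        * (fact (Poly_Mapping.lookup m j) * (\<Prod>i\<in>{..<N} - {j}. fact (Poly_Mapping.lookup m i)))"
    by (simp add: lookup_add algebra_simps)
  also have "fact (Poly_Mapping.lookup m j) * (\<Prod>i\<in>{..<N} - {j}. fact (Poly_Mapping.lookup m i)) = mfact m"
    unfolding mfact_def using assms by (intro prod.remove[symmetric]) auto
  finally show ?thesis .
qed

\<comment> \<open>the exponent \<open>1\<close> of a variable has to keep its form for the rules about
    adding one variable\<close>
declare One_nat_def [simp del]

text \<open>
  Division by the factorial makes the map multiplicative; the value \<open>0\<close>
  outside the first \<open>N\<close> variables places the result in the carrier of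
  \<open>power_series N\<close>.
\<close>

definition taylor :: "('h \<Rightarrow> 'k) \<Rightarrow> (nat \<Rightarrow>\<^sub>0 nat) \<Rightarrow> 'k" where
  "taylor q m = (if monom_in m then q (mon m) / mfact m else 0)"

lemma taylor_zero: "taylor q 0 = q 1"
  by (simp add: taylor_def mon_zero mfact_def)

lemma taylor_single: "i < N \<Longrightarrow> taylor q (Poly_Mapping.single i 1) = q (e i)"
  using mon_add_last[of i 0] mfact_add_single[of i 0]
  by (simp add: taylor_def mon_zero mfact_def)

lemma taylor_translate:
  assumes "j < N" "Poly_Mapping.keys m \<subseteq> {..j}"
  shows "taylor (\<lambda>x. q (x * e j)) m
    = of_nat (Poly_Mapping.lookup m j + 1) * taylor q (m + Poly_Mapping.single j 1)"
proof -
  have "monom_in m" using assms by auto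
  moreover have "(of_nat (Poly_Mapping.lookup m j + 1) :: 'k) \<noteq> 0"
    unfolding of_nat_eq_0_iff by simp
  ultimately show ?thesis
    using assms mfact_nonzero[of m]
    by (simp add: taylor_def mon_add_last mfact_add_single keys_add_nat del: of_nat_add)
qed

text \<open>
  Let \<open>j\<close> be the last variable of \<open>m = n +
  \<epsilon>\<^sub>j\<close>. Every monomial below \<open>m\<close> also has its
  variables among the first \<open>j\<close>, so appending \<open>e j\<close> to it on
  the right keeps it ordered, and right translation by \<open>e j\<close> acts on the
  relevant Taylor coefficients as the partial derivative in the variable
  \<open>j\<close>. Both sides are thus compared after differentiation, by the Leibniz
  rule and induction on the degree; the factor \<open>m\<^sub>j\<close> can be cancelled
  because the characteristic is \<open>0\<close>.
\<close>

lemma taylor_conv: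
  assumes "lin q" "lin r"
  shows "taylor (conv q r) m = (\<Sum>(a, b)\<in>{(a, b). a + b = m}. taylor q a * taylor r b)"
proof (cases "monom_in m")
  case False
  then have "taylor q a * taylor r b = 0" if "a + b = m" for a b
    using that by (auto simp: taylor_def keys_add_nat)
  then have "(\<Sum>(a, b)\<in>{(a, b). a + b = m}. taylor q a * taylor r b) = 0"
    by (intro sum.neutral) auto
  then show ?thesis using False by (simp add: taylor_def[of "conv q r"])
next
  case True
  then show ?thesis using assms
  proof (induct "mdeg m" arbitrary: m q r rule: less_induct)
    case less
    show ?case
    proof (cases "m = 0")
      case True
      then have "{(a, b). a + b = m} = {(0, 0)}"
        by (auto simp: mdeg_eq_0_iff[symmetric] mdeg_add)
      then show ?thesis using True less.prems by (simp add: taylor_zero conv_one)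
    next
      case False
      define j where "j = Max (Poly_Mapping.keys m)"
      have j_in: "j \<in> Poly_Mapping.keys m"
        unfolding j_def using False by (intro Max_in) auto
      then have j: "j < N" using less.prems by auto
      from j_in obtain n where m: "m = n + Poly_Mapping.single j 1" by (rule remove_variable)
      have keys_m: "Poly_Mapping.keys m \<subseteq> {..j}"
        unfolding j_def by auto
      then have keys: "Poly_Mapping.keys a \<subseteq> {..j}" "Poly_Mapping.keys b \<subseteq> {..j}" if "a + b = n" for a b
        using that unfolding m by (auto simp: keys_add_nat)
      have n: "monom_in n" "Poly_Mapping.keys n \<subseteq> {..j}" "mdeg n < mdeg m"
        using less.prems keys_m by (auto simp: m keys_add_nat mdeg_add)
      let ?A = "{(a, b). a + b = n}" and ?B = "{(a, b). a + b = m}"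
      let ?D = "\<lambda>q x. q (x * e j)"
      have IH: "taylor (conv q r) n = (\<Sum>(a, b)\<in>?A. taylor q a * taylor r b)"
        if "lin q" "lin r" for q r
        using less.hyps[OF n(3) n(1) that] .
      have "of_nat (Poly_Mapping.lookup m j) * taylor (conv q r) m
          = taylor (?D (conv q r)) n"
        using taylor_translate[OF j n(2)] by (simp add: m lookup_add)
      also have "\<dots> = taylor (conv (?D q) r) n + taylor (conv q (?D r)) n"
        using less.prems j e_primitive
        by (simp add: taylor_def conv_mult_primitive add_divide_distrib)
      also have "taylor (conv (?D q) r) n
          = (\<Sum>(a, b)\<in>?A. of_nat (Poly_Mapping.lookup a j + 1)
               * taylor q (a + Poly_Mapping.single j 1) * taylor r b)"
        unfolding IH[OF lin_mult_right[OF less.prems(2)] less.prems(3)]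
        by (intro sum.cong refl) (auto simp: taylor_translate[OF j keys(1)])
      also have "\<dots> = (\<Sum>(a, b)\<in>?B. of_nat (Poly_Mapping.lookup a j) * taylor q a * taylor r b)"
        unfolding m by (rule antidiagonal_shift)
      also have "taylor (conv q (?D r)) n
          = (\<Sum>(b, a)\<in>?A. of_nat (Poly_Mapping.lookup a j + 1)
               * taylor r (a + Poly_Mapping.single j 1) * taylor q b)"
        unfolding IH[OF less.prems(2) lin_mult_right[OF less.prems(3)]]
        by (intro sum.cong refl) (auto simp: taylor_translate[OF j keys(2)])
      also have "\<dots> = (\<Sum>(a, b)\<in>?A. of_nat (Poly_Mapping.lookup a j + 1)
               * taylor r (a + Poly_Mapping.single j 1) * taylor q b)"
        by (rule antidiagonal_commute)
      also have "\<dots> = (\<Sum>(a, b)\<in>?B. of_nat (Poly_Mapping.lookup a j) * taylor r a * taylor q b)"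
        unfolding m by (rule antidiagonal_shift)
      also have "\<dots> = (\<Sum>(b, a)\<in>?B. of_nat (Poly_Mapping.lookup a j) * taylor r a * taylor q b)"
        by (rule antidiagonal_commute[symmetric])
      also have "(\<Sum>(a, b)\<in>?B. of_nat (Poly_Mapping.lookup a j) * taylor q a * taylor r b) + \<dots>
          = (\<Sum>(a, b)\<in>?B. of_nat (Poly_Mapping.lookup m j) * (taylor q a * taylor r b))"
        unfolding sum.distrib[symmetric]
        by (intro sum.cong refl) (auto simp: lookup_add algebra_simps)
      also have "\<dots> = of_nat (Poly_Mapping.lookup m j) * (\<Sum>(a, b)\<in>?B. taylor q a * taylor r b)"
        by (simp add: sum_distrib_left case_prod_unfold)
      finally show ?thesis using j_in by (simp add: in_keys_iff)
    qed
  qed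
qed

lemma taylor_add: "taylor (\<lambda>h. q h + r h) m = taylor q m + taylor r m"
  and taylor_scale: "taylor (\<lambda>h. c * q h) m = c * taylor q m"
  by (simp_all add: taylor_def add_divide_distrib)

lemma taylor_sum: "finite A \<Longrightarrow> taylor (\<lambda>h. \<Sum>a\<in>A. q a h) m = (\<Sum>a\<in>A. taylor (q a) m)"
  by (simp add: taylor_def sum_divide_distrib)

lemma taylor_counit: "taylor counit m = (if m = 0 then 1 else 0)"
proof (cases "m = 0 \<or> \<not> monom_in m")
  case True
  then show ?thesis
    by (cases "m = 0") (simp_all add: taylor_zero counit_one taylor_def[of counit m])
next
  case False
  then have "m \<noteq> 0" "monom_in m" by auto
  then obtain j where "j \<in> Poly_Mapping.keys m" by fastforce
  then have "j < N" using \<open>monom_in m\<close> by auto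
  obtain k where "Poly_Mapping.lookup m j = Suc k"
    using \<open>j \<in> Poly_Mapping.keys m\<close> by (auto simp: in_keys_iff dest: gr0_implies_Suc)
  then have "counit (mon m) = 0"
    using \<open>j < N\<close>
    by (simp add: mon_split counit_mult counit_primitive[OF e_primitive])
  then show ?thesis using False by (simp add: taylor_def)
qed

lemma taylor_inj:
  assumes "q \<in> S" "r \<in> S" "taylor q = taylor r" shows "q = r"
proof
  fix h
  obtain n where "h \<in> filt n" using ex_filt[OF primitively_generated] by blast
  moreover have "q (mon m) = r (mon m)" if "monom_in m" for m
    using fun_cong[OF assms(3), of m] that mfact_nonzero by (simp add: taylor_def)
  ultimately show "q h = r h" using invariants_eq_on_filt assms(1,2) by blast
qed

text \<open>
  The translate of \<open>p\<close> by \<open>d j\<close>, normalized to vanish at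
  \<open>1\<close>. As an invariant functional it plays the part of the variable
  \<open>j\<close>.
\<close>

definition coordinate :: "nat \<Rightarrow> 'h \<Rightarrow> 'k" where
  "coordinate j h = p (d j * h) - p (d j) * counit h"

lemma coordinate_in: "coordinate j \<in> S"
proof -
  have "lin (coordinate j)"
    using lin_p lin_counit
    by (intro linI) (simp_all add: coordinate_def lin_add lin_scale distrib_left scale_mult_right
        right_diff_distrib)
  moreover have "coordinate j (g * l) = 0" if "l \<in> lie_annihilator p" for g l
    using that by (auto simp: coordinate_def lie_annihilator_def counit_mult counit_primitive
        simp flip: mult.assoc)
  ultimately show ?thesis by (simp add: invariants_def)
qed

lemma taylor_coordinate:
  assumes "j < N" "mdeg m \<le> 1"
  shows "taylor (coordinate j) m = (if m = Poly_Mapping.single j 1 then 1 else 0)"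
proof (cases "m = 0")
  case True
  then show ?thesis
    by (auto simp: taylor_zero coordinate_def counit_one dest: arg_cong[of _ _ mdeg])
next
  case False
  then obtain i where "i \<in> Poly_Mapping.keys m" by fastforce
  then obtain n where m: "m = n + Poly_Mapping.single i 1" by (rule remove_variable)
  then have "n = 0" using assms(2) by (simp add: mdeg_add mdeg_eq_0_iff)
  then have m: "m = Poly_Mapping.single i 1" using m by simp
  show ?thesis
  proof (cases "i < N")
    case True
    then show ?thesis
      using assms(1) biorthogonal[of i j] counit_primitive[OF e_primitive]
      by (auto simp: m taylor_single coordinate_def dest: arg_cong[of _ _ Poly_Mapping.keys])
  next
    case False
    then show ?thesis
      using assms(1) by (auto simp: m taylor_def dest: arg_cong[of _ _ Poly_Mapping.keys])
  qed
qed

text \<open>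
  The product of the coordinate functionals that belong to \<open>b\<close>, built one
  factor at a time. In the product with one more coordinate, Taylor coefficients of
  degree at most \<open>mdeg b\<close> involve only known coefficients: the coordinate
  has no constant term, so the other factor contributes in degree at most \<open>mdeg b
  - 1\<close>.
\<close>

lemma dual_monomial:
  assumes "monom_in b"
  shows "\<exists>q\<in>S. \<forall>a. mdeg a \<le> mdeg b \<longrightarrow> taylor q a = (if a = b then 1 else 0)"
  using assms
proof (induct "mdeg b" arbitrary: b)
  case 0
  have "counit \<in> S"
    by (simp add: invariants_def lin_counit counit_mult lie_annihilator_def counit_primitive)
  then show ?case using 0 by (intro bexI[of _ counit]) (auto simp: taylor_counit mdeg_eq_0_iff)
next
  case (Suc n)
  then obtain j where j: "j \<in> Poly_Mapping.keys b" by (force simp: mdeg_def)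
  then obtain b' where b: "b = b' + Poly_Mapping.single j 1" by (rule remove_variable)
  have jN: "j < N" using j Suc.prems by auto
  have n: "mdeg b' = n" and "monom_in b'"
    using Suc.hyps(2) Suc.prems by (auto simp: b mdeg_add keys_add_nat)
  then obtain q where q: "q \<in> S" and dual: "\<And>a. mdeg a \<le> n \<Longrightarrow> taylor q a = (if a = b' then 1 else 0)"
    using Suc.hyps(1)[of b'] by auto
  have "taylor (conv q (coordinate j)) a = (if a = b then 1 else 0)" if a: "mdeg a \<le> Suc n" for a
  proof -
    have "taylor q c * taylor (coordinate j) c'
        = (if (c, c') = (b', Poly_Mapping.single j 1) then 1 else 0)" if "c + c' = a" for c c'
    proof (cases "mdeg c \<le> n")
      case True
      show ?thesis
      proof (cases "c = b'")
        case c: True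
        then have "mdeg c' \<le> 1" using a n that by (auto simp: mdeg_add)
        then show ?thesis
          using taylor_coordinate[OF jN, of c'] dual[OF True] c by auto
      next
        case False
        then show ?thesis using dual[OF True] by simp
      qed
    next
      case False
      then have "mdeg c' = 0" using a that by (auto simp: mdeg_add)
      then have c': "c' = 0" by (simp add: mdeg_eq_0_iff)
      moreover have "(0 :: nat \<Rightarrow>\<^sub>0 nat) \<noteq> Poly_Mapping.single j 1"
        by (auto dest: arg_cong[of _ _ mdeg])
      ultimately show ?thesis using taylor_coordinate[OF jN, of c'] by simp
    qed
    then have "(\<Sum>(c, c')\<in>{(c, c'). c + c' = a}. taylor q c * taylor (coordinate j) c')
       = (\<Sum>x\<in>{(c, c'). c + c' = a}. if x = (b', Poly_Mapping.single j 1) then 1 else 0)"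
      by (intro sum.cong refl) (auto split: if_splits)
    also have "\<dots> = (if a = b then 1 else 0)"
      using finite_antidiagonal[of a] by (auto simp: b)
    finally show ?thesis
      using q coordinate_in by (simp add: taylor_conv invariants_lin)
  qed
  moreover have "conv q (coordinate j) \<in> S"
    using invariants_subalgebra q coordinate_in[of j] subringE(6)[of S dual]
    by (simp add: is_subalgebra_def)
  ultimately show ?case using Suc.hyps(2) by (metis (no_types, lifting))
qed

lemma invariants_add: "q \<in> S \<Longrightarrow> r \<in> S \<Longrightarrow> (\<lambda>h. q h + r h) \<in> S"
  by (simp add: invariants_def lin_iff algebra_simps)

lemma invariants_sum:
  "finite A \<Longrightarrow> (\<And>a. a \<in> A \<Longrightarrow> q a \<in> S) \<Longrightarrow> (\<lambda>h. \<Sum>a\<in>A. c a * q a h) \<in> S"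
  by (auto simp: invariants_def lin_iff sum.distrib sum_distrib_left algebra_simps)

text \<open>
  Coefficients are corrected degree by degree: a multiple of the functional dual to a
  monomial of degree \<open>n\<close> changes no coefficient of lower degree.
\<close>

lemma taylor_prescribed_below:
  "\<exists>q\<in>S. \<forall>a. monom_in a \<longrightarrow> mdeg a < n \<longrightarrow> taylor q a = F a"
proof (induct n)
  case 0
  have "(\<lambda>_. 0) \<in> S" by (simp add: invariants_def lin_iff)
  then show ?case by auto
next
  case (Suc n)
  then obtain q where q: "q \<in> S" "\<And>a. monom_in a \<Longrightarrow> mdeg a < n \<Longrightarrow> taylor q a = F a" by blast
  let ?B = "{b. monom_in b \<and> mdeg b = n}"
  have fin: "finite ?B"
    by (rule finite_subset[OF _ finite_bounded_monomials[of N n]]) auto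
  obtain x where x: "\<And>b. b \<in> ?B \<Longrightarrow> x b \<in> S"
    "\<And>b a. b \<in> ?B \<Longrightarrow> mdeg a \<le> n \<Longrightarrow> taylor (x b) a = (if a = b then 1 else 0)"
    using dual_monomial by (metis (mono_tags, lifting) mem_Collect_eq)
  \<comment> \<open>\<open>x b\<close> is dual to the monomial \<open>b\<close>, so this corrects
      exactly the coefficients of degree \<open>n\<close>\<close>
  let ?q = "\<lambda>h. q h + (\<Sum>b\<in>?B. (F b - taylor q b) * x b h)"
  have "?q \<in> S"
    using x(1) by (intro invariants_add q(1) invariants_sum fin)
  moreover have "taylor ?q a = F a" if a: "monom_in a" "mdeg a < Suc n" for a
  proof -
    have "taylor ?q a = taylor q a + (\<Sum>b\<in>?B. if a = b then F b - taylor q b else 0)"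
      unfolding taylor_add taylor_sum[OF fin] taylor_scale
      using a x(2) by (intro arg_cong2[of _ _ _ _ "(+)"] sum.cong) auto
    also have "\<dots> = F a"
      using fin a q(2)[of a] by (cases "mdeg a = n") auto
    finally show ?thesis .
  qed
  ultimately show ?case by blast
qed

text \<open>
  The approximations agree with each other on \<open>filt n\<close> from some stage on,
  since there they are determined by the coefficients of degree at most
  \<open>n\<close>. So the limit exists pointwise, is linear, and inherits invariance.
\<close>

lemma taylor_surj:
  assumes F: "\<And>m. \<not> monom_in m \<Longrightarrow> F m = 0"
  shows "\<exists>q\<in>S. taylor q = F"
proof -
  obtain Q where Q: "\<And>n. Q n \<in> S"
    "\<And>n a. monom_in a \<Longrightarrow> mdeg a < n \<Longrightarrow> taylor (Q n) a = F a"
    using taylor_prescribed_below[of _ F] by metis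
  define ord where "ord h = (LEAST n. h \<in> filt n)" for h
  \<comment> \<open>\<open>Q (Suc n)\<close> is correct in degrees up to \<open>n\<close>, which settles
      its values on \<open>filt n\<close>\<close>
  define q where "q h = Q (Suc (ord h)) h" for h
  have ord: "h \<in> filt (ord h)" for h
    unfolding ord_def using ex_filt[OF primitively_generated] by (rule LeastI_ex)
  have q_eq: "q h = Q (Suc n) h" if h: "h \<in> filt n" for h n
  proof -
    have "ord h \<le> n" unfolding ord_def using h by (rule Least_le)
    have "Q (Suc (ord h)) (mon m) = Q (Suc n) (mon m)" if "monom_in m" "mdeg m \<le> ord h" for m
    proof -
      have "taylor (Q (Suc (ord h))) m = taylor (Q (Suc n)) m"
        using Q(2)[OF that(1)] that(2) \<open>ord h \<le> n\<close> by simp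
      then show ?thesis using that(1) mfact_nonzero[of m] by (simp add: taylor_def)
    qed
    then show ?thesis
      unfolding q_def using invariants_eq_on_filt[OF Q(1) Q(1) _ ord] by blast
  qed
  have lin_Q: "lin (Q n)" for n using Q(1) invariants_lin by blast
  have lin: "lin q"
  proof (rule linI)
    fix x y
    let ?n = "max (ord x) (ord y)"
    have "x \<in> filt ?n" "y \<in> filt ?n"
      using ord[of x] ord[of y] filt_mono[of "ord x" ?n] filt_mono[of "ord y" ?n] by auto
    then show "q (x + y) = q x + q y"
      using q_eq[of _ ?n] filt_closed(1)[of x ?n y] lin_add[OF lin_Q] by simp
  next
    fix c x
    show "q (scale c x) = c * q x"
      using q_eq[OF ord[of x]] q_eq[OF filt_closed(3)[OF ord[of x]]] lin_scale[OF lin_Q] by simp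
  qed
  moreover have "q (g * l) = 0" if "l \<in> lie_annihilator p" for g l
    using Q(1) that by (auto simp: q_def invariants_def)
  ultimately have "q \<in> S" by (simp add: invariants_def)
  moreover have "taylor q m = F m" for m
  proof (cases "monom_in m")
    case True
    then show ?thesis
      using q_eq[OF mon_in_filt[OF True]] Q(2)[OF True, of "Suc (mdeg m)"] by (simp add: taylor_def)
  next
    case False
    then show ?thesis using F by (simp add: taylor_def)
  qed
  ultimately show ?thesis by blast
qed

lemma taylor_iso: "taylor \<in> alg_iso (dual\<lparr>carrier := S\<rparr>) (power_series N)"
proof -
  have carrier: "taylor q \<in> carrier (power_series N)" for q
    by (simp add: power_series_simps taylor_def)
  have "bij_betw taylor S (carrier (power_series N))"
  proof (rule bij_betwI')
    show "\<exists>q\<in>S. F = taylor q" if "F \<in> carrier (power_series N)" for F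
      using taylor_surj[of F] that unfolding power_series_simps by blast
  qed (use taylor_inj carrier in auto)
  moreover have "taylor \<in> ring_hom (dual\<lparr>carrier := S\<rparr>) (power_series N)"
    by (rule ring_hom_memI)
      (use carrier in \<open>auto simp: power_series_simps(2-) taylor_add taylor_counit taylor_conv
        invariants_lin fun_eq_iff\<close>)
  ultimately show ?thesis
    by (simp add: alg_iso_def alg_hom_def power_series_simps(6) taylor_scale fun_eq_iff)
qed

lemma produced_by_invariants:
  "differentially_produced scale comult (dual\<lparr>carrier := S\<rparr>) (\<lambda>q. q 1) p"
proof -
  have "p \<in> S" using lin_p by (simp add: invariants_def lie_annihilator_def)
  then show ?thesis
    unfolding differentially_produced_def
    using augmented_subalgebra_dual[OF invariants_subalgebra]
      right_module_subalgebra_dual[OF invariants_subalgebra invariants_translate]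
    by (auto intro!: exI[of _ "\<lambda>q h g. q (h * g)"] bexI[of _ p])
qed

end

section \<open>Finite-dimensional modules and quotients\<close>

lemma module_scalarsI:
  fixes V :: "('k::field, 'v) module"
  assumes "abelian_group V"
    and "\<And>c x. x \<in> carrier V \<Longrightarrow> c \<odot>\<^bsub>V\<^esub> x \<in> carrier V"
    and "\<And>a b x. x \<in> carrier V \<Longrightarrow> (a + b) \<odot>\<^bsub>V\<^esub> x = a \<odot>\<^bsub>V\<^esub> x \<oplus>\<^bsub>V\<^esub> b \<odot>\<^bsub>V\<^esub> x"
    and "\<And>a x y. x \<in> carrier V \<Longrightarrow> y \<in> carrier V \<Longrightarrow>
           a \<odot>\<^bsub>V\<^esub> (x \<oplus>\<^bsub>V\<^esub> y) = a \<odot>\<^bsub>V\<^esub> x \<oplus>\<^bsub>V\<^esub> a \<odot>\<^bsub>V\<^esub> y"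
    and "\<And>a b x. x \<in> carrier V \<Longrightarrow> (a * b) \<odot>\<^bsub>V\<^esub> x = a \<odot>\<^bsub>V\<^esub> (b \<odot>\<^bsub>V\<^esub> x)"
    and "\<And>x. x \<in> carrier V \<Longrightarrow> 1 \<odot>\<^bsub>V\<^esub> x = x"
  shows "module scalars V"
  by (rule moduleI) (simp_all add: assms cring_scalars)

lemma
  fixes V :: "('k::field, 'v) module"
  assumes "module scalars V"
  shows module_scalars_group: "abelian_group V"
    and module_scalars_monoid: "abelian_monoid V"
    and module_scalars_closed: "x \<in> carrier V \<Longrightarrow> c \<odot>\<^bsub>V\<^esub> x \<in> carrier V"
    and module_scalars_l_distr:
      "x \<in> carrier V \<Longrightarrow> (a + b) \<odot>\<^bsub>V\<^esub> x = a \<odot>\<^bsub>V\<^esub> x \<oplus>\<^bsub>V\<^esub> b \<odot>\<^bsub>V\<^esub> x"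
    and module_scalars_r_distr: "x \<in> carrier V \<Longrightarrow> y \<in> carrier V \<Longrightarrow>
      a \<odot>\<^bsub>V\<^esub> (x \<oplus>\<^bsub>V\<^esub> y) = a \<odot>\<^bsub>V\<^esub> x \<oplus>\<^bsub>V\<^esub> a \<odot>\<^bsub>V\<^esub> y"
    and module_scalars_assoc: "x \<in> carrier V \<Longrightarrow> (a * b) \<odot>\<^bsub>V\<^esub> x = a \<odot>\<^bsub>V\<^esub> (b \<odot>\<^bsub>V\<^esub> x)"
    and module_scalars_one: "x \<in> carrier V \<Longrightarrow> 1 \<odot>\<^bsub>V\<^esub> x = x"
    and module_scalars_minus: "x \<in> carrier V \<Longrightarrow> (- 1) \<odot>\<^bsub>V\<^esub> x = \<ominus>\<^bsub>V\<^esub> x"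
proof -
  interpret M: module scalars V by fact
  show "abelian_group V" "abelian_monoid V" by unfold_locales
  show "x \<in> carrier V \<Longrightarrow> c \<odot>\<^bsub>V\<^esub> x \<in> carrier V"
    by (rule M.smult_closed) simp_all
  show distr: "x \<in> carrier V \<Longrightarrow> (a + b) \<odot>\<^bsub>V\<^esub> x = a \<odot>\<^bsub>V\<^esub> x \<oplus>\<^bsub>V\<^esub> b \<odot>\<^bsub>V\<^esub> x" for a b
    using M.smult_l_distr[of a b x] by simp
  show "x \<in> carrier V \<Longrightarrow> y \<in> carrier V \<Longrightarrow>
      a \<odot>\<^bsub>V\<^esub> (x \<oplus>\<^bsub>V\<^esub> y) = a \<odot>\<^bsub>V\<^esub> x \<oplus>\<^bsub>V\<^esub> a \<odot>\<^bsub>V\<^esub> y"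
    using M.smult_r_distr[of a x y] by simp
  show "x \<in> carrier V \<Longrightarrow> (a * b) \<odot>\<^bsub>V\<^esub> x = a \<odot>\<^bsub>V\<^esub> (b \<odot>\<^bsub>V\<^esub> x)"
    using M.smult_assoc1[of a b x] by simp
  show one: "x \<in> carrier V \<Longrightarrow> 1 \<odot>\<^bsub>V\<^esub> x = x"
    using M.smult_one[of x] by simp
  have zero: "x \<in> carrier V \<Longrightarrow> 0 \<odot>\<^bsub>V\<^esub> x = \<zero>\<^bsub>V\<^esub>"
    using M.smult_l_null[of x] by simp
  show "x \<in> carrier V \<Longrightarrow> (- 1) \<odot>\<^bsub>V\<^esub> x = \<ominus>\<^bsub>V\<^esub> x"
    using distr[of "- 1" 1] one zero M.M.minus_equality[of "(- 1) \<odot>\<^bsub>V\<^esub> x" x] M.smult_closed[of "- 1" x]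
    by simp
qed

text \<open>
  The definition of finite dimension sums over a set of vectors, while spanning families
  arise with indices and possible repetitions. Equal vectors are collected into one
  term.
\<close>

lemma finsum_collect:
  fixes V :: "('k::field, 'v) module"
  assumes V: "module scalars V" and "finite J" "\<And>j. j \<in> J \<Longrightarrow> b j \<in> carrier V"
  shows "\<exists>d. (\<Oplus>\<^bsub>V\<^esub>j\<in>J. c j \<odot>\<^bsub>V\<^esub> b j) = (\<Oplus>\<^bsub>V\<^esub>y\<in>b ` J. d y \<odot>\<^bsub>V\<^esub> y)"
proof -
  interpret abelian_group V by (rule module_scalars_group[OF V])
  note closed = module_scalars_closed[OF V]
  show ?thesis
    using assms(2,3)
  proof (induct J rule: finite_induct)
    case (insert j J)
    then obtain d where d: "(\<Oplus>\<^bsub>V\<^esub>j\<in>J. c j \<odot>\<^bsub>V\<^esub> b j) = (\<Oplus>\<^bsub>V\<^esub>y\<in>b ` J. d y \<odot>\<^bsub>V\<^esub> y)" by auto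
    have b: "b j \<in> carrier V" and bJ: "b ` J \<subseteq> carrier V" and fin: "finite (b ` J)"
      using insert by auto
    have sum: "(\<Oplus>\<^bsub>V\<^esub>j\<in>insert j J. c j \<odot>\<^bsub>V\<^esub> b j)
        = c j \<odot>\<^bsub>V\<^esub> b j \<oplus>\<^bsub>V\<^esub> (\<Oplus>\<^bsub>V\<^esub>y\<in>b ` J. d y \<odot>\<^bsub>V\<^esub> y)"
      using insert closed by (subst finsum_insert) (auto simp: d)
    show ?case
    proof (cases "b j \<in> b ` J")
      case False
      let ?d = "d(b j := c j)"
      have upd: "?d y = d y" if "y \<in> b ` J" for y
        using False that by (metis fun_upd_other)
      have "d y \<odot>\<^bsub>V\<^esub> y \<in> carrier V" if "y \<in> b ` J" for y
        using that bJ closed by blast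
      then have "(\<Oplus>\<^bsub>V\<^esub>y\<in>b ` J. ?d y \<odot>\<^bsub>V\<^esub> y) = (\<Oplus>\<^bsub>V\<^esub>y\<in>b ` J. d y \<odot>\<^bsub>V\<^esub> y)"
        using upd by (intro finsum_cong') (simp_all add: Pi_def)
      then have "(\<Oplus>\<^bsub>V\<^esub>y\<in>b ` insert j J. ?d y \<odot>\<^bsub>V\<^esub> y)
          = c j \<odot>\<^bsub>V\<^esub> b j \<oplus>\<^bsub>V\<^esub> (\<Oplus>\<^bsub>V\<^esub>y\<in>b ` J. d y \<odot>\<^bsub>V\<^esub> y)"
        using False b bJ fin closed
        unfolding image_insert by (subst finsum_insert) auto
      then show ?thesis using sum by metis
    next
      case True
      let ?d = "d(b j := c j + d (b j))" and ?B = "b ` J - {b j}"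
      have B: "b ` J = insert (b j) ?B" "b ` insert j J = insert (b j) ?B" using True by auto
      have "(\<Oplus>\<^bsub>V\<^esub>y\<in>?B. ?d y \<odot>\<^bsub>V\<^esub> y) = (\<Oplus>\<^bsub>V\<^esub>y\<in>?B. d y \<odot>\<^bsub>V\<^esub> y)"
        using bJ closed by (intro finsum_cong') auto
      then have "(\<Oplus>\<^bsub>V\<^esub>y\<in>b ` insert j J. ?d y \<odot>\<^bsub>V\<^esub> y)
          = (c j + d (b j)) \<odot>\<^bsub>V\<^esub> b j \<oplus>\<^bsub>V\<^esub> (\<Oplus>\<^bsub>V\<^esub>y\<in>?B. d y \<odot>\<^bsub>V\<^esub> y)"
        using b bJ fin closed unfolding B(2) by (subst finsum_insert) auto
      also have "\<dots> = c j \<odot>\<^bsub>V\<^esub> b j \<oplus>\<^bsub>V\<^esub> (d (b j) \<odot>\<^bsub>V\<^esub> b j \<oplus>\<^bsub>V\<^esub> (\<Oplus>\<^bsub>V\<^esub>y\<in>?B. d y \<odot>\<^bsub>V\<^esub> y))"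
        using b bJ closed by (auto simp: module_scalars_l_distr[OF V] intro!: a_assoc finsum_closed)
      also have "d (b j) \<odot>\<^bsub>V\<^esub> b j \<oplus>\<^bsub>V\<^esub> (\<Oplus>\<^bsub>V\<^esub>y\<in>?B. d y \<odot>\<^bsub>V\<^esub> y) = (\<Oplus>\<^bsub>V\<^esub>y\<in>b ` J. d y \<odot>\<^bsub>V\<^esub> y)"
        using b bJ fin closed by (subst B(1), subst finsum_insert) auto
      finally show ?thesis using sum by metis
    qed
  qed simp
qed

lemma finite_dimensionalI:
  fixes V :: "('k::field, 'v) module"
  assumes "module scalars V" "finite J" "\<And>j. j \<in> J \<Longrightarrow> b j \<in> carrier V"
    and "\<And>v. v \<in> carrier V \<Longrightarrow> \<exists>c. v = (\<Oplus>\<^bsub>V\<^esub>j\<in>J. c j \<odot>\<^bsub>V\<^esub> b j)"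
  shows "finite_dimensional V"
  unfolding finite_dimensional_def
proof (intro exI[of _ "b ` J"] conjI ballI)
  fix v assume "v \<in> carrier V"
  with assms(4) obtain c where "v = (\<Oplus>\<^bsub>V\<^esub>j\<in>J. c j \<odot>\<^bsub>V\<^esub> b j)" by blast
  then show "\<exists>d. v = (\<Oplus>\<^bsub>V\<^esub>y\<in>b ` J. d y \<odot>\<^bsub>V\<^esub> y)"
    using finsum_collect[OF assms(1-3), where c = c] by simp
qed (use assms in auto)

lemma additive_finsum:
  assumes V: "abelian_group V" and U: "abelian_group U"
    and "\<And>x. x \<in> carrier V \<Longrightarrow> \<psi> x \<in> carrier U"
    and add: "\<And>x y. x \<in> carrier V \<Longrightarrow> y \<in> carrier V \<Longrightarrow> \<psi> (x \<oplus>\<^bsub>V\<^esub> y) = \<psi> x \<oplus>\<^bsub>U\<^esub> \<psi> y"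
    and "finite A" "\<And>a. a \<in> A \<Longrightarrow> f a \<in> carrier V"
  shows "\<psi> (\<Oplus>\<^bsub>V\<^esub>a\<in>A. f a) = (\<Oplus>\<^bsub>U\<^esub>a\<in>A. \<psi> (f a))"
proof -
  interpret V: abelian_group V by fact
  interpret U: abelian_group U by fact
  have zero: "\<psi> \<zero>\<^bsub>V\<^esub> = \<zero>\<^bsub>U\<^esub>"
    using add[of "\<zero>\<^bsub>V\<^esub>" "\<zero>\<^bsub>V\<^esub>"] assms(3)[of "\<zero>\<^bsub>V\<^esub>"] by (simp add: U.add.r_cancel_one')
  show ?thesis
    using assms(5,6)
  proof (induct A rule: finite_induct)
    case (insert a A)
    then have "\<psi> (\<Oplus>\<^bsub>V\<^esub>a\<in>insert a A. f a) = \<psi> (f a \<oplus>\<^bsub>V\<^esub> (\<Oplus>\<^bsub>V\<^esub>a\<in>A. f a))"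
      by (subst V.finsum_insert) auto
    also have "\<dots> = \<psi> (f a) \<oplus>\<^bsub>U\<^esub> (\<Oplus>\<^bsub>U\<^esub>a\<in>A. \<psi> (f a))"
      using insert by (subst add) (auto intro!: V.finsum_closed)
    also have "\<dots> = (\<Oplus>\<^bsub>U\<^esub>a\<in>insert a A. \<psi> (f a))"
      using insert assms(3) by (subst U.finsum_insert) auto
    finally show ?case .
  qed (simp add: zero)
qed

lemma functional_finsum:
  fixes \<psi> :: "'v \<Rightarrow> 'k::field"
  assumes "abelian_group V"
    and "\<And>x y. x \<in> carrier V \<Longrightarrow> y \<in> carrier V \<Longrightarrow> \<psi> (x \<oplus>\<^bsub>V\<^esub> y) = \<psi> x + \<psi> y"
    and "finite A" "\<And>a. a \<in> A \<Longrightarrow> f a \<in> carrier V"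
  shows "\<psi> (\<Oplus>\<^bsub>V\<^esub>a\<in>A. f a) = (\<Sum>a\<in>A. \<psi> (f a))"
  using additive_finsum[OF assms(1) abelian_group_type_algebra, of \<psi> "(*)" A f] assms(2-)
  by (simp add: finsum_type_algebra)

locale quotient_module =
  fixes V :: "('k::field, 'v) module" (structure) and W :: "'v set"
  assumes V: "module scalars V"
    and subgroup: "subgroup W (add_monoid V)"
    and smult_mem: "w \<in> W \<Longrightarrow> c \<odot> w \<in> W"
begin

abbreviation "Q \<equiv> quotient_space V W"

sublocale abelian_subgroup W V
proof -
  interpret abelian_group V by (rule module_scalars_group[OF V])
  show "abelian_subgroup W V"
    by (intro abelian_subgroupI3 additive_subgroupI subgroup) unfold_locales
qed

lemma W_subset: "W \<subseteq> carrier V"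
  by (rule a_subset)

lemma coset_eq_iff:
  assumes "x \<in> carrier V" "y \<in> carrier V"
  shows "W +> x = W +> y \<longleftrightarrow> y \<ominus> x \<in> W"
proof -
  have "W +> x = W +> y \<longleftrightarrow> y \<in> W +> x"
    using a_repr_independence[OF _ assms(1) subgroup] a_rcos_self[OF assms(2)] by metis
  then show ?thesis
    using a_rcos_module[OF assms] by (simp only: a_minus_def)
qed

lemma quotient_simps:
  "carrier Q = a_rcosets W" "\<zero>\<^bsub>Q\<^esub> = W" "X \<oplus>\<^bsub>Q\<^esub> Y = X <+> Y"
  "c \<odot>\<^bsub>Q\<^esub> X = (\<Union>x\<in>X. W +> (c \<odot> x))"
  by (simp_all add: quotient_space_def)

lemma carrier_quotient: "carrier Q = (\<lambda>x. W +> x) ` carrier V"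
  by (auto simp: quotient_simps A_RCOSETS_def' )

lemma coset_add: "x \<in> carrier V \<Longrightarrow> y \<in> carrier V \<Longrightarrow> W +> (x \<oplus> y) = (W +> x) \<oplus>\<^bsub>Q\<^esub> (W +> y)"
  by (simp add: quotient_simps a_rcos_sum)

lemma smult_diff:
  assumes "x \<in> carrier V" "y \<in> carrier V" shows "c \<odot> (x \<ominus> y) = c \<odot> x \<ominus> c \<odot> y"
proof -
  have "c \<odot> (\<ominus> y) = \<ominus> (c \<odot> y)"
    using assms module_scalars_assoc[OF V, of y c "- 1"] module_scalars_assoc[OF V, of y "- 1" c]
    by (simp add: module_scalars_minus[OF V] module_scalars_closed[OF V])
  then show ?thesis
    using assms by (simp add: a_minus_def module_scalars_r_distr[OF V])
qed

lemma coset_smult: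
  assumes x: "x \<in> carrier V" shows "W +> (c \<odot> x) = c \<odot>\<^bsub>Q\<^esub> (W +> x)"
proof -
  have "W +> (c \<odot> y) = W +> (c \<odot> x)" if y_mem: "y \<in> W +> x" for y
  proof -
    have y: "y \<in> carrier V" using y_mem x W_subset a_r_coset_subset_G by blast
    have "y \<ominus> x \<in> W"
      using y_mem a_rcos_module[OF x y] by (simp only: a_minus_def)
    from smult_mem[OF this, of c] have "c \<odot> y \<ominus> c \<odot> x \<in> W"
      by (simp only: smult_diff[OF y x])
    then show ?thesis
      using coset_eq_iff[OF module_scalars_closed[OF V x] module_scalars_closed[OF V y], of c c]
      by metis
  qed
  then show ?thesis
    unfolding quotient_simps using a_rcos_self[OF x] by blast
qed

lemma coset_zero: "\<zero>\<^bsub>Q\<^esub> = W +> \<zero>"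
  by (simp add: quotient_simps a_rcos_const)

lemma abelian_group_quotient: "abelian_group Q"
proof (rule abelian_groupI)
  show "\<exists>Y\<in>carrier Q. Y \<oplus>\<^bsub>Q\<^esub> X = \<zero>\<^bsub>Q\<^esub>" if X: "X \<in> carrier Q" for X
  proof -
    obtain x where x: "x \<in> carrier V" "X = W +> x" using X unfolding carrier_quotient by blast
    then have "(W +> \<ominus> x) \<oplus>\<^bsub>Q\<^esub> X = \<zero>\<^bsub>Q\<^esub>"
      by (simp add: coset_add[symmetric] coset_zero l_neg)
    then show ?thesis using x(1) unfolding carrier_quotient by blast
  qed
qed (auto simp: carrier_quotient coset_zero coset_add[symmetric] a_ac)

lemma module_quotient: "module scalars Q"
proof (rule module_scalarsI[OF abelian_group_quotient])
  note closed = module_scalars_closed[OF V]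
  show "c \<odot>\<^bsub>Q\<^esub> X \<in> carrier Q" if "X \<in> carrier Q" for c X
    using that closed by (auto simp: carrier_quotient simp flip: coset_smult)
  show "(a + b) \<odot>\<^bsub>Q\<^esub> X = a \<odot>\<^bsub>Q\<^esub> X \<oplus>\<^bsub>Q\<^esub> b \<odot>\<^bsub>Q\<^esub> X" if "X \<in> carrier Q" for a b X
    using that closed
    by (auto simp: carrier_quotient module_scalars_l_distr[OF V]
        simp flip: coset_smult coset_add)
  show "a \<odot>\<^bsub>Q\<^esub> (X \<oplus>\<^bsub>Q\<^esub> Y) = a \<odot>\<^bsub>Q\<^esub> X \<oplus>\<^bsub>Q\<^esub> a \<odot>\<^bsub>Q\<^esub> Y"
    if "X \<in> carrier Q" "Y \<in> carrier Q" for a X Y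
    using that closed
    by (auto simp: carrier_quotient module_scalars_r_distr[OF V]
        simp flip: coset_smult coset_add)
  show "(a * b) \<odot>\<^bsub>Q\<^esub> X = a \<odot>\<^bsub>Q\<^esub> (b \<odot>\<^bsub>Q\<^esub> X)" if "X \<in> carrier Q" for a b X
    using that closed
    by (auto simp: carrier_quotient module_scalars_assoc[OF V] simp flip: coset_smult)
  show "1 \<odot>\<^bsub>Q\<^esub> X = X" if "X \<in> carrier Q" for X
    using that by (auto simp: carrier_quotient module_scalars_one[OF V] simp flip: coset_smult)
qed

lemma coset_finsum:
  assumes "finite A" "\<And>a. a \<in> A \<Longrightarrow> f a \<in> carrier V"
  shows "W +> (\<Oplus>a\<in>A. f a) = (\<Oplus>\<^bsub>Q\<^esub>a\<in>A. W +> f a)"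
  using assms
  by (intro additive_finsum abelian_group_quotient module_scalars_group[OF V])
    (auto simp: coset_add carrier_quotient)

end

section \<open>Coordinates from finite Lie rank\<close>

text \<open>
  On a subspace, finitely many linear functionals are jointly controlled by finitely
  many vectors. For a new functional, one vector on which the previous ones vanish and
  the new one does not is enough; if there is none, the old vectors already suffice.
\<close>

lemma finite_functionals:
  fixes \<phi> :: "'x \<Rightarrow> 'h::ab_group_add \<Rightarrow> 'k::field"
  assumes "vector_space scale" "module.subspace scale P" "finite A"
    and add: "\<And>a x y. a \<in> A \<Longrightarrow> \<phi> a (x + y) = \<phi> a x + \<phi> a y"
    and scale: "\<And>a c x. a \<in> A \<Longrightarrow> \<phi> a (scale c x) = c * \<phi> a x"
  shows "\<exists>C. finite C \<and> C \<subseteq> P \<and> (\<forall>h\<in>P. \<exists>c. \<forall>a\<in>A. \<phi> a h = (\<Sum>b\<in>C. c b * \<phi> a b))"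
  using assms(3) add scale
proof (induct A rule: finite_induct)
  case empty
  then show ?case by (intro exI[of _ "{}"]) simp
next
  case (insert a A)
  interpret vector_space scale by fact
  obtain C where C: "finite C" "C \<subseteq> P"
    "\<And>h. h \<in> P \<Longrightarrow> \<exists>c. \<forall>a\<in>A. \<phi> a h = (\<Sum>b\<in>C. c b * \<phi> a b)"
    using insert by auto
  have lin: "\<phi> x (h - (\<Sum>b\<in>C. scale (c b) b)) = \<phi> x h - (\<Sum>b\<in>C. c b * \<phi> x b)"
    if x: "x \<in> insert a A" for x h c
  proof -
    have zero: "\<phi> x 0 = 0" using insert.prems(2)[OF x, of 0 0] by simp
    have "\<phi> x (\<Sum>b\<in>D. scale (c b) b) = (\<Sum>b\<in>D. c b * \<phi> x b)" if "finite D" for D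
      using that by (induct D rule: finite_induct) (simp_all add: zero insert.prems(1)[OF x] insert.prems(2)[OF x])
    then show ?thesis
      using insert.prems(1)[OF x, of "h - (\<Sum>b\<in>C. scale (c b) b)" "\<Sum>b\<in>C. scale (c b) b"] C(1)
      by simp
  qed
  have rest: "h - (\<Sum>b\<in>C. scale (c b) b) \<in> P" if "h \<in> P" for h c
    using that C(2) assms(2) by (intro subspace_diff subspace_sum subspace_scale) auto
  show ?case
  proof (cases "\<exists>u\<in>P. (\<forall>x\<in>A. \<phi> x u = 0) \<and> \<phi> a u \<noteq> 0")
    case True
    then obtain u where u: "u \<in> P" "\<And>x. x \<in> A \<Longrightarrow> \<phi> x u = 0" "\<phi> a u \<noteq> 0" by blast
    have "\<exists>c'. \<forall>x\<in>insert a A. \<phi> x h = (\<Sum>b\<in>insert u C. c' b * \<phi> x b)" if h: "h \<in> P" for h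
    proof -
      obtain c where c: "\<And>x. x \<in> A \<Longrightarrow> \<phi> x h = (\<Sum>b\<in>C. c b * \<phi> x b)" using C(3)[OF h] by blast
      define t where "t = (\<phi> a h - (\<Sum>b\<in>C. c b * \<phi> a b)) / \<phi> a u"
      let ?c = "\<lambda>b. (if b \<in> C then c b else 0) + (if b = u then t else 0)"
      have sum: "(\<Sum>b\<in>insert u C. ?c b * \<phi> x b) = (\<Sum>b\<in>C. c b * \<phi> x b) + t * \<phi> x u" for x
      proof -
        have "(\<Sum>b\<in>insert u C. ?c b * \<phi> x b)
          = (\<Sum>b\<in>insert u C. if b \<in> C then c b * \<phi> x b else 0)
            + (\<Sum>b\<in>insert u C. if b = u then t * \<phi> x b else 0)"
          unfolding sum.distrib[symmetric] by (intro sum.cong) (auto simp: algebra_simps)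
        also have "(\<Sum>b\<in>insert u C. if b \<in> C then c b * \<phi> x b else 0) = (\<Sum>b\<in>C. c b * \<phi> x b)"
          using C(1) by (intro sum.mono_neutral_cong_right) auto
        also have "(\<Sum>b\<in>insert u C. if b = u then t * \<phi> x b else 0) = t * \<phi> x u"
          using C(1) by simp
        finally show ?thesis .
      qed
      have "\<phi> x h = (\<Sum>b\<in>insert u C. ?c b * \<phi> x b)" if "x \<in> insert a A" for x
        unfolding sum using that
      proof
        assume "x = a"
        then show "\<phi> x h = (\<Sum>b\<in>C. c b * \<phi> x b) + t * \<phi> x u"
          using u(3) by (simp add: t_def)
      next
        assume "x \<in> A"
        then show "\<phi> x h = (\<Sum>b\<in>C. c b * \<phi> x b) + t * \<phi> x u"
          using c[of x] u(2)[of x] by simp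
      qed
      then show ?thesis by (intro exI[of _ ?c]) blast
    qed
    moreover have "finite (insert u C)" "insert u C \<subseteq> P" using C(1,2) u(1) by auto
    ultimately show ?thesis by blast
  next
    case False
    have "\<exists>c. \<forall>x\<in>insert a A. \<phi> x h = (\<Sum>b\<in>C. c b * \<phi> x b)" if h: "h \<in> P" for h
    proof -
      obtain c where c: "\<And>x. x \<in> A \<Longrightarrow> \<phi> x h = (\<Sum>b\<in>C. c b * \<phi> x b)" using C(3)[OF h] by blast
      let ?u = "h - (\<Sum>b\<in>C. scale (c b) b)"
      have "\<phi> x ?u = 0" if "x \<in> A" for x using lin[of x h c] c that by simp
      then have "\<phi> a ?u = 0" using False rest[OF h] by blast
      then have "\<phi> a h = (\<Sum>b\<in>C. c b * \<phi> a b)" using lin[of a h c] by simp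
      then show ?thesis using c by blast
    qed
    then show ?thesis using C(1,2) by blast
  qed
qed

context bialgebra
begin

lemma module_functions:
  assumes "(\<lambda>_. 0) \<in> V" "\<And>q r. q \<in> V \<Longrightarrow> r \<in> V \<Longrightarrow> (\<lambda>h. q h + r h) \<in> V"
    and scale: "\<And>c q. q \<in> V \<Longrightarrow> (\<lambda>h. c * q h) \<in> V"
  shows "module scalars (subspace_of dual V)"
proof (rule module_scalarsI)
  show "abelian_group (subspace_of dual V)"
  proof (rule abelian_groupI)
    show "\<exists>y\<in>carrier (subspace_of dual V). y \<oplus>\<^bsub>subspace_of dual V\<^esub> x = \<zero>\<^bsub>subspace_of dual V\<^esub>"
      if "x \<in> carrier (subspace_of dual V)" for x
      using that scale[of x "- 1"] by (intro bexI[of _ "\<lambda>h. - 1 * x h"]) (auto simp: subspace_of_def)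
  qed (use assms in \<open>auto simp: subspace_of_def algebra_simps\<close>)
qed (use assms in \<open>auto simp: subspace_of_def algebra_simps\<close>)

abbreviation hit_space :: "('h \<Rightarrow> 'k) \<Rightarrow> ('h \<Rightarrow> 'k) set" where
  "hit_space p \<equiv> (\<lambda>h. h \<rightharpoonup> p) ` prims"

lemma module_hit_space:
  assumes "lin p" shows "module scalars (subspace_of dual (hit_space p))"
proof (rule module_functions)
  have "(\<lambda>_. 0) = 0 \<rightharpoonup> p"
    by (simp add: left_hit_def lin_zero[OF assms])
  then show "(\<lambda>_. 0) \<in> hit_space p" using primitives_zero by (rule image_eqI)
  show "(\<lambda>h. q h + r h) \<in> hit_space p" if q: "q \<in> hit_space p" and r: "r \<in> hit_space p" for q r
  proof -
    obtain l where l: "q = l \<rightharpoonup> p" "l \<in> prims" using q by (rule imageE)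
    obtain l' where l': "r = l' \<rightharpoonup> p" "l' \<in> prims" using r by (rule imageE)
    have "(\<lambda>h. q h + r h) = (l + l') \<rightharpoonup> p"
      by (simp add: l l' left_hit_def lin_add[OF assms] distrib_left)
    then show ?thesis using primitives_add[OF l(2) l'(2)] by (rule image_eqI)
  qed
  show "(\<lambda>h. c * q h) \<in> hit_space p" if q: "q \<in> hit_space p" for c q
  proof -
    obtain l where l: "q = l \<rightharpoonup> p" "l \<in> prims" using q by (rule imageE)
    then have "(\<lambda>h. c * q h) = scale c l \<rightharpoonup> p"
      by (simp add: left_hit_def lin_scale[OF assms] scale_mult_right)
    then show ?thesis using primitives_scale[OF l(2)] by (rule image_eqI)
  qed
qed

lemma hit_space_finsum:
  assumes "lin p" "finite A" "\<And>a. a \<in> A \<Longrightarrow> f a \<in> hit_space p"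
  shows "(\<Oplus>\<^bsub>subspace_of dual (hit_space p)\<^esub>a\<in>A. c a \<odot>\<^bsub>subspace_of dual (hit_space p)\<^esub> f a)
    = (\<lambda>x. \<Sum>a\<in>A. c a * f a x)"
proof -
  note module = module_hit_space[OF assms(1)]
  have "c a \<odot>\<^bsub>subspace_of dual (hit_space p)\<^esub> f a \<in> hit_space p" if "a \<in> A" for a
    using module_scalars_closed[OF module, of "f a"] assms(3)[OF that] by (simp add: subspace_of_def)
  then show ?thesis
    unfolding subspace_of_def
    using finsum_functions[OF module_scalars_monoid[OF module, unfolded subspace_of_def] assms(2)]
    by (simp add: subspace_of_def)
qed

text \<open>
  Gram-Schmidt for the pairing \<open>(x, l) \<mapsto> p (x * l)\<close>. If
  \<open>b\<close> is not yet reproduced, then its remainder pairs nontrivially with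
  some \<open>y\<close>; the normalized remainder becomes the new \<open>e\<close>, and
  \<open>y\<close>, made orthogonal to the previous \<open>e i\<close>, becomes the new
  \<open>d\<close>. Elements that were reproduced before are orthogonal to the new
  \<open>d\<close>, hence stay reproduced.
\<close>

lemma biorthogonal_system:
  assumes "lin p" "finite C" "C \<subseteq> prims"
  shows "\<exists>(N::nat) e d. (\<forall>i<N. e i \<in> prims) \<and> (\<forall>i<N. \<forall>j<N. p (d j * e i) = (if i = j then 1 else 0)) \<and>
     (\<forall>l\<in>C. \<forall>x. p (x * l) = (\<Sum>i<N. p (d i * l) * p (x * e i)))"
  using assms(2,3)
proof (induct C rule: finite_induct)
  case empty
  then show ?case by (intro exI[of _ "0::nat"]) simp
next
  case (insert b C)
  then have "C \<subseteq> prims" by simp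
  from insert.hyps(3)[OF this] obtain N :: nat and e d where *: "\<forall>i<N. e i \<in> prims"
    "\<forall>i<N. \<forall>j<N. p (d j * e i) = (if i = j then 1 else 0)"
    "\<forall>l\<in>C. \<forall>x. p (x * l) = (\<Sum>i<N. p (d i * l) * p (x * e i))"
    by (elim exE conjE) (rule that)
  note e = *(1)[rule_format] and ortho = *(2)[rule_format] and rec = *(3)[rule_format]
  have b: "b \<in> prims" using insert by simp
  define r where "r x = p (x * b) - (\<Sum>i<N. p (d i * b) * p (x * e i))" for x
  show ?case
  proof (cases "\<forall>x. r x = 0")
    case True
    then have "p (x * b) = (\<Sum>i<N. p (d i * b) * p (x * e i))" for x
      using spec[of _ x] unfolding r_def eq_iff_diff_eq_0[of "p (x * b)"] by blast
    then have "\<forall>l\<in>insert b C. \<forall>x. p (x * l) = (\<Sum>i<N. p (d i * l) * p (x * e i))"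
      using *(3) by (metis insertE)
    then show ?thesis using *(1,2) by (intro exI conjI)
  next
    case False
    then obtain y where y: "r y \<noteq> 0" by blast
    \<comment> \<open>\<open>u\<close> and \<open>z\<close> are the new members of the system, normalized
        so that \<open>p (z * u) = 1\<close>\<close>
    define u where "u = scale (inverse (r y)) (b - (\<Sum>i<N. scale (p (d i * b)) (e i)))"
    define z where "z = y - (\<Sum>i<N. scale (p (y * e i)) (d i))"
    have u: "u \<in> prims"
      unfolding u_def using b e subspace_primitives
      by (intro subspace_scale subspace_diff subspace_sum) auto
    have "p (x * (b - (\<Sum>i<N. scale (p (d i * b)) (e i)))) = r x" for x
      by (simp add: r_def scale_mult_right right_diff_distrib sum_distrib_left
          lin_scale[OF assms(1)] lin_diff[OF assms(1)] lin_sum[OF _ assms(1)])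
    then have pu: "p (x * u) = r x / r y" for x
      by (simp add: u_def scale_mult_right lin_scale[OF assms(1)] divide_inverse mult.commute)
    have pz: "p (z * x) = p (y * x) - (\<Sum>i<N. p (y * e i) * p (d i * x))" for x
      by (simp add: z_def scale_mult_left left_diff_distrib sum_distrib_right
          lin_scale[OF assms(1)] lin_diff[OF assms(1)] lin_sum[OF _ assms(1)])
    have delta: "(\<Sum>i<N. f i * (if i = j then 1 else 0)) = f j"
      "(\<Sum>i<N. f i * (if j = i then 1 else 0)) = f j" if "j < N" for f :: "nat \<Rightarrow> 'k" and j
    proof -
      have "(\<Sum>i<N. f i * (if i = j then 1 else 0)) = (\<Sum>i<N. if i = j then f i else 0)"
        "(\<Sum>i<N. f i * (if j = i then 1 else 0)) = (\<Sum>i<N. if i = j then f i else 0)"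
        by (intro sum.cong refl; simp)+
      then show "(\<Sum>i<N. f i * (if i = j then 1 else 0)) = f j"
        "(\<Sum>i<N. f i * (if j = i then 1 else 0)) = f j"
        using that by simp_all
    qed
    have ze: "p (z * e j) = 0" if "j < N" for j
    proof -
      have "(\<Sum>i<N. p (y * e i) * p (d i * e j)) = (\<Sum>i<N. p (y * e i) * (if j = i then 1 else 0))"
        using that ortho by (intro sum.cong) auto
      then show ?thesis using delta(2)[OF that] by (simp add: pz)
    qed
    have rd: "r (d j) = 0" if "j < N" for j
    proof -
      have "(\<Sum>i<N. p (d i * b) * p (d j * e i)) = (\<Sum>i<N. p (d i * b) * (if i = j then 1 else 0))"
        using that ortho by (intro sum.cong) auto
      then show ?thesis using delta(1)[OF that] by (simp add: r_def)
    qed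
    have zb: "p (z * b) = r y"
      by (simp add: pz r_def mult.commute)
    have rz: "r z = r y"
      using ze zb by (simp add: r_def)
    have zC: "p (z * l) = 0" if "l \<in> C" for l
      using rec[OF that, of y] by (simp add: pz mult.commute)
    let ?e = "e(N := u)" and ?d = "d(N := z)"
    have "\<forall>i<Suc N. ?e i \<in> prims" using e u by (auto simp: less_Suc_eq)
    moreover have "\<forall>i<Suc N. \<forall>j<Suc N. p (?d j * ?e i) = (if i = j then 1 else 0)"
      using ortho ze rd rz y by (auto simp: less_Suc_eq pu)
    moreover have "\<forall>l\<in>insert b C. \<forall>x. p (x * l) = (\<Sum>i<Suc N. p (?d i * l) * p (x * ?e i))"
    proof (intro ballI allI)
      fix l x assume l: "l \<in> insert b C"
      have "(\<Sum>i<Suc N. p (?d i * l) * p (x * ?e i))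
          = (\<Sum>i<N. p (d i * l) * p (x * e i)) + p (z * l) * (r x / r y)"
        by (simp add: pu)
      also have "\<dots> = p (x * l)"
        using l
      proof
        assume "l = b"
        then show ?thesis using y by (simp add: zb) (simp add: r_def)
      next
        assume "l \<in> C"
        then show ?thesis using rec[of l x] by (simp add: zC)
      qed
      finally show "p (x * l) = (\<Sum>i<Suc N. p (?d i * l) * p (x * ?e i))" by simp
    qed
    ultimately show ?thesis by blast
  qed
qed

text \<open>
  A biorthogonal system that reproduces preimages of a finite spanning set of \<open>{l
  \<rightharpoonup> p}\<close> reproduces all primitive elements, as both sides depend
  only on \<open>l \<rightharpoonup> p\<close> and do so linearly.
\<close>

lemma finite_lie_rank_coordinates:
  assumes "lin p" "finite_lie_rank scale comult counit p"
  shows "\<exists>(N::nat) e d. (\<forall>i<N. e i \<in> prims) \<and> (\<forall>i<N. \<forall>j<N. p (d j * e i) = (if i = j then 1 else 0)) \<and>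
     (\<forall>l\<in>prims. \<forall>x. p (x * l) = (\<Sum>i<N. p (d i * l) * p (x * e i)))"
proof -
  let ?V = "subspace_of dual (hit_space p)"
  obtain B where B: "finite B" "B \<subseteq> hit_space p"
    and gen: "\<And>v. v \<in> hit_space p \<Longrightarrow> \<exists>c. v = (\<Oplus>\<^bsub>?V\<^esub>b\<in>B. c b \<odot>\<^bsub>?V\<^esub> b)"
    using assms(2) by (auto simp: finite_lie_rank_def finite_dimensional_def subspace_of_def)
  obtain s where s: "\<And>b. b \<in> B \<Longrightarrow> s b \<in> prims \<and> b = s b \<rightharpoonup> p"
    using bchoice[of B "\<lambda>b l. l \<in> prims \<and> b = l \<rightharpoonup> p"] B(2) by blast
  have "finite (s ` B)" "s ` B \<subseteq> prims" using B(1) s by auto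
  from biorthogonal_system[OF assms(1) this] obtain N :: nat and e d where sys: "\<forall>i<N. e i \<in> prims"
    "\<forall>i<N. \<forall>j<N. p (d j * e i) = (if i = j then 1 else 0)"
    and rec': "\<forall>l\<in>s ` B. \<forall>x. p (x * l) = (\<Sum>i<N. p (d i * l) * p (x * e i))"
    by (elim exE conjE) (rule that)
  have rec: "p (x * s b) = (\<Sum>i<N. p (d i * s b) * p (x * e i))" if "b \<in> B" for b x
    using rec' that by blast
  have "p (x * l) = (\<Sum>i<N. p (d i * l) * p (x * e i))" if l: "l \<in> prims" for l x
  proof -
    obtain c where c: "l \<rightharpoonup> p = (\<Oplus>\<^bsub>?V\<^esub>b\<in>B. c b \<odot>\<^bsub>?V\<^esub> b)"
      using gen[OF imageI[OF l]] by blast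
    have sum_B: "(\<Oplus>\<^bsub>?V\<^esub>b\<in>B. c b \<odot>\<^bsub>?V\<^esub> b) = (\<lambda>x. \<Sum>b\<in>B. c b * b x)"
      using B(2) by (intro hit_space_finsum[OF assms(1) B(1)]) blast
    have pl: "p (x * l) = (\<Sum>b\<in>B. c b * p (x * s b))" for x
    proof -
      have "p (x * l) = (\<Sum>b\<in>B. c b * b x)"
        using fun_cong[OF trans[OF c sum_B], of x] by (simp only: left_hit_def)
      also have "\<dots> = (\<Sum>b\<in>B. c b * p (x * s b))"
      proof (rule sum.cong[OF refl])
        fix b assume "b \<in> B"
        then have "b = s b \<rightharpoonup> p" using s by blast
        from fun_cong[OF this, of x] show "c b * b x = c b * p (x * s b)"
          by (simp only: left_hit_def)
      qed
      finally show ?thesis .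
    qed
    have "p (x * l) = (\<Sum>b\<in>B. \<Sum>i<N. c b * p (d i * s b) * p (x * e i))"
      unfolding pl
    proof (rule sum.cong[OF refl])
      fix b assume "b \<in> B"
      from rec[OF this, of x]
      show "c b * p (x * s b) = (\<Sum>i<N. c b * p (d i * s b) * p (x * e i))"
        by (simp only: sum_distrib_left mult.assoc)
    qed
    also have "\<dots> = (\<Sum>i<N. \<Sum>b\<in>B. c b * p (d i * s b) * p (x * e i))"
      by (rule sum.swap)
    also have "\<dots> = (\<Sum>i<N. p (d i * l) * p (x * e i))"
      unfolding pl by (simp add: sum_distrib_right)
    finally show ?thesis .
  qed
  then have "\<forall>l\<in>prims. \<forall>x. p (x * l) = (\<Sum>i<N. p (d i * l) * p (x * e i))"
    by blast
  with sys show ?thesis by (intro exI conjI)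
qed

end

section \<open>The augmentation ideal modulo its square\<close>

lemma
  assumes "augmented_algebra A \<eta>"
  shows augmented_ring: "ring A"
    and augmented_module: "module scalars A"
    and augmentation_add:
      "x \<in> carrier A \<Longrightarrow> y \<in> carrier A \<Longrightarrow> \<eta> (x \<oplus>\<^bsub>A\<^esub> y) = \<eta> x + \<eta> y"
    and augmentation_mult:
      "x \<in> carrier A \<Longrightarrow> y \<in> carrier A \<Longrightarrow> \<eta> (x \<otimes>\<^bsub>A\<^esub> y) = \<eta> x * \<eta> y"
    and augmentation_one: "\<eta> \<one>\<^bsub>A\<^esub> = 1"
    and augmentation_smult: "x \<in> carrier A \<Longrightarrow> \<eta> (c \<odot>\<^bsub>A\<^esub> x) = c * \<eta> x"
    and augmented_smult_mult_left:
      "x \<in> carrier A \<Longrightarrow> y \<in> carrier A \<Longrightarrow> (c \<odot>\<^bsub>A\<^esub> x) \<otimes>\<^bsub>A\<^esub> y = c \<odot>\<^bsub>A\<^esub> (x \<otimes>\<^bsub>A\<^esub> y)"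
    and augmented_smult_mult_right:
      "x \<in> carrier A \<Longrightarrow> y \<in> carrier A \<Longrightarrow> x \<otimes>\<^bsub>A\<^esub> (c \<odot>\<^bsub>A\<^esub> y) = c \<odot>\<^bsub>A\<^esub> (x \<otimes>\<^bsub>A\<^esub> y)"
  using assms
  by (auto simp: augmented_algebra_def alg_hom_def ring_hom_def k_algebra_def k_algebra_axioms_def)

lemma (in abelian_group) minus_add_cancel:
  "x \<in> carrier G \<Longrightarrow> y \<in> carrier G \<Longrightarrow> (x \<ominus> y) \<oplus> y = x"
  by (simp add: a_minus_def a_assoc l_neg)

lemma quotient_moduleI:
  fixes V :: "('k::field, 'v) module"
  assumes V: "module scalars V" and W: "W \<subseteq> carrier V" "W \<noteq> {}"
    and "\<And>x y. x \<in> W \<Longrightarrow> y \<in> W \<Longrightarrow> x \<oplus>\<^bsub>V\<^esub> y \<in> W"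
    and smult: "\<And>c x. x \<in> W \<Longrightarrow> c \<odot>\<^bsub>V\<^esub> x \<in> W"
  shows "quotient_module V W"
proof (rule quotient_module.intro[OF V])
  interpret abelian_group V by (rule module_scalars_group[OF V])
  show "subgroup W (add_monoid V)"
  proof (rule group.subgroupI[OF a_group])
    show "inv\<^bsub>add_monoid V\<^esub> x \<in> W" if x: "x \<in> W" for x
    proof -
      have "inv\<^bsub>add_monoid V\<^esub> x = (- 1) \<odot>\<^bsub>V\<^esub> x"
        using x W(1) module_scalars_minus[OF V, of x] by (auto simp: a_inv_def)
      then show ?thesis using smult[OF x] by simp
    qed
  qed (use assms in auto)
qed (rule smult)

locale augmented =
  fixes A :: "('k::field, 'a) module" (structure) and \<eta> :: "'a \<Rightarrow> 'k"
  assumes augmented: "augmented_algebra A \<eta>"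
begin

sublocale ring A by (rule augmented_ring[OF augmented])

lemmas module_A = augmented_module[OF augmented]
  and \<eta>_add = augmentation_add[OF augmented]
  and \<eta>_mult = augmentation_mult[OF augmented]
  and \<eta>_one = augmentation_one[OF augmented]
  and \<eta>_smult = augmentation_smult[OF augmented]
  and smult_left = augmented_smult_mult_left[OF augmented]
  and smult_right = augmented_smult_mult_right[OF augmented]

definition I where "I = a_kernel A scalars \<eta>"

lemma I_iff: "x \<in> I \<longleftrightarrow> x \<in> carrier A \<and> \<eta> x = 0"
  by (simp add: I_def a_kernel_def')

lemma smult_carrier: "x \<in> carrier A \<Longrightarrow> c \<odot> x \<in> carrier A"
  by (rule module_scalars_closed[OF module_A])

lemma smult_I: "x \<in> I \<Longrightarrow> c \<odot> x \<in> I"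
  by (simp add: I_iff smult_carrier \<eta>_smult)

lemma ideal_I: "ideal I A"
proof -
  have "ring_hom_ring A scalars \<eta>"
    using augmented ring_axioms cring_scalars
    by (intro ring_hom_ringI2) (auto simp: augmented_algebra_def alg_hom_def cring_def)
  then show ?thesis unfolding I_def by (rule ring_hom_ring.kernel_is_ideal)
qed

lemma minus_smult: "x \<in> carrier A \<Longrightarrow> \<ominus> x = (- 1) \<odot> x"
  by (simp add: module_scalars_minus[OF module_A])

lemma \<eta>_minus: "x \<in> carrier A \<Longrightarrow> y \<in> carrier A \<Longrightarrow> \<eta> (x \<ominus> y) = \<eta> x - \<eta> y"
  by (simp add: a_minus_def minus_smult \<eta>_add \<eta>_smult smult_carrier)

lemma decompose:
  assumes "x \<in> carrier A"
  obtains v where "v \<in> I" "x = v \<oplus> \<eta> x \<odot> \<one>"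
proof
  show "x \<ominus> \<eta> x \<odot> \<one> \<in> I"
    using assms by (simp add: I_iff smult_carrier \<eta>_minus \<eta>_smult \<eta>_one)
  show "x = (x \<ominus> \<eta> x \<odot> \<one>) \<oplus> \<eta> x \<odot> \<one>"
    using assms smult_carrier[of \<one> "\<eta> x"] by (simp add: a_minus_def a_assoc l_neg)
qed

abbreviation "V \<equiv> subspace_of A I"

abbreviation "I2 \<equiv> ideal_prod A I I"

lemma V_simps: "carrier V = I" "x \<oplus>\<^bsub>V\<^esub> y = x \<oplus> y" "c \<odot>\<^bsub>V\<^esub> x = c \<odot> x" "\<zero>\<^bsub>V\<^esub> = \<zero>"
  by (simp_all add: subspace_of_def)

lemma module_V: "module scalars V"
proof (rule module_scalarsI)
  interpret I: ideal I A by (rule ideal_I)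
  show "abelian_group V"
  proof (rule abelian_groupI)
    show "\<exists>y\<in>carrier V. y \<oplus>\<^bsub>V\<^esub> x = \<zero>\<^bsub>V\<^esub>" if "x \<in> carrier V" for x
      using that by (intro bexI[of _ "\<ominus> x"]) (auto simp: V_simps I.a_Hcarr l_neg I.a_inv_closed)
  qed (auto simp: V_simps I.a_Hcarr a_ac)
qed (auto simp: V_simps smult_carrier \<eta>_smult I_iff module_scalars_l_distr[OF module_A]
      module_scalars_r_distr[OF module_A] module_scalars_assoc[OF module_A]
      module_scalars_one[OF module_A])

lemma I2_subset: "I2 \<subseteq> I"
  using ideal_prod_inter[OF ideal_I ideal_I] by simp

lemma smult_I2: "w \<in> I2 \<Longrightarrow> c \<odot> w \<in> I2"
proof (induct rule: ideal_prod.induct)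
  case (prod i j)
  then have "c \<odot> (i \<otimes> j) = (c \<odot> i) \<otimes> j" by (simp add: smult_left I_iff)
  then show ?case using ideal_prod.prod[OF smult_I[OF prod(1)] prod(2)] by simp
next
  case (sum s1 s2)
  then have "c \<odot> (s1 \<oplus> s2) = c \<odot> s1 \<oplus> c \<odot> s2"
    using I2_subset by (intro module_scalars_r_distr[OF module_A]) (auto simp: I_iff)
  then show ?case using ideal_prod.sum[OF sum(2,4)] by simp
qed

sublocale Q: quotient_module V I2
proof (rule quotient_moduleI[OF module_V])
  have "\<zero> \<in> I" using additive_subgroup.zero_closed[OF ideal.axioms(1)[OF ideal_I]] .
  then show "I2 \<noteq> {}" using ideal_prod.prod[of \<zero> I \<zero> I A] by auto
qed (use I2_subset smult_I2 in \<open>auto simp: V_simps intro: ideal_prod.sum\<close>)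

lemma indecomposables_eq: "indecomposables A \<eta> = Q.Q"
  by (simp add: indecomposables_def Let_def I_def)

lemma V_minus_add: "x \<in> I \<Longrightarrow> y \<in> I \<Longrightarrow> (x \<ominus>\<^bsub>V\<^esub> y) \<oplus> y = x"
  using abelian_group.minus_add_cancel[OF module_scalars_group[OF module_V], of x y]
  by (simp only: V_simps(1,2))

text \<open>
  The functionals on the indecomposables, seen as functionals on the augmentation ideal;
  in geometric language, tangent vectors at the point \<open>\<eta>\<close>. Only the
  values on the ideal matter.
\<close>

definition tangent_functional :: "('a \<Rightarrow> 'k) \<Rightarrow> bool" where
  "tangent_functional \<psi> \<longleftrightarrow> (\<forall>x\<in>I. \<forall>y\<in>I. \<psi> (x \<oplus> y) = \<psi> x + \<psi> y) \<and>
     (\<forall>x\<in>I. \<forall>k. \<psi> (k \<odot> x) = k * \<psi> x) \<and> (\<forall>w\<in>I2. \<psi> w = 0)"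

text \<open>
  The coefficients \<open>c\<close> depend on \<open>v\<close> but not on
  \<open>\<psi>\<close>; this uniformity is what later bounds the Lie rank.
\<close>

lemma tangent_functional_expansion:
  assumes "finite_dimensional (indecomposables A \<eta>)"
  shows "\<exists>(B :: 'a set set) r. finite B \<and> (\<forall>b\<in>B. r b \<in> I) \<and>
     (\<forall>v\<in>I. \<exists>c. \<forall>\<psi>. tangent_functional \<psi> \<longrightarrow> \<psi> v = (\<Sum>b\<in>B. c b * \<psi> (r b)))"
proof -
  obtain B where B: "finite B" "B \<subseteq> carrier Q.Q"
    and gen: "\<forall>X\<in>carrier Q.Q. \<exists>c. X = (\<Oplus>\<^bsub>Q.Q\<^esub>b\<in>B. c b \<odot>\<^bsub>Q.Q\<^esub> b)"
    using assms unfolding indecomposables_eq finite_dimensional_def by (elim exE conjE) (rule that)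
  have "\<forall>b\<in>B. \<exists>x. x \<in> I \<and> b = I2 +>\<^bsub>V\<^esub> x"
  proof
    fix b assume "b \<in> B"
    with B(2) have "b \<in> (\<lambda>x. I2 +>\<^bsub>V\<^esub> x) ` I" unfolding Q.carrier_quotient V_simps(1) ..
    then show "\<exists>x. x \<in> I \<and> b = I2 +>\<^bsub>V\<^esub> x" by (rule imageE) (intro exI conjI)
  qed
  from bchoice[OF this] obtain r where r': "\<forall>b\<in>B. r b \<in> I \<and> b = I2 +>\<^bsub>V\<^esub> r b" ..
  note r = conjunct1[OF bspec[OF r']] conjunct2[OF bspec[OF r'], symmetric]
  have "\<exists>c. \<forall>\<psi>. tangent_functional \<psi> \<longrightarrow> \<psi> v = (\<Sum>b\<in>B. c b * \<psi> (r b))"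
    if v: "v \<in> I" for v
  proof -
    have "I2 +>\<^bsub>V\<^esub> v \<in> carrier Q.Q" using v unfolding Q.carrier_quotient V_simps by blast
    from bspec[OF gen this] obtain c where c: "I2 +>\<^bsub>V\<^esub> v = (\<Oplus>\<^bsub>Q.Q\<^esub>b\<in>B. c b \<odot>\<^bsub>Q.Q\<^esub> b)" ..
    let ?s = "\<Oplus>\<^bsub>V\<^esub>b\<in>B. c b \<odot> r b"
    have mem: "c b \<odot> r b \<in> carrier V" if "b \<in> B" for b
      using r(1)[OF that] smult_I by (simp add: V_simps)
    have s: "?s \<in> carrier V"
      using mem by (intro abelian_monoid.finsum_closed[OF module_scalars_monoid[OF module_V]]) auto
    have "I2 +>\<^bsub>V\<^esub> ?s = (\<Oplus>\<^bsub>Q.Q\<^esub>b\<in>B. I2 +>\<^bsub>V\<^esub> (c b \<odot> r b))"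
      using mem by (intro Q.coset_finsum B(1))
    also have "\<dots> = (\<Oplus>\<^bsub>Q.Q\<^esub>b\<in>B. c b \<odot>\<^bsub>Q.Q\<^esub> b)"
    proof (rule abelian_monoid.finsum_cong'[OF module_scalars_monoid[OF Q.module_quotient] refl])
      show "I2 +>\<^bsub>V\<^esub> (c b \<odot> r b) = c b \<odot>\<^bsub>Q.Q\<^esub> b" if "b \<in> B" for b
        using Q.coset_smult[of "r b" "c b"] r[OF that] by (simp add: V_simps)
      show "(\<lambda>b. c b \<odot>\<^bsub>Q.Q\<^esub> b) \<in> B \<rightarrow> carrier Q.Q"
        using B(2) module_scalars_closed[OF Q.module_quotient] by blast
    qed
    finally have "I2 +>\<^bsub>V\<^esub> ?s = I2 +>\<^bsub>V\<^esub> v" unfolding c .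
    moreover have "v \<in> carrier V" using v by (simp only: V_simps(1))
    ultimately have w: "v \<ominus>\<^bsub>V\<^esub> ?s \<in> I2"
      using Q.coset_eq_iff[OF s] by blast
    have "\<psi> v = (\<Sum>b\<in>B. c b * \<psi> (r b))"
      if "tangent_functional \<psi>" for \<psi>
    proof -
      have add: "\<forall>x\<in>I. \<forall>y\<in>I. \<psi> (x \<oplus> y) = \<psi> x + \<psi> y"
        and smult: "\<forall>x\<in>I. \<forall>k. \<psi> (k \<odot> x) = k * \<psi> x" and zero: "\<forall>w\<in>I2. \<psi> w = 0"
        using that by (simp_all add: tangent_functional_def)
      from arg_cong[OF V_minus_add[OF v s[unfolded V_simps(1)], symmetric], of \<psi>]
      have "\<psi> v = \<psi> ((v \<ominus>\<^bsub>V\<^esub> ?s) \<oplus> ?s)" .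
      also have "\<dots> = \<psi> (v \<ominus>\<^bsub>V\<^esub> ?s) + \<psi> ?s"
        using add w I2_subset s unfolding V_simps(1) by blast
      also have "\<psi> ?s = (\<Sum>b\<in>B. \<psi> (c b \<odot> r b))"
        using add mem
        by (intro functional_finsum[OF module_scalars_group[OF module_V] _ B(1)])
          (simp_all only: V_simps(1,2))
      also have "\<dots> = (\<Sum>b\<in>B. c b * \<psi> (r b))"
        using smult r(1) by (intro sum.cong refl) blast
      finally show ?thesis using zero w by simp
    qed
    then show ?thesis by (intro exI allI impI)
  qed
  then have "\<forall>v\<in>I. \<exists>c. \<forall>\<psi>. tangent_functional \<psi> \<longrightarrow> \<psi> v = (\<Sum>b\<in>B. c b * \<psi> (r b))"
    by blast
  moreover have "\<forall>b\<in>B. r b \<in> I" using r(1) by blast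
  ultimately show ?thesis using B(1) by (intro exI conjI)
qed

text \<open>
  Modulo the square of the ideal, \<open>x j \<otimes> g j\<close> is \<open>\<eta> (g
  j) \<odot> x j\<close>: ideal generators span the indecomposables as a vector space.
\<close>

lemma finite_dimensional_indecomposables:
  assumes "finite J" and x: "\<And>j. j \<in> J \<Longrightarrow> x j \<in> I"
    and gen: "\<And>v. v \<in> I \<Longrightarrow> \<exists>g. (\<forall>j\<in>J. g j \<in> carrier A) \<and> v = (\<Oplus>\<^bsub>V\<^esub>j\<in>J. x j \<otimes> g j)"
  shows "finite_dimensional (indecomposables A \<eta>)"
  unfolding indecomposables_eq
proof (rule finite_dimensionalI[OF Q.module_quotient assms(1)])
  show "I2 +>\<^bsub>V\<^esub> x j \<in> carrier Q.Q" if "j \<in> J" for j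
    using x[OF that] unfolding Q.carrier_quotient V_simps by blast
  fix X assume "X \<in> carrier Q.Q"
  then obtain v where v: "v \<in> I" "X = I2 +>\<^bsub>V\<^esub> v"
    unfolding Q.carrier_quotient V_simps by blast
  from gen[OF v(1)] obtain g where g: "\<And>j. j \<in> J \<Longrightarrow> g j \<in> carrier A"
    and sum: "v = (\<Oplus>\<^bsub>V\<^esub>j\<in>J. x j \<otimes> g j)" by blast
  interpret I: ideal I A by (rule ideal_I)
  have mem: "x j \<otimes> g j \<in> I" if "j \<in> J" for j
    using x[OF that] g[OF that] by (rule I.I_r_closed)
  have "X = (\<Oplus>\<^bsub>Q.Q\<^esub>j\<in>J. I2 +>\<^bsub>V\<^esub> (x j \<otimes> g j))"
    unfolding v(2) sum using mem by (intro Q.coset_finsum assms(1)) (simp add: V_simps)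
  also have "\<dots> = (\<Oplus>\<^bsub>Q.Q\<^esub>j\<in>J. \<eta> (g j) \<odot>\<^bsub>Q.Q\<^esub> (I2 +>\<^bsub>V\<^esub> x j))"
  proof (rule abelian_monoid.finsum_cong'[OF module_scalars_monoid[OF Q.module_quotient] refl])
    show "(\<lambda>j. \<eta> (g j) \<odot>\<^bsub>Q.Q\<^esub> (I2 +>\<^bsub>V\<^esub> x j)) \<in> J \<rightarrow> carrier Q.Q"
      using x module_scalars_closed[OF Q.module_quotient] unfolding Q.carrier_quotient V_simps by blast
    fix j assume j: "j \<in> J"
    obtain u where u: "u \<in> I" "g j = u \<oplus> \<eta> (g j) \<odot> \<one>"
      using decompose[OF g[OF j]] .
    have xj: "x j \<in> carrier A" "u \<in> carrier A" using x[OF j] u(1) by (auto simp: I_iff)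
    have "x j \<otimes> g j = x j \<otimes> u \<oplus> \<eta> (g j) \<odot> x j"
      by (subst u(2)) (simp add: r_distr xj smult_carrier smult_right)
    moreover have "x j \<otimes> u \<in> I2" using x[OF j] u(1) by (rule ideal_prod.prod)
    moreover have "I2 +>\<^bsub>V\<^esub> (w \<oplus> y) = I2 +>\<^bsub>V\<^esub> y" if "w \<in> I2" "y \<in> I" for w y
    proof -
      have "w \<oplus> y \<in> I2 +>\<^bsub>V\<^esub> y"
        using that unfolding a_r_coset_def' V_simps by blast
      then show ?thesis
        using Q.a_repr_independence[OF _ _ Q.subgroup, of "w \<oplus> y" y] that(2) by (simp add: V_simps)
    qed
    ultimately have "I2 +>\<^bsub>V\<^esub> (x j \<otimes> g j) = I2 +>\<^bsub>V\<^esub> (\<eta> (g j) \<odot> x j)"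
      using smult_I[OF x[OF j]] by simp
    then show "I2 +>\<^bsub>V\<^esub> (x j \<otimes> g j) = \<eta> (g j) \<odot>\<^bsub>Q.Q\<^esub> (I2 +>\<^bsub>V\<^esub> x j)"
      using Q.coset_smult[of "x j" "\<eta> (g j)"] x[OF j] by (simp add: V_simps)
  qed
  finally show "\<exists>c. X = (\<Oplus>\<^bsub>Q.Q\<^esub>j\<in>J. c j \<odot>\<^bsub>Q.Q\<^esub> (I2 +>\<^bsub>V\<^esub> x j))"
    by (rule exI[of _ "\<lambda>j. \<eta> (g j)"])
qed

end

section \<open>Augmentations of power series algebras\<close>

text \<open>
  The reciprocal of \<open>F\<close>, obtained by solving \<open>F * G = 1\<close> for
  the coefficient \<open>G m\<close> in terms of coefficients of lower degree.
\<close>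

function inverse_series :: "((nat \<Rightarrow>\<^sub>0 nat) \<Rightarrow> 'k::field) \<Rightarrow> (nat \<Rightarrow>\<^sub>0 nat) \<Rightarrow> 'k" where
  "inverse_series F m = (if m = 0 then inverse (F 0)
     else - inverse (F 0) * (\<Sum>b\<in>{b. (\<exists>a. a + b = m) \<and> b \<noteq> m}. F (m - b) * inverse_series F b))"
  by auto
termination
proof (relation "measure (mdeg \<circ> snd)")
  fix F :: "(nat \<Rightarrow>\<^sub>0 nat) \<Rightarrow> 'k" and m b :: "nat \<Rightarrow>\<^sub>0 nat"
  assume "b \<in> {b. (\<exists>a. a + b = m) \<and> b \<noteq> m}"
  then obtain a where "a + b = m" "a \<noteq> 0" by auto
  then show "((F, b), F, m) \<in> measure (mdeg \<circ> snd)"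
    using mdeg_eq_0_iff[of a] by (auto simp: mdeg_add)
qed simp

declare inverse_series.simps [simp del]

lemma antidiagonal_snd:
  fixes F G :: "(nat \<Rightarrow>\<^sub>0 nat) \<Rightarrow> 'k::field"
  shows "(\<Sum>(a, b)\<in>{(a, b). a + b = m}. F a * G b) = (\<Sum>b\<in>{b. \<exists>a. a + b = m}. F (m - b) * G b)"
  by (rule sum.reindex_bij_witness[of _ "\<lambda>b. (m - b, b)" snd]) auto

lemma inverse_series_mult:
  assumes "F 0 \<noteq> 0"
  shows "(\<Sum>(a, b)\<in>{(a, b). a + b = m}. F a * inverse_series F b) = (if m = 0 then 1 else 0)"
proof (cases "m = 0")
  case True
  have "{(a, b). a + b = (0 :: nat \<Rightarrow>\<^sub>0 nat)} = {(0, 0)}"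
    by (auto simp: mdeg_eq_0_iff[symmetric] mdeg_add)
  then show ?thesis using True assms by (simp add: inverse_series.simps)
next
  case False
  let ?B = "{b. \<exists>a. a + b = m}"
  have "?B = snd ` {(a, b). a + b = m}" by force
  then have fin: "finite ?B" using finite_antidiagonal[of m] by simp
  have "?B - {m} = {b. (\<exists>a. a + b = m) \<and> b \<noteq> m}" by auto
  moreover have "(\<Sum>b\<in>?B. F (m - b) * inverse_series F b)
      = F (m - m) * inverse_series F m + (\<Sum>b\<in>?B - {m}. F (m - b) * inverse_series F b)"
    by (rule sum.remove[OF fin]) (auto intro: exI[of _ 0])
  ultimately show ?thesis
    unfolding antidiagonal_snd using False assms
    by (simp add: inverse_series.simps[of F m])
qed

lemma inverse_series_carrier:
  assumes F: "\<And>m. \<not> Poly_Mapping.keys m \<subseteq> {..<N} \<Longrightarrow> F m = 0"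
    and m: "\<not> Poly_Mapping.keys m \<subseteq> {..<N}"
  shows "inverse_series F m = 0"
  using m
proof (induct "mdeg m" arbitrary: m rule: less_induct)
  case less
  have "F (m - b) * inverse_series F b = 0" if b: "b \<in> {b. (\<exists>a. a + b = m) \<and> b \<noteq> m}" for b
  proof -
    obtain a where a: "a + b = m" "a \<noteq> 0" using b by auto
    then have "mdeg b < mdeg m" using mdeg_eq_0_iff[of a] by (auto simp: mdeg_add)
    moreover have "\<not> Poly_Mapping.keys a \<subseteq> {..<N} \<or> \<not> Poly_Mapping.keys b \<subseteq> {..<N}"
      using less.prems a(1) by (auto simp: keys_add_nat)
    ultimately have "F a = 0 \<or> inverse_series F b = 0" using F less.hyps by blast
    moreover have "m - b = a" using a(1) by auto
    ultimately show ?thesis by auto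
  qed
  then have "(\<Sum>b\<in>{b. (\<exists>a. a + b = m) \<and> b \<noteq> m}. F (m - b) * inverse_series F b) = 0"
    by (intro sum.neutral) blast
  moreover have "m \<noteq> 0" using less.prems by auto
  ultimately show ?case by (simp add: inverse_series.simps[of F m])
qed

definition variable :: "nat \<Rightarrow> (nat \<Rightarrow>\<^sub>0 nat) \<Rightarrow> 'k::field" where
  "variable i m = (if m = Poly_Mapping.single i 1 then 1 else 0)"

lemma variable_mult:
  "(\<Sum>(a, b)\<in>{(a, b). a + b = m}. variable i a * G b)
   = (if i \<in> Poly_Mapping.keys m then G (m - Poly_Mapping.single i 1) else 0)"
proof (cases "i \<in> Poly_Mapping.keys m")
  case True
  then obtain n where m: "m = n + Poly_Mapping.single i 1" by (rule remove_variable)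
  have "(\<Sum>(a, b)\<in>{(a, b). a + b = m}. variable i a * G b)
      = (\<Sum>x\<in>{(a, b). a + b = m}. if x = (Poly_Mapping.single i 1, n) then G n else 0)"
    by (intro sum.cong refl) (auto simp: variable_def m add.commute[of n] split: if_splits)
  also have "\<dots> = G n"
    using finite_antidiagonal[of m] by (simp add: m add.commute)
  finally show ?thesis using True by (simp add: m)
next
  case False
  then have "variable i a * G b = 0" if "a + b = m" for a b
    using that by (auto simp: variable_def keys_add_nat)
  then have "(\<Sum>(a, b)\<in>{(a, b). a + b = m}. variable i a * G b) = 0"
    by (intro sum.neutral) auto
  then show ?thesis using False by simp
qed

text \<open>
  Each monomial of a series without constant term is attributed to its smallest variable
  \<open>i\<close>; the quotients by \<open>i\<close> of the monomials attributed to
  \<open>i\<close> form this series.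
\<close>

definition part_led_by :: "nat \<Rightarrow> ((nat \<Rightarrow>\<^sub>0 nat) \<Rightarrow> 'k::field) \<Rightarrow> (nat \<Rightarrow>\<^sub>0 nat) \<Rightarrow> 'k" where
  "part_led_by i F m = (if Min (Poly_Mapping.keys (m + Poly_Mapping.single i 1)) = i
     then F (m + Poly_Mapping.single i 1) else 0)"

lemma sum_variables:
  assumes F: "\<And>m. \<not> Poly_Mapping.keys m \<subseteq> {..<N} \<Longrightarrow> F m = 0" and "F 0 = 0"
  shows "F m = (\<Sum>i<N. \<Sum>(a, b)\<in>{(a, b). a + b = m}. variable i a * part_led_by i F b)"
proof -
  have "(\<Sum>(a, b)\<in>{(a, b). a + b = m}. variable i a * part_led_by i F b)
      = (if i \<in> Poly_Mapping.keys m \<and> Min (Poly_Mapping.keys m) = i then F m else 0)" for i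
  proof (cases "i \<in> Poly_Mapping.keys m")
    case True
    then obtain n where m: "m = n + Poly_Mapping.single i 1" by (rule remove_variable)
    show ?thesis unfolding variable_mult using True by (simp add: part_led_by_def m)
  qed (simp add: variable_mult)
  then have sum: "(\<Sum>i<N. \<Sum>(a, b)\<in>{(a, b). a + b = m}. variable i a * part_led_by i F b)
      = (\<Sum>i<N. if i \<in> Poly_Mapping.keys m \<and> Min (Poly_Mapping.keys m) = i then F m else 0)"
    by simp
  show ?thesis
  proof (cases "m = 0 \<or> \<not> Poly_Mapping.keys m \<subseteq> {..<N}")
    case True
    then have zero: "F m = 0" using assms by blast
    show ?thesis unfolding sum zero by simp
  next
    case False
    then have "Poly_Mapping.keys m \<noteq> {}" by (auto intro: poly_mapping_eqI simp: in_keys_iff)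
    then have Min: "Min (Poly_Mapping.keys m) \<in> Poly_Mapping.keys m" by simp
    have "(\<Sum>i<N. if i \<in> Poly_Mapping.keys m \<and> Min (Poly_Mapping.keys m) = i then F m else 0)
        = (\<Sum>i<N. if i = Min (Poly_Mapping.keys m) then F m else 0)"
      using Min by (intro sum.cong) auto
    also have "\<dots> = F m"
    proof -
      have "Min (Poly_Mapping.keys m) < N" using Min False by blast
      then show ?thesis by simp
    qed
    finally show ?thesis unfolding sum by simp
  qed
qed

text \<open>
  An element with nonzero constant coefficient is a unit, so an augmentation cannot kill
  it; hence the augmentation is the constant coefficient. Its kernel is generated by the
  variables.
\<close>

lemma (in augmented) power_series_indecomposables:
  assumes iso: "\<phi> \<in> alg_iso A (power_series N)"
  shows "finite_dimensional (indecomposables A \<eta>)"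
proof -
  let ?P = "power_series N :: ('k, (nat \<Rightarrow>\<^sub>0 nat) \<Rightarrow> 'k) module"
  let ?inv = "inv_into (carrier A) \<phi>"
  have bij: "bij_betw \<phi> (carrier A) (carrier ?P)"
    and \<phi>_mult: "\<And>x y m. x \<in> carrier A \<Longrightarrow> y \<in> carrier A \<Longrightarrow>
       \<phi> (x \<otimes> y) m = (\<Sum>(a, b)\<in>{(a, b). a + b = m}. \<phi> x a * \<phi> y b)"
    and \<phi>_add: "\<And>x y m. x \<in> carrier A \<Longrightarrow> y \<in> carrier A \<Longrightarrow> \<phi> (x \<oplus> y) m = \<phi> x m + \<phi> y m"
    and \<phi>_one: "\<phi> \<one> = (\<lambda>m. if m = 0 then 1 else 0)"
    and \<phi>_smult: "\<And>c x m. x \<in> carrier A \<Longrightarrow> \<phi> (c \<odot> x) m = c * \<phi> x m"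
    using iso by (auto simp: alg_iso_def alg_hom_def ring_hom_def power_series_simps)
  have inv: "?inv F \<in> carrier A" "\<phi> (?inv F) = F" if "F \<in> carrier ?P" for F
    using bij that by (auto simp: bij_betw_def inv_into_into f_inv_into_f)
  have inj: "x = y" if "x \<in> carrier A" "y \<in> carrier A" "\<And>m. \<phi> x m = \<phi> y m" for x y
    using bij that by (auto simp: bij_betw_def inj_on_def fun_eq_iff)
  have outside: "\<phi> x m = 0" if "x \<in> carrier A" "\<not> Poly_Mapping.keys m \<subseteq> {..<N}" for x m
    using bij_betwE[OF bij] that unfolding power_series_simps by blast
  have unit: "\<eta> v \<noteq> 0" if v: "v \<in> carrier A" "\<phi> v 0 \<noteq> 0" for v
  proof -
    let ?w = "?inv (inverse_series (\<phi> v))"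
    have "inverse_series (\<phi> v) \<in> carrier ?P"
      using inverse_series_carrier[of N "\<phi> v"] outside[OF v(1)] by (simp add: power_series_simps)
    note w = inv[OF this]
    have "v \<otimes> ?w = \<one>"
      using v w by (intro inj) (simp_all add: \<phi>_mult \<phi>_one inverse_series_mult)
    then have "\<eta> v * \<eta> ?w = 1" using \<eta>_mult[OF v(1) w(1)] \<eta>_one by simp
    then show ?thesis by auto
  qed
  have const: "\<eta> v = \<phi> v 0" if v: "v \<in> carrier A" for v
  proof -
    let ?u = "v \<oplus> (- \<eta> v) \<odot> \<one>"
    have "\<eta> ?u = 0" using v by (simp add: \<eta>_add \<eta>_smult \<eta>_one smult_carrier)
    moreover have "?u \<in> carrier A" using v smult_carrier by simp
    ultimately have "\<phi> ?u 0 = 0" using unit by blast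
    then show ?thesis using v by (simp add: \<phi>_add \<phi>_smult \<phi>_one smult_carrier)
  qed
  show ?thesis
  proof (rule finite_dimensional_indecomposables[of "{..<N}" "\<lambda>i. ?inv (variable i)"])
    have var: "variable i \<in> carrier ?P" if "i < N" for i
      using that by (auto simp: power_series_simps variable_def)
    show var_I: "?inv (variable i) \<in> I" if i: "i \<in> {..<N}" for i
    proof -
      have "(0 :: nat \<Rightarrow>\<^sub>0 nat) \<noteq> Poly_Mapping.single i 1" by (auto dest: arg_cong[of _ _ mdeg])
      then show ?thesis
        using i inv[OF var] const[OF inv(1)[OF var]] by (simp add: I_iff variable_def)
    qed
    fix v assume "v \<in> I"
    then have v: "v \<in> carrier A" "\<phi> v 0 = 0" using const by (auto simp: I_iff)
    let ?g = "\<lambda>i. ?inv (part_led_by i (\<phi> v))"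
    have "part_led_by i (\<phi> v) \<in> carrier ?P" for i
      using outside[OF v(1)] by (auto simp: power_series_simps part_led_by_def keys_add_nat)
    note g = inv[OF this]
    interpret I: ideal I A by (rule ideal_I)
    have mem: "?inv (variable i) \<otimes> ?g i \<in> I" if "i \<in> {..<N}" for i
      using I.I_r_closed[OF var_I[OF that] g(1)] .
    have sum_V: "(\<Oplus>\<^bsub>V\<^esub>i\<in>{..<N}. ?inv (variable i) \<otimes> ?g i) \<in> carrier V"
      using mem
      by (intro abelian_monoid.finsum_closed[OF module_scalars_monoid[OF module_V]])
        (auto simp: V_simps)
    have "v = (\<Oplus>\<^bsub>V\<^esub>i\<in>{..<N}. ?inv (variable i) \<otimes> ?g i)"
    proof (rule inj[OF v(1)])
      show "(\<Oplus>\<^bsub>V\<^esub>i\<in>{..<N}. ?inv (variable i) \<otimes> ?g i) \<in> carrier A"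
        using sum_V by (simp add: V_simps I_iff)
      fix m
      have "\<phi> (\<Oplus>\<^bsub>V\<^esub>i\<in>{..<N}. ?inv (variable i) \<otimes> ?g i) m
          = (\<Sum>i<N. \<phi> (?inv (variable i) \<otimes> ?g i) m)"
        using mem
        by (intro functional_finsum[of V "\<lambda>x. \<phi> x m"] module_scalars_group[OF module_V])
          (auto simp: V_simps I_iff \<phi>_add)
      also have "\<dots> = (\<Sum>i<N. \<Sum>(a, b)\<in>{(a, b). a + b = m}. variable i a * part_led_by i (\<phi> v) b)"
        using var_I inv(2)[OF var] g by (intro sum.cong refl) (simp add: \<phi>_mult I_iff)
      also have "\<dots> = \<phi> v m"
        using sum_variables[of N "\<phi> v" m] outside[OF v(1)] v(2) by simp
      finally show "\<phi> v m = \<phi> (\<Oplus>\<^bsub>V\<^esub>i\<in>{..<N}. ?inv (variable i) \<otimes> ?g i) m" ..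
    qed
    then show "\<exists>g. (\<forall>i\<in>{..<N}. g i \<in> carrier A) \<and> v = (\<Oplus>\<^bsub>V\<^esub>i\<in>{..<N}. ?inv (variable i) \<otimes> g i)"
      using g(1) by (intro exI[of _ ?g]) simp
  qed simp
qed

section \<open>Finite Lie rank from differential production\<close>

text \<open>
  With \<open>\<phi> a h = \<eta> (a \<triangleleft> h)\<close>, the map
  \<open>\<phi>\<close> carries the product of \<open>R\<close> to the convolution
  product. So for primitive \<open>l\<close> the map \<open>a \<mapsto> \<phi> a
  l\<close> is an \<open>\<eta>\<close>-derivation, and \<open>p (g * l) = \<phi> (f
  \<triangleleft> g) l\<close> depends on \<open>l\<close> only through its values on
  finitely many elements.
\<close>

lemma (in bialgebra) production_finite_lie_rank:
  fixes R :: "('k, 'r) module"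
  assumes p: "lin p" and prod: "differentially_produced scale comult R \<eta> p"
    and fd: "finite_dimensional (indecomposables R \<eta>)"
  shows "finite_lie_rank scale comult counit p"
proof -
  obtain act f where aug: "augmented_algebra R \<eta>" and act: "right_module_algebra scale comult R act"
    and f: "f \<in> carrier R" and pf: "\<And>h. p h = \<eta> (act f h)"
    using prod unfolding differentially_produced_def by blast
  interpret R: augmented R \<eta> by (rule augmented.intro[OF aug])
  interpret M: right_module_algebra scale comult R act by (rule act)
  define \<phi> where "\<phi> a h = \<eta> (act a h)" for a h
  have lin: "lin (\<phi> a)" if "a \<in> carrier R" for a
    using that
    by (intro linI) (simp_all add: \<phi>_def M.act_add_right M.act_smult_right M.act_closed R.\<eta>_add R.\<eta>_smult)
  have \<phi>_add: "\<phi> (a \<oplus>\<^bsub>R\<^esub> b) h = \<phi> a h + \<phi> b h" if "a \<in> carrier R" "b \<in> carrier R" for a b h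
    using that by (simp add: \<phi>_def M.act_add_left M.act_closed R.\<eta>_add)
  have \<phi>_smult: "\<phi> (c \<odot>\<^bsub>R\<^esub> a) h = c * \<phi> a h" if "a \<in> carrier R" for a c h
    using that by (simp add: \<phi>_def M.act_smult_left M.act_closed R.\<eta>_smult)
  have \<phi>_one: "\<phi> a 1 = \<eta> a" if "a \<in> carrier R" for a
    using that by (simp add: \<phi>_def M.act_one)
  have \<phi>_mult: "\<phi> (a \<otimes>\<^bsub>R\<^esub> b) h = conv (\<phi> a) (\<phi> b) h" if ab: "a \<in> carrier R" "b \<in> carrier R" for a b h
  proof -
    let ?t = "\<lambda>vw. act a (fst vw) \<otimes>\<^bsub>R\<^esub> act b (snd vw)"
    have t: "?t vw \<in> carrier R" for vw
      using ab by (intro R.m_closed M.act_closed)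
    have "\<phi> (a \<otimes>\<^bsub>R\<^esub> b) h = \<eta> (\<Oplus>\<^bsub>R\<^esub>vw\<in>Poly_Mapping.keys (rep h). Poly_Mapping.lookup (rep h) vw \<odot>\<^bsub>R\<^esub> ?t vw)"
      using ab by (simp add: \<phi>_def M.mult_act tensor_lift_comult)
    also have "\<dots> = (\<Sum>vw\<in>Poly_Mapping.keys (rep h). \<eta> (Poly_Mapping.lookup (rep h) vw \<odot>\<^bsub>R\<^esub> ?t vw))"
      using R.smult_carrier[OF t]
      by (intro functional_finsum R.abelian_group_axioms R.\<eta>_add) auto
    also have "\<dots> = conv (\<phi> a) (\<phi> b) h"
      using t ab
      by (simp add: R.\<eta>_smult R.\<eta>_mult M.act_closed conv_def sweedler_def lin_ext_def \<phi>_def)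
    finally show ?thesis .
  qed
  have \<phi>_I2: "\<phi> w l = 0" if w: "w \<in> R.I2" and l: "l \<in> prims" for w l
    using w
  proof (induct rule: ideal_prod.induct)
    case (prod i j)
    then show ?case
      using l by (simp add: R.I_iff \<phi>_mult lin conv_primitive \<phi>_one)
  next
    case (sum s1 s2)
    then show ?case using R.I2_subset by (auto simp: \<phi>_add R.I_iff subset_iff)
  qed
  \<comment> \<open>derivations kill \<open>1 = 1 \<otimes> 1\<close>\<close>
  have unit: "\<phi> \<one>\<^bsub>R\<^esub> l = 0" if l: "l \<in> prims" for l
  proof -
    have "\<phi> \<one>\<^bsub>R\<^esub> l = \<phi> (\<one>\<^bsub>R\<^esub> \<otimes>\<^bsub>R\<^esub> \<one>\<^bsub>R\<^esub>) l" by simp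
    also have "\<dots> = \<phi> \<one>\<^bsub>R\<^esub> l + \<phi> \<one>\<^bsub>R\<^esub> l"
      using l by (simp only: \<phi>_mult R.one_closed lin conv_primitive \<phi>_one R.\<eta>_one) simp
    finally show ?thesis by (metis add_cancel_right_right)
  qed
  obtain B :: "'r set set" and r where B: "finite B" "\<forall>b\<in>B. r b \<in> R.I"
    and gen: "\<forall>v\<in>R.I. \<exists>c. \<forall>\<psi>. R.tangent_functional \<psi> \<longrightarrow> \<psi> v = (\<Sum>b\<in>B. c b * \<psi> (r b))"
    using R.tangent_functional_expansion[OF fd] by (elim exE conjE) (rule that)
  have tangent: "R.tangent_functional (\<lambda>v. \<phi> v l)" if "l \<in> prims" for l
    using \<phi>_I2[OF _ that] by (simp add: R.tangent_functional_def R.I_iff \<phi>_add \<phi>_smult)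
  have expand: "\<exists>c. \<forall>l\<in>prims. p (g * l) = (\<Sum>b\<in>B. c b * \<phi> (r b) l)" for g
  proof -
    have fg: "act f g \<in> carrier R" using f by (rule M.act_closed)
    obtain v where v: "v \<in> R.I" "act f g = v \<oplus>\<^bsub>R\<^esub> \<eta> (act f g) \<odot>\<^bsub>R\<^esub> \<one>\<^bsub>R\<^esub>"
      using R.decompose[OF fg] .
    from bspec[OF gen v(1)] obtain c
      where c: "\<forall>\<psi>. R.tangent_functional \<psi> \<longrightarrow> \<psi> v = (\<Sum>b\<in>B. c b * \<psi> (r b))" ..
    have "p (g * l) = (\<Sum>b\<in>B. c b * \<phi> (r b) l)" if l: "l \<in> prims" for l
    proof -
      have "p (g * l) = \<phi> (act f g) l"
        using f by (simp add: pf \<phi>_def M.act_mult)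
      also have "\<dots> = \<phi> v l"
        using v(1) unit[OF l]
        by (subst v(2)) (simp add: \<phi>_add \<phi>_smult R.I_iff R.smult_carrier)
      also have "\<dots> = (\<Sum>b\<in>B. c b * \<phi> (r b) l)"
        by (rule mp[OF spec[OF c, of "\<lambda>v. \<phi> v l"] tangent[OF l]])
      finally show ?thesis .
    qed
    then show ?thesis by blast
  qed
  have lin_r: "lin (\<phi> (r b))" if "b \<in> B" for b
  proof (rule lin)
    show "r b \<in> carrier R" using bspec[OF B(2) that] by (simp only: R.I_iff)
  qed
  have "\<exists>C. finite C \<and> C \<subseteq> prims \<and>
      (\<forall>l\<in>prims. \<exists>c. \<forall>b\<in>B. \<phi> (r b) l = (\<Sum>u\<in>C. c u * \<phi> (r b) u))"
    by (rule finite_functionals[OF vector_space_axioms subspace_primitives B(1)])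
      (simp_all add: lin_add[OF lin_r] lin_scale[OF lin_r])
  then obtain C where C: "finite C" "C \<subseteq> prims"
    and span: "\<forall>l\<in>prims. \<exists>c. \<forall>b\<in>B. \<phi> (r b) l = (\<Sum>u\<in>C. c u * \<phi> (r b) u)"
    by (elim exE conjE) (rule that)
  show ?thesis
    unfolding finite_lie_rank_def
  proof (rule finite_dimensionalI[OF module_hit_space[OF p] C(1), of "\<lambda>u. u \<rightharpoonup> p"])
    show "u \<rightharpoonup> p \<in> carrier (subspace_of dual (hit_space p))" if "u \<in> C" for u
      using that C(2) by (auto simp: subspace_of_def)
    fix q assume "q \<in> carrier (subspace_of dual (hit_space p))"
    then obtain l where l: "l \<in> prims" "q = l \<rightharpoonup> p" by (auto simp: subspace_of_def)
    from bspec[OF span l(1)] obtain c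
      where c: "\<forall>b\<in>B. \<phi> (r b) l = (\<Sum>u\<in>C. c u * \<phi> (r b) u)" ..
    have expand_l: "p (g * l) = (\<Sum>u\<in>C. c u * p (g * u))" for g
    proof -
      from expand[of g] obtain k where k: "\<forall>l\<in>prims. p (g * l) = (\<Sum>b\<in>B. k b * \<phi> (r b) l)" ..
      have "p (g * l) = (\<Sum>b\<in>B. \<Sum>u\<in>C. c u * (k b * \<phi> (r b) u))"
        unfolding bspec[OF k l(1)]
      proof (rule sum.cong[OF refl])
        fix b assume "b \<in> B"
        from bspec[OF c this] show "k b * \<phi> (r b) l = (\<Sum>u\<in>C. c u * (k b * \<phi> (r b) u))"
          by (simp only: sum_distrib_left mult.left_commute)
      qed
      also have "\<dots> = (\<Sum>u\<in>C. c u * (\<Sum>b\<in>B. k b * \<phi> (r b) u))"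
        unfolding sum_distrib_left by (rule sum.swap)
      also have "\<dots> = (\<Sum>u\<in>C. c u * p (g * u))"
      proof (rule sum.cong[OF refl])
        fix u assume "u \<in> C"
        then show "c u * (\<Sum>b\<in>B. k b * \<phi> (r b) u) = c u * p (g * u)"
          using k C(2) by (simp only: subset_iff)
      qed
      finally show ?thesis .
    qed
    have sum: "(\<Oplus>\<^bsub>subspace_of dual (hit_space p)\<^esub>u\<in>C.
        c u \<odot>\<^bsub>subspace_of dual (hit_space p)\<^esub> (u \<rightharpoonup> p)) = (\<lambda>g. \<Sum>u\<in>C. c u * (u \<rightharpoonup> p) g)"
    proof (rule hit_space_finsum[OF p C(1)])
      show "u \<rightharpoonup> p \<in> hit_space p" if "u \<in> C" for u
        using C(2) that by (intro imageI) (rule subsetD)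
    qed
    have "q = (\<Oplus>\<^bsub>subspace_of dual (hit_space p)\<^esub>u\<in>C.
        c u \<odot>\<^bsub>subspace_of dual (hit_space p)\<^esub> (u \<rightharpoonup> p))"
      unfolding sum unfolding l(2) left_hit_def by (rule ext) (rule expand_l)
    then show "\<exists>c. q = (\<Oplus>\<^bsub>subspace_of dual (hit_space p)\<^esub>u\<in>C.
        c u \<odot>\<^bsub>subspace_of dual (hit_space p)\<^esub> (u \<rightharpoonup> p))"
      by (rule exI[of _ c])
  qed
qed

section \<open>The equivalence\<close>

theorem theorem1p1:
  fixes scale :: "'k::field_char_0 \<Rightarrow> 'h::ring_1 \<Rightarrow> 'h"
    and comult :: "'h \<Rightarrow> ('h \<times> 'h \<Rightarrow>\<^sub>0 'k) set"
    and counit :: "'h \<Rightarrow> 'k"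
    and p :: "'h \<Rightarrow> 'k"
  assumes "bialgebra scale comult counit"
    and "primitively_generated scale comult"
    and "p \<in> carrier (dual_algebra scale comult counit)"
  shows
    "(finite_lie_rank scale comult counit p \<longleftrightarrow>
        (\<exists>(R :: ('k, 'h \<Rightarrow> 'k) module) \<eta>.
           differentially_produced scale comult R \<eta> p \<and>
           finite_dimensional (indecomposables R \<eta>))) \<and>
     (\<forall>(R :: ('k, 'r) module) \<eta>.
        differentially_produced scale comult R \<eta> p \<and>
        finite_dimensional (indecomposables R \<eta>) \<longrightarrow>
        finite_lie_rank scale comult counit p) \<and>
     (finite_lie_rank scale comult counit p \<longleftrightarrow>
        (\<exists>S N \<eta>.
           is_subalgebra S (dual_algebra scale comult counit) \<and>
           alg_iso ((dual_algebra scale comult counit)\<lparr>carrier := S\<rparr>) (power_series N) \<noteq> {} \<and>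
           differentially_produced scale comult
             ((dual_algebra scale comult counit)\<lparr>carrier := S\<rparr>) \<eta> p))"
    (is "(?fin \<longleftrightarrow> (\<exists>(R :: ('k, 'h \<Rightarrow> 'k) module) \<eta>. ?gen R \<eta>)) \<and> _ \<and>
      (_ \<longleftrightarrow> (\<exists>S N \<eta>. ?sub S N \<eta>))")
proof -
  have H: "primitively_generated_bialgebra scale comult counit"
    by (intro primitively_generated_bialgebra.intro assms
        primitively_generated_bialgebra_axioms.intro)
  interpret primitively_generated_bialgebra scale comult counit by (rule H)
  have p: "lin p" using assms(3) by simp
  have 1: "\<exists>S N \<eta>. ?sub S N \<eta>" if ?fin
  proof -
    obtain N :: nat and e d where *: "\<forall>i<N. e i \<in> prims"
      "\<forall>i<N. \<forall>j<N. p (d j * e i) = (if i = j then 1 else 0)"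
      "\<forall>l\<in>prims. \<forall>x. p (x * l) = (\<Sum>i<N. p (d i * l) * p (x * e i))"
      using finite_lie_rank_coordinates[OF p \<open>?fin\<close>] by (elim exE conjE) (rule that)
    interpret lie_coordinates scale comult counit p N e d
      by (intro lie_coordinates.intro[OF H] lie_coordinates_axioms.intro p)
        (fact *(1)[rule_format] *(2)[rule_format] *(3)[rule_format])+
    show ?thesis
      using invariants_subalgebra taylor_iso produced_by_invariants by blast
  qed
  have 2: "?gen (dual\<lparr>carrier := S\<rparr>) \<eta>" if sub: "?sub S N \<eta>" for S N \<eta>
  proof -
    have "augmented_algebra (dual\<lparr>carrier := S\<rparr>) \<eta>"
      using sub by (simp add: differentially_produced_def)
    then interpret R: augmented "dual\<lparr>carrier := S\<rparr>" \<eta> by (rule augmented.intro)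
    show ?thesis
      using sub R.power_series_indecomposables by blast
  qed
  show ?thesis
  proof (intro conjI iffI allI impI)
    assume ?fin
    from 1[OF this] obtain S N \<eta> where "?sub S N \<eta>" by (elim exE) (rule that)
    from 2[OF this] show "\<exists>(R :: ('k, 'h \<Rightarrow> 'k) module) \<eta>. ?gen R \<eta>" by (intro exI)
  next
    assume "\<exists>(R :: ('k, 'h \<Rightarrow> 'k) module) \<eta>. ?gen R \<eta>"
    then show ?fin by (elim exE conjE) (rule production_finite_lie_rank[OF p])
  next
    fix R :: "('k, 'r) module" and \<eta>
    assume "differentially_produced scale comult R \<eta> p \<and> finite_dimensional (indecomposables R \<eta>)"
    then show ?fin by (elim conjE) (rule production_finite_lie_rank[OF p])
  next
    assume ?fin
    then show "\<exists>S N \<eta>. ?sub S N \<eta>" by (rule 1)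
  next
    assume "\<exists>S N \<eta>. ?sub S N \<eta>"
    then obtain S N \<eta> where "?sub S N \<eta>" by (elim exE) (rule that)
    from 2[OF this] show ?fin by (elim conjE) (rule production_finite_lie_rank[OF p])
  qed
qed

end
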